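(* Let $n\geq 2$, let $k$ be an infinite field with algebraic closure $\overline k$, and let $\underline x=(x_1,\ldots,x_n)$. Let $A,B\in k[\underline x]$ be two nonzero relatively prime polynomials. Let $\mathcal{I}rr_n(\overline k,A,B)$ be the set of polynomials $M\in\overline k[\underline x]$ such that $A+BM$ is irreducible in $\overline k[\underline x]$. Then for every $n$-tuple $\underline d=(d_1,\ldots,d_n)$ of positive integers, $\mathcal{I}rr_n(\overline k,A,B)$ contains a nonempty Zariski open subset of $\mathcal{P}ol_{k,n,\underline d}(k)$.
   Context: $\mathcal{P}ol_{k,n,\underline d}(k)$ is the set of polynomials $M\in k[\underline x]$ with $\deg_{x_i}(M)\leq d_i$ for $i=1,\ldots,n$, identified via coefficients with the affine space $k^{N+1}$, $N+1=\prod_i(d_i+1)$, endowed with its Zariski topology. *)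

theory Defs
  imports
    "HOL-Library.Poly_Mapping"
    "HOL-Analysis.Analysis"
    "HOL-Algebra.Algebraic_Closure_Type"
begin

text \<open>
  The ring k[x] in indeterminates indexed by \<open>'v\<close> is the monoid algebra
  \<open>('v \<Rightarrow>\<^sub>0 nat) \<Rightarrow>\<^sub>0 'k\<close>: finitely supported coefficient functions on exponent vectors,
  with the convolution product provided by \<open>HOL-Library.Poly_Mapping\<close>.
\<close>

type_synonym ('v, 'k) mpol = "('v \<Rightarrow>\<^sub>0 nat) \<Rightarrow>\<^sub>0 'k"


section \<open>Evaluation\<close>

definition mpol_eval :: "('v \<Rightarrow> 'k) \<Rightarrow> ('v, 'k::comm_ring_1) mpol \<Rightarrow> 'k" where
  "mpol_eval x f =
     (\<Sum>m\<in>Poly_Mapping.keys f. Poly_Mapping.lookup f m *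
        (\<Prod>v\<in>Poly_Mapping.keys m. x v ^ Poly_Mapping.lookup m v))"

definition mpols_in :: "'v set \<Rightarrow> ('v, 'k::comm_ring_1) mpol set" where
  "mpols_in I = {f. \<forall>m\<in>Poly_Mapping.keys f. Poly_Mapping.keys m \<subseteq> I}"

lemma mpol_eval_superset:
  assumes "finite K" "Poly_Mapping.keys f \<subseteq> K"
  shows "mpol_eval x f =
     (\<Sum>m\<in>K. Poly_Mapping.lookup f m *
        (\<Prod>v\<in>Poly_Mapping.keys m. x v ^ Poly_Mapping.lookup m v))"
  unfolding mpol_eval_def
  by (rule sum.mono_neutral_left) (use assms in \<open>auto simp: in_keys_iff\<close>)

lemma mpol_eval_0 [simp]: "mpol_eval x 0 = 0"
  by (simp add: mpol_eval_def)

lemma mpol_eval_1 [simp]: "mpol_eval x 1 = 1"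
  by (simp add: mpol_eval_def flip: single_one)

lemma mpol_eval_single:
  "mpol_eval x (Poly_Mapping.single m c) =
     c * (\<Prod>v\<in>Poly_Mapping.keys m. x v ^ Poly_Mapping.lookup m v)"
  by (subst mpol_eval_superset[of "{m}"]) auto

lemma mpol_eval_add: "mpol_eval x (f + g) = mpol_eval x f + mpol_eval x g"
proof -
  let ?K = "Poly_Mapping.keys f \<union> Poly_Mapping.keys g"
  have "Poly_Mapping.keys (f + g) \<subseteq> ?K"
    by (rule Poly_Mapping.keys_add)
  then show ?thesis
    by (simp add: mpol_eval_superset[of ?K] lookup_add sum.distrib distrib_right)
qed

lemma monom_eval_add:
  fixes x :: "'v \<Rightarrow> 'k::comm_ring_1"
  shows "(\<Prod>v\<in>Poly_Mapping.keys (m + n). x v ^ Poly_Mapping.lookup (m + n) v) =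
     (\<Prod>v\<in>Poly_Mapping.keys m. x v ^ Poly_Mapping.lookup m v) *
     (\<Prod>v\<in>Poly_Mapping.keys n. x v ^ Poly_Mapping.lookup n v)"
proof -
  let ?K = "Poly_Mapping.keys m \<union> Poly_Mapping.keys n"
  have sup: "(\<Prod>v\<in>Poly_Mapping.keys p. x v ^ Poly_Mapping.lookup p v) =
      (\<Prod>v\<in>?K. x v ^ Poly_Mapping.lookup p v)"
    if "Poly_Mapping.keys p \<subseteq> ?K" for p :: "'v \<Rightarrow>\<^sub>0 nat"
    by (rule prod.mono_neutral_left) (use that in \<open>auto simp: in_keys_iff\<close>)
  have "Poly_Mapping.keys (m + n) \<subseteq> ?K"
    by (rule Poly_Mapping.keys_add)
  from sup[OF this] sup[of m] sup[of n] show ?thesis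
    by (simp add: lookup_add power_add prod.distrib)
qed

lemma poly_mapping_single_induct [case_names zero add]:
  assumes "P 0" and "\<And>m c f. P f \<Longrightarrow> P (Poly_Mapping.single m c + f)"
  shows "P f"
proof (induction f rule: update_induct)
  case (update f a b)
  then have "Poly_Mapping.update a b f = Poly_Mapping.single a b + f"
    by (intro poly_mapping_eqI)
       (auto simp: lookup_update lookup_add lookup_single when_def in_keys_iff)
  then show ?case using assms(2) update by simp
qed (rule assms(1))

lemma mpol_eval_single_mult:
  "mpol_eval x (Poly_Mapping.single m c * g) =
     mpol_eval x (Poly_Mapping.single m c) * mpol_eval x g"
proof (induction g rule: poly_mapping_single_induct)
  case zero
  show ?case by simp
next
  case (add n b g)
  have "mpol_eval x (Poly_Mapping.single m c * Poly_Mapping.single n b) =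
      mpol_eval x (Poly_Mapping.single m c) * mpol_eval x (Poly_Mapping.single n b)"
    by (simp add: mult_single mpol_eval_single monom_eval_add mult_ac)
  with add show ?case by (simp add: distrib_left mpol_eval_add)
qed

lemma mpol_eval_mult: "mpol_eval x (f * g) = mpol_eval x f * mpol_eval x g"
proof (induction f rule: poly_mapping_single_induct)
  case zero
  show ?case by simp
next
  case (add m c f)
  then show ?case by (simp add: distrib_right mpol_eval_add mpol_eval_single_mult)
qed

lemma mpols_in_1: "1 \<in> mpols_in I"
  by (simp add: mpols_in_def flip: single_one)

lemma mpols_in_mult: "f \<in> mpols_in I \<Longrightarrow> g \<in> mpols_in I \<Longrightarrow> f * g \<in> mpols_in I"
proof -
  assume f: "f \<in> mpols_in I" and g: "g \<in> mpols_in I"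
  have "Poly_Mapping.keys m \<subseteq> I" if m: "m \<in> Poly_Mapping.keys (f * g)" for m
  proof -
    obtain a b where "m = a + b" "a \<in> Poly_Mapping.keys f" "b \<in> Poly_Mapping.keys g"
      using keys_mult[of f g] m by blast
    then show ?thesis
      using f g Poly_Mapping.keys_add[of a b] unfolding mpols_in_def by blast
  qed
  then show ?thesis by (simp add: mpols_in_def)
qed


section \<open>The Zariski topology on affine space\<close>

text \<open>Affine space with coordinates indexed by \<open>I\<close> is \<open>I \<rightarrow>\<^sub>E UNIV\<close>.\<close>

definition zero_locus :: "'v set \<Rightarrow> ('v, 'k::field) mpol set \<Rightarrow> ('v \<Rightarrow> 'k) set" where
  "zero_locus I S = {x \<in> I \<rightarrow>\<^sub>E UNIV. \<forall>f\<in>S. mpol_eval x f = 0}"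

definition zariski_topology :: "'v set \<Rightarrow> ('v \<Rightarrow> 'k::field) topology" where
  "zariski_topology I =
     topology (\<lambda>U. \<exists>S \<subseteq> mpols_in I. U = (I \<rightarrow>\<^sub>E UNIV) - zero_locus I S)"

lemma istopology_zariski:
  "istopology (\<lambda>U :: ('v \<Rightarrow> 'k::field) set.
     \<exists>S \<subseteq> mpols_in I. U = (I \<rightarrow>\<^sub>E UNIV) - zero_locus I S)"
  unfolding istopology_def
proof (intro conjI allI impI)
  fix U V :: "('v \<Rightarrow> 'k) set"
  assume "\<exists>S \<subseteq> mpols_in I. U = (I \<rightarrow>\<^sub>E UNIV) - zero_locus I S"
    and "\<exists>S \<subseteq> mpols_in I. V = (I \<rightarrow>\<^sub>E UNIV) - zero_locus I S"
  then obtain S T where S: "S \<subseteq> mpols_in I" "U = (I \<rightarrow>\<^sub>E UNIV) - zero_locus I S"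
    and T: "T \<subseteq> mpols_in I" "V = (I \<rightarrow>\<^sub>E UNIV) - zero_locus I T" by blast
  let ?P = "{f * g |f g. f \<in> S \<and> g \<in> T}"
  have "?P \<subseteq> mpols_in I"
    using S T mpols_in_mult by blast
  moreover have "zero_locus I ?P = zero_locus I S \<union> zero_locus I T"
  proof (intro equalityI subsetI)
    fix x assume x: "x \<in> zero_locus I ?P"
    show "x \<in> zero_locus I S \<union> zero_locus I T"
    proof (rule ccontr)
      assume "x \<notin> zero_locus I S \<union> zero_locus I T"
      then obtain f g where "f \<in> S" "g \<in> T" "mpol_eval x f \<noteq> 0" "mpol_eval x g \<noteq> 0"
        using x unfolding zero_locus_def by blast
      moreover from this have "mpol_eval x (f * g) = 0"
        using x unfolding zero_locus_def by blast
      ultimately show False by (simp add: mpol_eval_mult)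
    qed
  next
    fix x assume "x \<in> zero_locus I S \<union> zero_locus I T"
    then show "x \<in> zero_locus I ?P"
      unfolding zero_locus_def by (auto simp: mpol_eval_mult)
  qed
  ultimately show "\<exists>S \<subseteq> mpols_in I. U \<inter> V = (I \<rightarrow>\<^sub>E UNIV) - zero_locus I S"
    using S(2) T(2) by (intro exI[of _ ?P]) blast
next
  fix K :: "('v \<Rightarrow> 'k) set set"
  assume "\<forall>U\<in>K. \<exists>S \<subseteq> mpols_in I. U = (I \<rightarrow>\<^sub>E UNIV) - zero_locus I S"
  then obtain S where S: "\<And>U. U \<in> K \<Longrightarrow> S U \<subseteq> mpols_in I"
    "\<And>U. U \<in> K \<Longrightarrow> U = (I \<rightarrow>\<^sub>E UNIV) - zero_locus I (S U)" by metis
  have eq: "\<Union>K = (\<Union>U\<in>K. (I \<rightarrow>\<^sub>E UNIV) - zero_locus I (S U))"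
    using S(2) by auto
  have "\<Union>K = (I \<rightarrow>\<^sub>E UNIV) - zero_locus I (\<Union>U\<in>K. S U)"
    unfolding eq zero_locus_def by blast
  moreover have "(\<Union>U\<in>K. S U) \<subseteq> mpols_in I"
    using S(1) by blast
  ultimately show "\<exists>S \<subseteq> mpols_in I. \<Union>K = (I \<rightarrow>\<^sub>E UNIV) - zero_locus I S"
    by blast
qed

lemma openin_zariski_topology:
  "openin (zariski_topology I) U \<longleftrightarrow>
     (\<exists>S \<subseteq> mpols_in I. U = (I \<rightarrow>\<^sub>E UNIV) - zero_locus I S)"
  unfolding zariski_topology_def topology_inverse'[OF istopology_zariski] ..

lemma topspace_zariski_topology: "topspace (zariski_topology I) = I \<rightarrow>\<^sub>E (UNIV :: 'k::field set)"
proof -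
  have "openin (zariski_topology I) (I \<rightarrow>\<^sub>E (UNIV :: 'k set))"
    unfolding openin_zariski_topology
    by (rule exI[of _ "{1}"]) (auto simp: zero_locus_def mpols_in_1)
  moreover have "U \<subseteq> I \<rightarrow>\<^sub>E UNIV" if "openin (zariski_topology I) U" for U :: "(_ \<Rightarrow> 'k) set"
    using that unfolding openin_zariski_topology by blast
  ultimately show ?thesis
    by (meson openin_subset openin_topspace subset_antisym)
qed


section \<open>Polynomials of bounded partial degrees\<close>

text \<open>The zero polynomial gets degree 0, so it belongs to every \<open>Pol d\<close>.\<close>

definition deg_in :: "'n \<Rightarrow> ('n, 'k::zero) mpol \<Rightarrow> nat" where
  "deg_in i M = Max (insert 0 ((\<lambda>m. Poly_Mapping.lookup m i) ` Poly_Mapping.keys M))"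

definition Pol :: "('n \<Rightarrow> nat) \<Rightarrow> ('n, 'k::zero) mpol set" where
  "Pol d = {M. \<forall>i. deg_in i M \<le> d i}"

definition exponents :: "('n \<Rightarrow> nat) \<Rightarrow> ('n \<Rightarrow>\<^sub>0 nat) set" where
  "exponents d = {m. \<forall>i. Poly_Mapping.lookup m i \<le> d i}"

definition coeffs_of :: "('n \<Rightarrow> nat) \<Rightarrow> ('n, 'k::zero) mpol \<Rightarrow> ('n \<Rightarrow>\<^sub>0 nat) \<Rightarrow> 'k" where
  "coeffs_of d M = restrict (Poly_Mapping.lookup M) (exponents d)"

text \<open>
  The Zariski topology of affine space transported to \<open>Pol d\<close> along the coefficient bijection
  \<open>bij_betw_coeffs_of\<close>. The coordinates are indexed by \<open>exponents d\<close>, so the polynomials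
  cutting out closed sets have the elements of \<open>exponents d\<close> as indeterminates.
\<close>

definition Pol_topology :: "('n \<Rightarrow> nat) \<Rightarrow> ('n, 'k::field) mpol topology" where
  "Pol_topology d = pullback_topology (Pol d) (coeffs_of d) (zariski_topology (exponents d))"

lemma Pol_iff: "M \<in> Pol d \<longleftrightarrow> Poly_Mapping.keys M \<subseteq> exponents d"
  by (auto simp: Pol_def deg_in_def exponents_def)

lemma bij_betw_exponents:
  "bij_betw Poly_Mapping.lookup (exponents (d :: 'n::finite \<Rightarrow> nat)) (Pi\<^sub>E UNIV (\<lambda>i. {..d i}))"
proof (rule bij_betw_imageI)
  show "inj_on Poly_Mapping.lookup (exponents d)"
    by (simp add: inj_on_def)
  show "Poly_Mapping.lookup ` exponents d = Pi\<^sub>E UNIV (\<lambda>i. {..d i})"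
  proof (intro equalityI subsetI)
    fix f assume "f \<in> Pi\<^sub>E UNIV (\<lambda>i. {..d i})"
    then have "Abs_poly_mapping f \<in> exponents d" "Poly_Mapping.lookup (Abs_poly_mapping f) = f"
      by (auto simp: exponents_def PiE_iff)
    then show "f \<in> Poly_Mapping.lookup ` exponents d"
      by (metis imageI)
  qed (auto simp: exponents_def)
qed

lemma finite_exponents: "finite (exponents (d :: 'n::finite \<Rightarrow> nat))"
  using bij_betw_finite[OF bij_betw_exponents[of d]] by (simp add: finite_PiE)

lemma card_exponents: "card (exponents (d :: 'n::finite \<Rightarrow> nat)) = (\<Prod>i\<in>UNIV. d i + 1)"
  using bij_betw_same_card[OF bij_betw_exponents[of d]] by (simp add: card_PiE)

lemma bij_betw_coeffs_of:
  fixes d :: "'n::finite \<Rightarrow> nat"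
  shows "bij_betw (coeffs_of d) (Pol d :: ('n, 'k::zero) mpol set) (exponents d \<rightarrow>\<^sub>E UNIV)"
proof (rule bij_betw_imageI)
  show "inj_on (coeffs_of d) (Pol d :: ('n, 'k) mpol set)"
  proof (rule inj_onI)
    fix M N :: "('n, 'k) mpol"
    assume M: "M \<in> Pol d" and N: "N \<in> Pol d" and eq: "coeffs_of d M = coeffs_of d N"
    show "M = N"
    proof (rule poly_mapping_eqI)
      fix m
      show "Poly_Mapping.lookup M m = Poly_Mapping.lookup N m"
      proof (cases "m \<in> exponents d")
        case True
        then show ?thesis using fun_cong[OF eq, of m] by (simp add: coeffs_of_def)
      next
        case False
        then have "m \<notin> Poly_Mapping.keys M" "m \<notin> Poly_Mapping.keys N"
          using M N by (auto simp: Pol_iff)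
        then show ?thesis by (simp add: in_keys_iff)
      qed
    qed
  qed
  show "coeffs_of d ` (Pol d :: ('n, 'k) mpol set) = exponents d \<rightarrow>\<^sub>E UNIV"
  proof (intro equalityI subsetI)
    fix c :: "('n \<Rightarrow>\<^sub>0 nat) \<Rightarrow> 'k" assume c: "c \<in> exponents d \<rightarrow>\<^sub>E UNIV"
    define M where "M = Abs_poly_mapping (\<lambda>m. if m \<in> exponents d then c m else 0)"
    have lookup: "Poly_Mapping.lookup M = (\<lambda>m. if m \<in> exponents d then c m else 0)"
      unfolding M_def
      by (rule lookup_Abs_poly_mapping) (rule finite_subset[OF _ finite_exponents[of d]], auto)
    have "M \<in> Pol d"
      unfolding Pol_iff by (auto simp: in_keys_iff lookup split: if_splits)
    moreover have "coeffs_of d M = c"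
      using c by (auto simp: coeffs_of_def lookup fun_eq_iff PiE_iff extensional_def)
    ultimately show "c \<in> coeffs_of d ` Pol d" by blast
  qed (auto simp: coeffs_of_def)
qed

lemma topspace_Pol_topology:
  "topspace (Pol_topology d) = (Pol d :: ('n::finite, 'k::field) mpol set)"
  unfolding Pol_topology_def topspace_pullback_topology topspace_zariski_topology
  by (auto simp: coeffs_of_def)


section \<open>The irreducibility set\<close>

text \<open>The inclusion of k[x] into the polynomial ring over the algebraic closure of k.\<close>

definition to_ac_mpol :: "('n, 'k::field) mpol \<Rightarrow> ('n, 'k alg_closure) mpol" where
  "to_ac_mpol M = Poly_Mapping.map to_ac M"

lemma lookup_to_ac_mpol [simp]:
  "Poly_Mapping.lookup (to_ac_mpol M) m = to_ac (Poly_Mapping.lookup M m)"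
  by (simp add: to_ac_mpol_def Poly_Mapping.map.rep_eq when_def)

definition Irr :: "('n, 'k::field) mpol \<Rightarrow> ('n, 'k) mpol \<Rightarrow> ('n, 'k alg_closure) mpol set" where
  "Irr A B = {M. Factorial_Ring.irreducible (to_ac_mpol A + to_ac_mpol B * M)}"

text \<open>
  \<^const>\<open>coprime\<close> is only available on \<^class>\<open>algebraic_semidom\<close>, of which the type of
  polynomials is not an instance; this is its defining condition.
\<close>

definition relatively_prime :: "('n, 'k::field) mpol \<Rightarrow> ('n, 'k) mpol \<Rightarrow> bool" where
  "relatively_prime A B \<longleftrightarrow> (\<forall>C. C dvd A \<longrightarrow> C dvd B \<longrightarrow> C dvd 1)"

end

theory Submission
  imports Defs
begin

text \<open>
  Let \<open>F\<^sub>u = A + B M\<^sub>u\<close>, with \<open>u\<close> the coefficient vector of \<open>M\<^sub>u\<close>. For two variables \<open>x\<close>, \<open>y\<close> specialise the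
  others to generic constants; \<open>A\<close> and \<open>B\<close> remain coprime, since polynomial rings are factorial and
  \<open>A\<close>, \<open>B\<close> have nonzero eliminants without \<open>x\<close> and without \<open>y\<close>. If \<open>p\<close> is a smooth point of \<open>F\<^sub>u = 0\<close>, every
  factorisation \<open>F\<^sub>u = G H\<close> has a factor vanishing on the power series branch through \<open>p\<close>. Vanishing on
  the branch is a linear condition on the coefficients of \<open>G\<close>, so the absence of solutions of too
  small degree is an open condition on \<open>(u, p)\<close> that does not change under field extensions. It holds
  for some \<open>(u, p)\<close> over \<open>k(s, t)\<close> with \<open>p\<close> rational over \<open>k\<close>: there \<open>F\<^sub>u\<close> is linear in \<open>t\<close> with coprime
  coefficients, hence irreducible, and a polynomial of smaller degree cannot share a branch with it.
  Finally the point \<open>p\<close> is eliminated: a generic \<open>F\<^sub>u\<close> has, over the algebraic closure, a point where the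
  condition holds. No assumption on the characteristic is needed, and coprimality is used over \<open>k\<close> only.
\<close>

text \<open>Irreducibility over \<open>k(s, t)\<close> need not survive in an algebraic closure. The
  smooth rational point repairs this: conjugate components would all pass through it and make it
  singular. Independence of the monomials \<open>x^a y^b\<close> along the branch expresses this as
  a nonvanishing minor, hence as an open condition. The special member is
  \<open>A + B (c0 + s (x - p1) + t m)\<close> with
  \<open>m = (y - p2) (1 + (x - p1)^dx (y - p2)^(dy - 1))\<close>. Each piece has one task:
  \<open>c0\<close> puts \<open>p\<close> on the curve; \<open>t\<close> makes the equation linear;
  \<open>s\<close> removes the factors that \<open>A + c0 B\<close> and \<open>m\<close> might
  share; the factor \<open>y - p2\<close> gives a nonzero \<open>y\<close>-derivative at
  \<open>p\<close>; the large monomial raises the degrees in \<open>x\<close> and \<open>y\<close>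
  to the largest values that any member can have. These extreme degrees matter: a factor attaining
  them leaves a cofactor free of \<open>x\<close> and \<open>y\<close>. With \<open>x\<close> fixed
  and \<open>y\<close> running through the other variables, the same factor attains them every time,
  so its cofactor is constant.\<close>

hide_const (open) Polynomials.degree Polynomials.lead_coeff up_ring.coeff up_ring.monom
  Divisibility.irreducible module.smult
hide_fact (open) Divisibility.irreducible_def

subsection \<open>Evaluation homomorphisms and partial degrees\<close>

locale comm_ring_hom =
  fixes h :: "'a::comm_ring_1 \<Rightarrow> 'b::comm_ring_1"
  assumes hom_add: "h (x + y) = h x + h y"
    and hom_mult: "h (x * y) = h x * h y"
    and hom_one: "h 1 = 1"
begin

lemma hom_zero: "h 0 = 0"
  using hom_add[of 0 0] by simp

lemma hom_uminus: "h (- x) = - h x"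
proof -
  have "h x + h (- x) = 0" by (simp flip: hom_add add: hom_zero)
  then show ?thesis by (metis minus_unique)
qed

lemma hom_diff: "h (x - y) = h x - h y"
  using hom_add[of x "- y"] by (simp add: hom_uminus)

lemma hom_power: "h (x ^ n) = h x ^ n"
  by (induction n) (simp_all add: hom_one hom_mult)

lemma hom_sum: "h (sum f A) = (\<Sum>x\<in>A. h (f x))"
  by (induction A rule: infinite_finite_induct) (simp_all add: hom_zero hom_add)

lemma hom_prod: "h (prod f A) = (\<Prod>x\<in>A. h (f x))"
  by (induction A rule: infinite_finite_induct) (simp_all add: hom_one hom_mult)

lemma hom_dvd: "x dvd y \<Longrightarrow> h x dvd h y"
  by (metis dvd_def hom_mult)

lemmas hom_simps = hom_zero hom_one hom_add hom_mult hom_uminus hom_diff hom_power hom_sum hom_prod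

lemma comp_hom: "comm_ring_hom g \<Longrightarrow> comm_ring_hom (\<lambda>x. g (h x))"
  unfolding comm_ring_hom_def by (simp add: hom_simps)

lemma map_poly_hom: "comm_ring_hom (map_poly h)"
proof
  show "map_poly h (p + q) = map_poly h p + map_poly h q" for p q
    by (rule poly_eqI) (simp add: coeff_map_poly hom_simps)
  show "map_poly h (p * q) = map_poly h p * map_poly h q" for p q
    by (rule poly_eqI) (simp add: coeff_map_poly hom_simps coeff_mult)
  show "map_poly h 1 = 1"
    by (simp add: hom_one)
qed

lemma hom_poly: "h (poly p x) = poly (map_poly h p) (h x)"
  by (induction p) (simp_all add: hom_simps map_poly_pCons)

end

lemma comm_ring_hom_id: "comm_ring_hom (\<lambda>x. x)"
  by unfold_locales simp_all

lemma comm_ring_hom_poly_const: "comm_ring_hom (\<lambda>c. [:c:])"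
  by unfold_locales (simp_all add: one_pCons)

lemma comm_ring_hom_fps_const: "comm_ring_hom fps_const"
  by unfold_locales simp_all

lemma comm_ring_hom_poly: "comm_ring_hom (\<lambda>p. poly p x)"
  by unfold_locales simp_all

definition mconst :: "'c \<Rightarrow> ('v, 'c::comm_ring_1) mpol" where
  "mconst c = Poly_Mapping.single 0 c"

definition mvar :: "'v \<Rightarrow> ('v, 'c::comm_ring_1) mpol" where
  "mvar v = Poly_Mapping.single (Poly_Mapping.single v 1) 1"

definition monom_val :: "('v \<Rightarrow> 's::comm_ring_1) \<Rightarrow> ('v \<Rightarrow>\<^sub>0 nat) \<Rightarrow> 's" where
  "monom_val \<theta> m = (\<Prod>v\<in>Poly_Mapping.keys m. \<theta> v ^ Poly_Mapping.lookup m v)"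

text \<open>The universal property of the polynomial ring. Evaluation, base change, specialisation,
  renaming and substitution of a branch are all instances, and \<open>hom_insertion\<close> shows
  how they compose.\<close>

definition insertion ::
    "('c::comm_ring_1 \<Rightarrow> 's::comm_ring_1) \<Rightarrow> ('v \<Rightarrow> 's) \<Rightarrow> ('v, 'c) mpol \<Rightarrow> 's" where
  "insertion \<iota> \<theta> f =
     (\<Sum>m\<in>Poly_Mapping.keys f. \<iota> (Poly_Mapping.lookup f m) * monom_val \<theta> m)"

lemma comm_ring_hom_mconst: "comm_ring_hom mconst"
  by unfold_locales (simp_all add: mconst_def single_add mult_single)

lemma monom_val_0 [simp]: "monom_val \<theta> 0 = 1"
  by (simp add: monom_val_def)

lemma monom_val_single [simp]: "monom_val \<theta> (Poly_Mapping.single v n) = \<theta> v ^ n"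
  by (simp add: monom_val_def)

lemma monom_val_add: "monom_val \<theta> (m + n) = monom_val \<theta> m * monom_val \<theta> n"
  unfolding monom_val_def by (rule monom_eval_add)

lemma monom_val_superset:
  assumes "finite K" "Poly_Mapping.keys m \<subseteq> K"
  shows "monom_val \<theta> m = (\<Prod>v\<in>K. \<theta> v ^ Poly_Mapping.lookup m v)"
  unfolding monom_val_def
  by (rule prod.mono_neutral_left) (use assms in \<open>auto simp: in_keys_iff\<close>)

lemma (in comm_ring_hom) hom_monom_val: "h (monom_val \<theta> m) = monom_val (\<lambda>v. h (\<theta> v)) m"
  by (simp add: monom_val_def hom_simps)

lemma insertion_superset:
  assumes "finite K" "Poly_Mapping.keys f \<subseteq> K" "\<iota> 0 = 0"
  shows "insertion \<iota> \<theta> f = (\<Sum>m\<in>K. \<iota> (Poly_Mapping.lookup f m) * monom_val \<theta> m)"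
  unfolding insertion_def
  by (rule sum.mono_neutral_left) (use assms in \<open>auto simp: in_keys_iff\<close>)

lemma insertion_single:
  assumes "\<iota> 0 = 0"
  shows "insertion \<iota> \<theta> (Poly_Mapping.single m c) = \<iota> c * monom_val \<theta> m"
  by (subst insertion_superset[of "{m}"]) (use assms in auto)

lemma insertion_mconst: "\<iota> 0 = 0 \<Longrightarrow> insertion \<iota> \<theta> (mconst c) = \<iota> c"
  by (simp add: mconst_def insertion_single)

lemma insertion_mvar:
  assumes "comm_ring_hom \<iota>"
  shows "insertion \<iota> \<theta> (mvar v) = \<theta> v"
  using assms by (simp add: mvar_def insertion_single comm_ring_hom.hom_simps)

lemma insertion_0 [simp]: "insertion \<iota> \<theta> 0 = 0"
  by (simp add: insertion_def)

lemma insertion_add: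
  assumes "comm_ring_hom \<iota>"
  shows "insertion \<iota> \<theta> (f + g) = insertion \<iota> \<theta> f + insertion \<iota> \<theta> g"
proof -
  interpret comm_ring_hom \<iota> by fact
  let ?K = "Poly_Mapping.keys f \<union> Poly_Mapping.keys g"
  have "Poly_Mapping.keys (f + g) \<subseteq> ?K"
    by (rule Poly_Mapping.keys_add)
  then show ?thesis
    by (simp add: insertion_superset[of ?K] lookup_add sum.distrib distrib_right hom_simps)
qed

lemma insertion_single_mult:
  assumes "comm_ring_hom \<iota>"
  shows "insertion \<iota> \<theta> (Poly_Mapping.single m c * g) = \<iota> c * monom_val \<theta> m * insertion \<iota> \<theta> g"
proof -
  interpret comm_ring_hom \<iota> by fact
  show ?thesis
    by (induction g rule: poly_mapping_single_induct)
       (simp_all add: insertion_add[OF assms] distrib_left mult_single insertion_single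
          hom_simps monom_val_add mult_ac)
qed

lemma insertion_mult:
  assumes "comm_ring_hom \<iota>"
  shows "insertion \<iota> \<theta> (f * g) = insertion \<iota> \<theta> f * insertion \<iota> \<theta> g"
proof -
  interpret comm_ring_hom \<iota> by fact
  show ?thesis
    by (induction f rule: poly_mapping_single_induct)
       (simp_all add: insertion_add[OF assms] insertion_single_mult[OF assms] distrib_right
          insertion_single hom_simps)
qed

lemma insertion_hom:
  assumes "comm_ring_hom \<iota>"
  shows "comm_ring_hom (insertion \<iota> \<theta>)"
proof
  interpret comm_ring_hom \<iota> by fact
  show "insertion \<iota> \<theta> 1 = 1"
    using insertion_single[of \<iota> \<theta> 0 1] by (simp add: hom_simps)
qed (simp_all add: insertion_add insertion_mult assms)

lemma (in comm_ring_hom) hom_insertion: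
  "h (insertion \<iota> \<theta> f) = insertion (\<lambda>c. h (\<iota> c)) (\<lambda>v. h (\<theta> v)) f"
  by (simp add: insertion_def hom_simps hom_monom_val)

lemma mpol_eval_eq_insertion: "mpol_eval x f = insertion (\<lambda>c. c) x f"
  by (simp add: mpol_eval_def insertion_def monom_val_def)

lemma monom_val_mvar: "monom_val mvar m = Poly_Mapping.single m (1 :: 'c::comm_ring_1)"
proof (induction m rule: poly_mapping_single_induct)
  case (add v n f)
  have "(mvar v :: ('a, 'c) mpol) ^ n = Poly_Mapping.single (Poly_Mapping.single v n) 1"
    by (induction n) (simp_all add: mvar_def mult_single single_add[symmetric])
  with add show ?case
    by (simp add: monom_val_add mult_single)
qed simp

lemma insertion_mconst_mvar [simp]: "insertion mconst mvar f = f"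
proof (induction f rule: poly_mapping_single_induct)
  case (add m c f)
  then show ?case
    by (simp add: insertion_add comm_ring_hom_mconst insertion_single monom_val_mvar
        comm_ring_hom.hom_zero) (simp add: mconst_def mult_single)
qed simp

lemma monom_val_cong:
  "(\<And>v. v \<in> Poly_Mapping.keys m \<Longrightarrow> \<theta> v = \<theta>' v) \<Longrightarrow> monom_val \<theta> m = monom_val \<theta>' m"
  by (simp add: monom_val_def)

lemma insertion_cong:
  assumes "f \<in> mpols_in I" "\<And>v. v \<in> I \<Longrightarrow> \<theta> v = \<theta>' v" "\<And>c. \<iota> c = \<iota>' c"
  shows "insertion \<iota> \<theta> f = insertion \<iota>' \<theta>' f"
proof -
  have "monom_val \<theta> m = monom_val \<theta>' m" if "m \<in> Poly_Mapping.keys f" for m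
    using that assms by (intro monom_val_cong) (auto simp: mpols_in_def)
  then show ?thesis using assms(3) by (simp add: insertion_def)
qed

section \<open>Subrings and polynomials in a given set of variables\<close>

definition is_subring :: "'a::comm_ring_1 set \<Rightarrow> bool" where
  "is_subring S \<longleftrightarrow> 0 \<in> S \<and> 1 \<in> S \<and> (\<forall>x\<in>S. \<forall>y\<in>S. x + y \<in> S \<and> x * y \<in> S) \<and> (\<forall>x\<in>S. - x \<in> S)"

lemma is_subringD:
  assumes "is_subring S"
  shows "0 \<in> S" "1 \<in> S" "x \<in> S \<Longrightarrow> y \<in> S \<Longrightarrow> x + y \<in> S" "x \<in> S \<Longrightarrow> y \<in> S \<Longrightarrow> x * y \<in> S"
    "x \<in> S \<Longrightarrow> - x \<in> S" "x \<in> S \<Longrightarrow> y \<in> S \<Longrightarrow> x - y \<in> S"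
    "x \<in> S \<Longrightarrow> x ^ n \<in> S" "(\<And>a. a \<in> A \<Longrightarrow> f a \<in> S) \<Longrightarrow> sum f A \<in> S"
    "(\<And>a. a \<in> A \<Longrightarrow> f a \<in> S) \<Longrightarrow> prod f A \<in> S"
proof -
  show *: "0 \<in> S" "1 \<in> S" "x \<in> S \<Longrightarrow> y \<in> S \<Longrightarrow> x + y \<in> S" "x \<in> S \<Longrightarrow> y \<in> S \<Longrightarrow> x * y \<in> S"
    "x \<in> S \<Longrightarrow> - x \<in> S" for x y
    using assms by (simp_all add: is_subring_def)
  show "x \<in> S \<Longrightarrow> y \<in> S \<Longrightarrow> x - y \<in> S"
    using *(3)[of x "- y"] *(5)[of y] by simp
  show "x \<in> S \<Longrightarrow> x ^ n \<in> S"
    by (induction n) (auto intro: *)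
  show "(\<And>a. a \<in> A \<Longrightarrow> f a \<in> S) \<Longrightarrow> sum f A \<in> S"
    by (induction A rule: infinite_finite_induct) (auto intro: *)
  show "(\<And>a. a \<in> A \<Longrightarrow> f a \<in> S) \<Longrightarrow> prod f A \<in> S"
    by (induction A rule: infinite_finite_induct) (auto intro: *)
qed

text \<open>One closure argument that serves for two kinds of subring: polynomials in few variables,
  and univariate polynomials with coefficients in such a ring.\<close>

lemma insertion_in_subring:
  assumes "is_subring S" "\<And>c. \<iota> c \<in> S" "\<And>v. v \<in> I \<Longrightarrow> \<theta> v \<in> S" "f \<in> mpols_in I"
  shows "insertion \<iota> \<theta> f \<in> S"
  unfolding insertion_def monom_val_def
proof (intro is_subringD(8)[OF assms(1)] is_subringD(4)[OF assms(1)] assms(2)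
    is_subringD(9)[OF assms(1)] is_subringD(7)[OF assms(1)] assms(3))
  fix m v assume "m \<in> Poly_Mapping.keys f" "v \<in> Poly_Mapping.keys m"
  then show "v \<in> I" using assms(4) by (auto simp: mpols_in_def)
qed

lemma mpols_in_mconst [simp]: "mconst c \<in> mpols_in I"
  by (auto simp: mpols_in_def mconst_def split: if_splits)

lemma mpols_in_mvar: "v \<in> I \<Longrightarrow> mvar v \<in> mpols_in I"
  by (auto simp: mpols_in_def mvar_def split: if_splits)

lemma is_subring_mpols_in: "is_subring (mpols_in I :: ('v, 'c::comm_ring_1) mpol set)"
  unfolding is_subring_def
proof (intro conjI ballI)
  fix f g :: "('v, 'c::comm_ring_1) mpol" assume "f \<in> mpols_in I" "g \<in> mpols_in I"
  then show "f + g \<in> mpols_in I"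
    using Poly_Mapping.keys_add[of f g] by (auto simp: mpols_in_def)
qed (auto simp: mpols_in_1 mpols_in_mult, auto simp: mpols_in_def)

lemmas mpols_in_intros = is_subringD[OF is_subring_mpols_in]

lemma mpols_in_mono: "I \<subseteq> J \<Longrightarrow> f \<in> mpols_in I \<Longrightarrow> f \<in> mpols_in J"
  by (auto simp: mpols_in_def)

lemma mpols_in_UNIV [simp]: "f \<in> mpols_in UNIV"
  by (simp add: mpols_in_def)

lemma mpols_in_empty_iff: "f \<in> mpols_in {} \<longleftrightarrow> (\<exists>c. f = mconst c)"
proof
  assume f: "f \<in> mpols_in {}"
  have "f = mconst (Poly_Mapping.lookup f 0)"
  proof (rule poly_mapping_eqI)
    fix m show "Poly_Mapping.lookup f m = Poly_Mapping.lookup (mconst (Poly_Mapping.lookup f 0)) m"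
      using f by (auto simp: mconst_def lookup_single when_def mpols_in_def in_keys_iff)
  qed
  then show "\<exists>c. f = mconst c" ..
qed auto

lemma insertion_eq_self:
  "f \<in> mpols_in I \<Longrightarrow> (\<And>v. v \<in> I \<Longrightarrow> \<theta> v = mvar v) \<Longrightarrow> insertion mconst \<theta> f = f"
  using insertion_cong[of f I \<theta> mvar mconst mconst] by simp

section \<open>Partial degrees and one distinguished variable\<close>

lemma deg_in_le_iff:
  "deg_in i f \<le> n \<longleftrightarrow> (\<forall>m\<in>Poly_Mapping.keys f. Poly_Mapping.lookup m i \<le> n)"
  by (auto simp: deg_in_def)

lemma lookup_le_deg_in: "m \<in> Poly_Mapping.keys f \<Longrightarrow> Poly_Mapping.lookup m i \<le> deg_in i f"
  using deg_in_le_iff[of i f "deg_in i f"] by simp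

lemma deg_in_add_le: "deg_in i (f + g) \<le> max (deg_in i f) (deg_in i g)"
  unfolding deg_in_le_iff
proof
  fix m assume "m \<in> Poly_Mapping.keys (f + g)"
  then have "m \<in> Poly_Mapping.keys f \<or> m \<in> Poly_Mapping.keys g"
    using Poly_Mapping.keys_add[of f g] by blast
  then show "Poly_Mapping.lookup m i \<le> max (deg_in i f) (deg_in i g)"
    by (auto simp: le_max_iff_disj lookup_le_deg_in)
qed

lemma deg_in_uminus [simp]: "deg_in i (- f) = deg_in i (f :: ('v, 'c::comm_ring_1) mpol)"
  by (simp add: deg_in_def)

lemma deg_in_diff_le:
  "deg_in i (f - g) \<le> max (deg_in i f) (deg_in i (g :: ('v, 'c::comm_ring_1) mpol))"
  using deg_in_add_le[of i f "- g"] by simp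

lemma deg_in_mult_le: "deg_in i (f * g) \<le> deg_in i f + deg_in i g"
  unfolding deg_in_le_iff
proof
  fix m assume "m \<in> Poly_Mapping.keys (f * g)"
  then obtain a b where "m = a + b" "a \<in> Poly_Mapping.keys f" "b \<in> Poly_Mapping.keys g"
    using keys_mult[of f g] by blast
  then show "Poly_Mapping.lookup m i \<le> deg_in i f + deg_in i g"
    by (simp add: lookup_add add_mono lookup_le_deg_in)
qed

lemma deg_in_mconst [simp]: "deg_in i (mconst c) = 0"
  by (simp add: deg_in_def mconst_def)

lemma deg_in_0 [simp]: "deg_in i 0 = 0"
  by (simp add: deg_in_def)

lemma deg_in_1 [simp]: "deg_in i (1 :: ('v, 'c::comm_ring_1) mpol) = 0"
  using comm_ring_hom.hom_one[OF comm_ring_hom_mconst] deg_in_mconst by metis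

lemma deg_in_mvar: "deg_in i (mvar v :: ('v, 'c::comm_ring_1) mpol) = (if i = v then 1 else 0)"
  by (auto simp: deg_in_def mvar_def lookup_single when_def)

lemma deg_in_eq_0_iff: "f \<in> mpols_in I \<longleftrightarrow> (\<forall>i. i \<notin> I \<longrightarrow> deg_in i f = 0)"
proof -
  have "deg_in i f = 0 \<longleftrightarrow> (\<forall>m\<in>Poly_Mapping.keys f. Poly_Mapping.lookup m i = 0)" for i
    using deg_in_le_iff[of i f 0] by simp
  then show ?thesis
    by (force simp: mpols_in_def Poly_Mapping.in_keys_iff)
qed

text \<open>\<open>N\<close> stands for a degree function on the target ring.\<close>

lemma insertion_degree_le:
  fixes N :: "'s::comm_ring_1 \<Rightarrow> nat"
  assumes N: "N 0 = 0" "N 1 = 0" "\<And>x y. N (x + y) \<le> max (N x) (N y)"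
      "\<And>x y. N (x * y) \<le> N x + N y"
    and "\<And>c. N (\<iota> c) = 0" "N (\<theta> i) \<le> 1" "\<And>v. v \<noteq> i \<Longrightarrow> N (\<theta> v) = 0"
  shows "N (insertion \<iota> \<theta> f) \<le> deg_in i f"
proof -
  have pow: "N (x ^ n) \<le> n * N x" for x n
    by (induction n) (auto simp: N intro: order_trans[OF N(4)])
  have prd: "N (prod g A) \<le> (\<Sum>a\<in>A. N (g a))" if "finite A" for g :: "'v \<Rightarrow> 's" and A
    using that by (induction A) (auto simp: N intro: order_trans[OF N(4)])
  have sm: "N (sum g A) \<le> n" if "finite A" "\<And>a. a \<in> A \<Longrightarrow> N (g a) \<le> n"
    for g :: "('v \<Rightarrow>\<^sub>0 nat) \<Rightarrow> 's" and A n
    using that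
  proof (induction A)
    case (insert a A)
    have "N (g a + sum g A) \<le> max (N (g a)) (N (sum g A))" by (rule N)
    also have "\<dots> \<le> n" using insert by auto
    finally show ?case using insert by simp
  qed (simp add: N)
  have mon: "N (monom_val \<theta> m) \<le> Poly_Mapping.lookup m i" for m
  proof -
    have "N (monom_val \<theta> m) \<le> (\<Sum>v\<in>Poly_Mapping.keys m. Poly_Mapping.lookup m v * N (\<theta> v))"
      unfolding monom_val_def by (rule order_trans[OF prd sum_mono[OF pow]]) simp
    also have "\<dots> = (\<Sum>v\<in>Poly_Mapping.keys m. if v = i then Poly_Mapping.lookup m i * N (\<theta> i) else 0)"
      using assms(7) by (intro sum.cong) auto
    also have "\<dots> \<le> Poly_Mapping.lookup m i * 1"
      using assms(6) by (simp add: sum.delta)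
    finally show ?thesis by simp
  qed
  show ?thesis unfolding insertion_def
  proof (rule sm)
    fix m assume "m \<in> Poly_Mapping.keys f"
    then have "Poly_Mapping.lookup m i \<le> deg_in i f" by (rule lookup_le_deg_in)
    with mon[of m] N(4)[of "\<iota> (Poly_Mapping.lookup f m)" "monom_val \<theta> m"] assms(5)
    show "N (\<iota> (Poly_Mapping.lookup f m) * monom_val \<theta> m) \<le> deg_in i f"
      by (metis add_0 order_trans)
  qed simp
qed

lemmas deg_in_insertion_le =
  insertion_degree_le[where N = "deg_in w" for w, OF deg_in_0 deg_in_1 deg_in_add_le deg_in_mult_le]

lemma degree_insertion_le:
  fixes \<theta> :: "'v \<Rightarrow> 's::comm_ring_1 poly"
  assumes "\<And>c. degree (\<iota> c) = 0" "degree (\<theta> i) \<le> 1" "\<And>v. v \<noteq> i \<Longrightarrow> degree (\<theta> v) = 0"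
  shows "degree (insertion \<iota> \<theta> f) \<le> deg_in i f"
  by (rule insertion_degree_le) (use assms in \<open>auto intro: degree_add_le_max degree_mult_le\<close>)

text \<open>The ring regarded as univariate over the remaining variables. The coefficients keep the
  full type; that \<open>v\<close> is gone from them is the content of
  \<open>coeff_separate_in\<close>. Substituting \<open>mvar v\<close> undoes the map.\<close>

definition separate :: "'v \<Rightarrow> ('v, 'c::comm_ring_1) mpol \<Rightarrow> ('v, 'c) mpol poly" where
  "separate v = insertion (\<lambda>c. [:mconst c:]) (\<lambda>w. if w = v then [:0, 1:] else [:mvar w:])"

lemma comm_ring_hom_poly_mconst: "comm_ring_hom (\<lambda>c. [:mconst c:])"
  using comm_ring_hom.comp_hom[OF comm_ring_hom_mconst comm_ring_hom_poly_const] .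

lemma separate_hom: "comm_ring_hom (separate v)"
  unfolding separate_def by (rule insertion_hom[OF comm_ring_hom_poly_mconst])

lemma poly_separate: "poly (separate v f) (mvar v) = f"
proof -
  have "poly (separate v f) (mvar v) =
      insertion (\<lambda>c. mconst c) (\<lambda>w. poly (if w = v then [:0, 1:] else [:mvar w:]) (mvar v)) f"
    unfolding separate_def by (subst comm_ring_hom.hom_insertion[OF comm_ring_hom_poly]) simp
  also have "\<dots> = f"
    by (rule insertion_eq_self[where I = UNIV]) auto
  finally show ?thesis .
qed

lemma separate_eq_0_iff [simp]: "separate v f = 0 \<longleftrightarrow> f = 0"
  using poly_separate[of v f] by (auto simp: comm_ring_hom.hom_zero[OF separate_hom])

lemma is_subring_coeffs:
  assumes "is_subring S"
  shows "is_subring {p. \<forall>n. coeff p n \<in> S}"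
  unfolding is_subring_def
  by (auto simp: coeff_mult one_pCons coeff_pCons split: nat.splits
      intro!: is_subringD[OF assms])

lemma coeff_separate_in:
  assumes "f \<in> mpols_in I"
  shows "coeff (separate v f) n \<in> mpols_in (I - {v})"
proof -
  have "separate v f \<in> {p. \<forall>n. coeff p n \<in> mpols_in (I - {v})}"
    unfolding separate_def
    by (rule insertion_in_subring[OF is_subring_coeffs[OF is_subring_mpols_in] _ _ assms])
       (auto simp: coeff_pCons mpols_in_mvar mpols_in_intros split: nat.splits)
  then show ?thesis by auto
qed

lemma separate_const:
  assumes "f \<in> mpols_in (- {v})"
  shows "separate v f = [:f:]"
proof -
  have "[:f:] = insertion (\<lambda>c. [:mconst c:]) (\<lambda>w. [:mvar w:]) f"
    using comm_ring_hom.hom_insertion[OF comm_ring_hom_poly_const, of mconst mvar f] by simp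
  also have "\<dots> = separate v f"
    unfolding separate_def by (rule insertion_cong[OF assms]) auto
  finally show ?thesis ..
qed

lemma separate_mvar: "separate v (mvar v) = [:0, 1:]"
  by (simp add: separate_def insertion_mvar[OF comm_ring_hom_poly_mconst])

text \<open>Brings the degree theory of univariate polynomials over a domain to partial degrees. The
  harder inequality comes from writing \<open>f\<close> back as a polynomial in
  \<open>mvar v\<close> whose coefficients have degree 0 in \<open>v\<close>.\<close>

lemma degree_separate: "degree (separate v f) = deg_in v f"
proof (rule antisym)
  show "degree (separate v f) \<le> deg_in v f"
    unfolding separate_def by (rule degree_insertion_le) auto
  have *: "(\<Sum>n\<le>degree (separate v f). coeff (separate v f) n * mvar v ^ n) = f"
    using poly_separate[of v f] by (simp add: poly_altdef)
  have "deg_in v (\<Sum>n\<in>A. coeff (separate v f) n * mvar v ^ n) \<le> k"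
    if "A \<subseteq> {..k}" "finite A" for A k
    using that(2,1)
  proof (induction A)
    case (insert n A)
    have pow: "deg_in v ((mvar v :: ('a, 'b) mpol) ^ n) \<le> n" for n
    proof (induction n)
      case (Suc n)
      then show ?case using deg_in_mult_le[of v "mvar v :: ('a, 'b) mpol" "mvar v ^ n"]
        by (simp add: deg_in_mvar)
    qed simp
    have c: "coeff (separate v f) n \<in> mpols_in (UNIV - {v})"
      by (rule coeff_separate_in) simp
    then have "deg_in v (coeff (separate v f) n) = 0"
      by (simp add: deg_in_eq_0_iff)
    then have "deg_in v (coeff (separate v f) n * mvar v ^ n) \<le> k"
      using deg_in_mult_le[of v "coeff (separate v f) n" "mvar v ^ n"] pow[of n] insert.prems
      by auto
    moreover have "deg_in v (\<Sum>n\<in>A. coeff (separate v f) n * mvar v ^ n) \<le> k"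
      using insert by auto
    ultimately show ?case
      using deg_in_add_le[of v "coeff (separate v f) n * mvar v ^ n"
          "\<Sum>n\<in>A. coeff (separate v f) n * mvar v ^ n"] insert by auto
  qed simp
  from this[of "{..degree (separate v f)}" "degree (separate v f)"] *
  show "deg_in v f \<le> degree (separate v f)" by simp
qed

text \<open>The order on the variables is what makes the polynomial ring a domain as a type; over an
  unordered finite index type the result is recovered in \<open>deg_in_mult_finite\<close>.\<close>

lemma deg_in_mult:
  fixes f g :: "('v::linorder, 'c::idom) mpol"
  assumes "f \<noteq> 0" "g \<noteq> 0"
  shows "deg_in v (f * g) = deg_in v f + deg_in v g"
  using assms by (simp add: degree_separate[symmetric] comm_ring_hom.hom_mult[OF separate_hom]
      degree_mult_eq)

text \<open>Degrees add and are nonnegative, so a factor cannot contain a variable that is missing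
  from a nonzero product.\<close>

lemma mpols_in_factor:
  fixes f g :: "('v::linorder, 'c::idom) mpol"
  assumes "f * g \<in> mpols_in I" "f * g \<noteq> 0"
  shows "f \<in> mpols_in I"
proof -
  have nz: "f \<noteq> 0" "g \<noteq> 0" using assms(2) by auto
  have "deg_in i f = 0" if "i \<notin> I" for i
  proof -
    have "deg_in i (f * g) = 0" using assms(1) that unfolding deg_in_eq_0_iff by blast
    then show ?thesis unfolding deg_in_mult[OF nz] by (rule add_is_0[THEN iffD1, THEN conjunct1])
  qed
  then show ?thesis unfolding deg_in_eq_0_iff by blast
qed

lemma mpols_in_dvd:
  fixes f g :: "('v::linorder, 'c::idom) mpol"
  assumes "f dvd g" "g \<in> mpols_in I" "g \<noteq> 0"
  shows "f \<in> mpols_in I"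
proof -
  obtain h where "g = f * h" using assms(1) by (auto elim: dvdE)
  with assms(2,3) show ?thesis using mpols_in_factor[of f h I] by simp
qed

lemma is_unit_mconst:
  fixes c :: "'c::field"
  assumes "c \<noteq> 0"
  shows "(mconst c :: ('v, 'c) mpol) dvd 1"
proof (rule dvdI)
  show "1 = (mconst c :: ('v, 'c) mpol) * mconst (inverse c)"
    unfolding comm_ring_hom.hom_mult[OF comm_ring_hom_mconst, symmetric] right_inverse[OF assms]
    by (rule comm_ring_hom.hom_one[OF comm_ring_hom_mconst, symmetric])
qed

subsection \<open>Divisibility in polynomial rings over a field\<close>

lemma finite_vars:
  obtains I where "finite I" "f \<in> mpols_in I"
  by (rule that[of "\<Union>m\<in>Poly_Mapping.keys f. Poly_Mapping.keys m"]) (auto simp: mpols_in_def)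

lemma mpol_eval_hom: "comm_ring_hom (mpol_eval x)"
  using insertion_hom[OF comm_ring_hom_id, of x]
  by (simp add: mpol_eval_eq_insertion[abs_def])

lemma mpol_eval_mconst [simp]: "mpol_eval x (mconst c) = c"
  by (simp add: mpol_eval_eq_insertion insertion_mconst)

lemma mpol_eval_mvar [simp]: "mpol_eval x (mvar v) = x v"
  by (simp add: mpol_eval_eq_insertion insertion_mvar comm_ring_hom_id)

text \<open>Induction on the variables: at a point where the leading coefficient in \<open>v\<close>
  does not vanish, only finitely many values of \<open>v\<close> are roots.\<close>

lemma mpol_eval_nonzero:
  fixes f :: "('v, 'k::field) mpol"
  assumes "infinite (UNIV :: 'k set)" "f \<noteq> 0"
  shows "\<exists>x. mpol_eval x f \<noteq> 0"
proof -
  obtain I where "finite I" "f \<in> mpols_in I"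
    by (rule finite_vars)
  then show ?thesis using assms(2)
  proof (induction I arbitrary: f)
    case empty
    then show ?case by (auto simp: mpols_in_empty_iff comm_ring_hom.hom_zero[OF comm_ring_hom_mconst])
  next
    case (insert v I)
    define P where "P = separate v f"
    have P: "P \<noteq> 0" using insert.prems by (simp add: P_def)
    have coeffs: "coeff P n \<in> mpols_in I" for n
      using coeff_separate_in[OF insert.prems(1), of v n] insert.hyps by (simp add: P_def)
    obtain x where x: "mpol_eval x (lead_coeff P) \<noteq> 0"
      using insert.IH[OF coeffs] P by (metis leading_coeff_0_iff)
    define p where "p = map_poly (mpol_eval x) P"
    have "coeff p (degree P) \<noteq> 0" using x by (simp add: p_def coeff_map_poly)
    then have "p \<noteq> 0" by auto
    then have "finite {z. poly p z = 0}" by (rule poly_roots_finite)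
    then obtain z where z: "poly p z \<noteq> 0"
      using assms(1) by (metis (mono_tags, lifting) mem_Collect_eq finite_subset subsetI)
    have "mpol_eval (x(v := z)) (coeff P n) = mpol_eval x (coeff P n)" for n
      unfolding mpol_eval_eq_insertion by (rule insertion_cong[OF coeffs]) (use insert.hyps in auto)
    then have "map_poly (mpol_eval (x(v := z))) P = p"
      by (intro poly_eqI) (simp add: p_def coeff_map_poly)
    then have "mpol_eval (x(v := z)) f = poly p z"
      using comm_ring_hom.hom_poly[OF mpol_eval_hom, of "x(v := z)" P "mvar v"]
      by (simp add: P_def poly_separate)
    with z show ?case by metis
  qed
qed

text \<open>Termination measure for splitting off factors: additive on products and positive on
  nonunits.\<close>

definition deg_sum :: "'v set \<Rightarrow> ('v, 'c::zero) mpol \<Rightarrow> nat" where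
  "deg_sum I f = (\<Sum>v\<in>I. deg_in v f)"

lemma deg_sum_mult:
  fixes f g :: "('v::linorder, 'c::idom) mpol"
  shows "f \<noteq> 0 \<Longrightarrow> g \<noteq> 0 \<Longrightarrow> deg_sum I (f * g) = deg_sum I f + deg_sum I g"
  by (simp add: deg_sum_def deg_in_mult sum.distrib)

lemma deg_sum_pos:
  fixes f :: "('v::linorder, 'k::field) mpol"
  assumes "finite I" "f \<in> mpols_in I" "f \<noteq> 0" "\<not> f dvd 1"
  shows "deg_sum I f > 0"
proof (rule ccontr)
  assume "\<not> deg_sum I f > 0"
  then have "f \<in> mpols_in {}"
    using assms(1,2) by (auto simp: deg_sum_def deg_in_eq_0_iff)
  then show False
    using assms(3,4) is_unit_mconst
    by (metis mpols_in_empty_iff comm_ring_hom.hom_zero[OF comm_ring_hom_mconst])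
qed

lemma exists_irreducible_factor:
  fixes f :: "('v::linorder, 'k::field) mpol"
  assumes "finite I" "f \<in> mpols_in I" "f \<noteq> 0" "\<not> f dvd 1"
  shows "\<exists>p\<in>mpols_in I. irreducible p \<and> p dvd f"
  using assms(2-)
proof (induction "deg_sum I f" arbitrary: f rule: less_induct)
  case less
  show ?case
  proof (cases "irreducible f")
    case False
    then obtain a b where ab: "f = a * b" "\<not> a dvd 1" "\<not> b dvd 1"
      using less.prems unfolding irreducible_def by blast
    have nz: "a \<noteq> 0" "b \<noteq> 0" using ab less.prems by auto
    have inI: "a \<in> mpols_in I" "b \<in> mpols_in I"
      using mpols_in_factor[of a b I] mpols_in_factor[of b a I] ab less.prems
      by (simp_all add: mult.commute)
    have "deg_sum I a < deg_sum I f"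
      using deg_sum_pos[OF assms(1) inI(2) nz(2) ab(3)] deg_sum_mult[OF nz, of I] ab(1) by simp
    from less.hyps[OF this inI(1) nz(1) ab(2)] show ?thesis
      using ab(1) by (auto intro: dvd_mult2)
  qed (use less in auto)
qed

text \<open>Euclid's lemma relative to \<open>I\<close>, the form in which factoriality is proved by
  induction on the variables; the \<open>itself\<close> argument fixes the coefficient
  field.\<close>

definition irreducibles_prime_in :: "'v set \<Rightarrow> 'k::field itself \<Rightarrow> bool" where
  "irreducibles_prime_in I (_ :: 'k::field itself) \<longleftrightarrow>
     (\<forall>p \<in> mpols_in I. irreducible (p :: ('v, 'k::field) mpol) \<longrightarrow>
        (\<forall>g \<in> mpols_in I. \<forall>h \<in> mpols_in I. p dvd g * h \<longrightarrow> p dvd g \<or> p dvd h))"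

text \<open>With one further variable adjoined to \<open>I\<close>, this says that the content is a
  unit.\<close>

definition primitive_over :: "'v set \<Rightarrow> ('v, 'k::field) mpol \<Rightarrow> bool" where
  "primitive_over I e \<longleftrightarrow> (\<forall>c\<in>mpols_in I. c dvd e \<longrightarrow> c dvd 1)"

lemma dvd_iff_dvd_coeffs:
  fixes p g :: "('v::linorder, 'c::idom) mpol"
  assumes "p \<in> mpols_in (- {v})"
  shows "p dvd g \<longleftrightarrow> (\<forall>n. p dvd coeff (separate v g) n)"
proof
  assume "p dvd g"
  then have "separate v p dvd separate v g"
    by (rule comm_ring_hom.hom_dvd[OF separate_hom])
  then show "\<forall>n. p dvd coeff (separate v g) n"
    by (simp add: separate_const[OF assms] const_poly_dvd_iff)
next
  assume "\<forall>n. p dvd coeff (separate v g) n"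
  then have "[:p:] dvd separate v g" by (simp add: const_poly_dvd_iff)
  then have "poly [:p:] (mvar v) dvd poly (separate v g) (mvar v)"
    by (rule comm_ring_hom.hom_dvd[OF comm_ring_hom_poly])
  then show "p dvd g" by (simp add: poly_separate)
qed

text \<open>Gauss's lemma: modulo the prime \<open>p\<close>, a product of two nonzero polynomials
  in \<open>v\<close> is nonzero.\<close>

lemma prime_insert_variable:
  fixes p :: "('v::linorder, 'k::field) mpol"
  assumes "v \<notin> I" "irreducibles_prime_in I TYPE('k)" "p \<in> mpols_in I" "irreducible p"
    and g: "g \<in> mpols_in (insert v I)" and h: "h \<in> mpols_in (insert v I)"
    and dvd: "p dvd g * h"
  shows "p dvd g \<or> p dvd h"
proof (rule ccontr)
  assume neg: "\<not> (p dvd g \<or> p dvd h)"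
  define G where "G = coeff (separate v g)"
  define H where "H = coeff (separate v h)"
  have p: "p \<in> mpols_in (- {v})"
    using mpols_in_mono[of I "- {v}"] assms(1,3) by auto
  have GI: "G n \<in> mpols_in I" and HI: "H n \<in> mpols_in I" for n
    using coeff_separate_in[OF g, of v n] coeff_separate_in[OF h, of v n] assms(1)
    by (simp_all add: G_def H_def)
  have "\<exists>i. \<not> p dvd G i" "\<exists>i. \<not> p dvd H i"
    using neg dvd_iff_dvd_coeffs[OF p, of g] dvd_iff_dvd_coeffs[OF p, of h]
    by (simp_all add: G_def H_def)
  \<comment> \<open>Lowest coefficients not divisible by \<open>p\<close>; in the coefficient of
    index \<open>i + j\<close> of the product every other summand is divisible.\<close>
  then obtain i j where i: "\<not> p dvd G i" "\<And>i'. i' < i \<Longrightarrow> p dvd G i'"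
    and j: "\<not> p dvd H j" "\<And>j'. j' < j \<Longrightarrow> p dvd H j'"
    using exists_least_iff[of "\<lambda>i. \<not> p dvd G i"] exists_least_iff[of "\<lambda>i. \<not> p dvd H i"]
    by metis
  have "p dvd coeff (separate v g * separate v h) (i + j)"
    using dvd dvd_iff_dvd_coeffs[OF p, of "g * h"]
    by (simp add: comm_ring_hom.hom_mult[OF separate_hom])
  also have "coeff (separate v g * separate v h) (i + j) = (\<Sum>l\<le>i + j. G l * H (i + j - l))"
    by (simp add: coeff_mult G_def H_def)
  also have "\<dots> = G i * H j + (\<Sum>l\<in>{..i + j} - {i}. G l * H (i + j - l))"
    by (subst sum.remove[of _ i]) auto
  finally have *: "p dvd G i * H j + (\<Sum>l\<in>{..i + j} - {i}. G l * H (i + j - l))" .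
  have "p dvd (\<Sum>l\<in>{..i + j} - {i}. G l * H (i + j - l))"
  proof (rule dvd_sum)
    fix l assume "l \<in> {..i + j} - {i}"
    then have "l < i \<or> i + j - l < j" by auto
    then show "p dvd G l * H (i + j - l)" using i(2) j(2) by auto
  qed
  with * have "p dvd G i * H j" by (simp add: dvd_add_left_iff)
  then show False
    using assms(2-4) GI HI i(1) j(1) unfolding irreducibles_prime_in_def by blast
qed

text \<open>The irreducible factors of \<open>r\<close> are cancelled one at a time: each is prime
  by \<open>prime_insert_variable\<close> and cannot divide the primitive \<open>p\<close>, so it
  divides \<open>s\<close>.\<close>

lemma primitive_dvd_cancel:
  fixes r :: "('v::linorder, 'k::field) mpol"
  assumes I: "finite I" "v \<notin> I" "irreducibles_prime_in I TYPE('k)"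
    and "r \<in> mpols_in I" "r \<noteq> 0" "p \<in> mpols_in (insert v I)" "primitive_over I p"
      "s \<in> mpols_in (insert v I)" "r * h = p * s"
  shows "p dvd h"
  using assms(4-)
proof (induction "deg_sum I r" arbitrary: r s rule: less_induct)
  case less
  show ?case
  proof (cases "r dvd 1")
    case True
    then obtain w where "1 = r * w" by (auto elim: dvdE)
    then have "h = p * (s * w)" using less.prems by (metis mult.assoc mult.commute mult_1)
    then show ?thesis by simp
  next
    case False
    then obtain q where q: "q \<in> mpols_in I" "irreducible q" "q dvd r"
      using exists_irreducible_factor[OF I(1) less.prems(1,2)] by blast
    then obtain r' where r': "r = q * r'" by (auto elim: dvdE)
    have nz: "q \<noteq> 0" "r' \<noteq> 0" using r' less.prems by auto
    have r'I: "r' \<in> mpols_in I"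
      using mpols_in_factor[of r' q I] r' less.prems by (simp add: mult.commute)
    have "q dvd p * s" using less.prems(6) r' by (metis dvd_triv_left dvd_mult2)
    then have "q dvd p \<or> q dvd s"
      using prime_insert_variable[OF I(2,3) q(1,2) less.prems(3,5)] by blast
    moreover have "\<not> q dvd p"
      using less.prems(4) q by (auto simp: primitive_over_def irreducible_def)
    ultimately obtain s' where s': "s = q * s'" by (auto elim: dvdE)
    have eq: "r' * h = p * s'"
      using less.prems(6) r' s' nz(1) by (simp add: mult.left_commute mult.assoc)
    have "s' \<in> mpols_in (insert v I)"
    proof (cases "s = 0")
      case False
      then show ?thesis using mpols_in_factor[of s' q] s' less.prems by (simp add: mult.commute)
    qed (use s' nz mpols_in_intros in auto)
    moreover have "deg_sum I r' < deg_sum I r"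
      using deg_sum_pos[OF I(1) q(1) nz(1)] q(2) deg_sum_mult[OF nz, of I] r'
      by (simp add: irreducible_def)
    ultimately show ?thesis
      using less.hyps[OF _ r'I nz(2) less.prems(3,4) _ eq] by blast
  qed
qed

lemma primitive_part_exists:
  fixes f :: "('v::linorder, 'k::field) mpol"
  assumes "finite J" "I \<subseteq> J" "f \<in> mpols_in J" "f \<noteq> 0"
  shows "\<exists>r e. f = r * e \<and> r \<in> mpols_in I \<and> r \<noteq> 0 \<and> e \<in> mpols_in J \<and> primitive_over I e"
  using assms(3-)
proof (induction "deg_sum J f" arbitrary: f rule: less_induct)
  case less
  show ?case
  proof (cases "primitive_over I f")
    case True
    then show ?thesis using less.prems by (intro exI[of _ 1] exI[of _ f]) (simp add: mpols_in_1)
  next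
    case False
    then obtain c f' where c: "c \<in> mpols_in I" "\<not> c dvd 1" "f = c * f'"
      by (auto simp: primitive_over_def elim!: dvdE)
    have nz: "c \<noteq> 0" "f' \<noteq> 0" using c less.prems by auto
    have cJ: "c \<in> mpols_in J" using c(1) assms(2) mpols_in_mono by blast
    have f'J: "f' \<in> mpols_in J"
      using mpols_in_factor[of f' c J] c less.prems by (simp add: mult.commute)
    have "deg_sum J f' < deg_sum J f"
      using deg_sum_pos[OF assms(1) cJ nz(1) c(2)] deg_sum_mult[OF nz, of J] c(3) by simp
    then obtain r e where "f' = r * e" "r \<in> mpols_in I" "r \<noteq> 0" "e \<in> mpols_in J" "primitive_over I e"
      using less.hyps[OF _ f'J nz(2)] by blast
    then show ?thesis
      using c nz by (intro exI[of _ "c * r"] exI[of _ e]) (auto simp: mult.assoc mpols_in_mult)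
  qed
qed

text \<open>Euclid's algorithm in the last variable, with denominators \<open>r\<close> free of it.\<close>

lemma primitive_gcd:
  fixes f g :: "('v::linorder, 'k::field) mpol"
  assumes I: "finite I" "v \<notin> I" "irreducibles_prime_in I TYPE('k)"
    and "f \<in> mpols_in (insert v I)" "g \<in> mpols_in (insert v I)" "f \<noteq> 0 \<or> g \<noteq> 0"
  shows "\<exists>e r a b. e \<in> mpols_in (insert v I) \<and> e dvd f \<and> e dvd g \<and>
           r \<in> mpols_in I \<and> r \<noteq> 0 \<and> primitive_over I e \<and> r * e = a * f + b * g"
proof -
  \<comment> \<open>\<open>Suc\<close> keeps nonzero polynomials free of \<open>v\<close> above the
    zero polynomial in the measure.\<close>
  define sz :: "('v, 'k) mpol \<Rightarrow> nat" where "sz = (\<lambda>f. if f = 0 then 0 else Suc (deg_in v f))"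
  let ?R = "mpols_in (insert v I) :: ('v, 'k) mpol set"
  let ?Q = "\<lambda>f g :: ('v, 'k) mpol. \<exists>e r a b. e \<in> ?R \<and> e dvd f \<and> e dvd g \<and>
           r \<in> mpols_in I \<and> r \<noteq> 0 \<and> primitive_over I e \<and> r * e = a * f + b * g"
  have sym: "?Q f g \<Longrightarrow> ?Q g f" for f g by (metis add.commute)
  have zero: "?Q f 0" if "f \<in> ?R" "f \<noteq> 0" for f
    using primitive_part_exists[of "insert v I" I f] that I
    by (metis add.right_neutral dvd_0_right dvd_triv_right finite.insertI mult_1 mult_zero_right
        subset_insertI)
  have reduce: "?Q f g"
    if IH: "\<And>f' g'. sz f' + sz g' < sz f + sz g \<Longrightarrow> f' \<in> ?R \<Longrightarrow> g' \<in> ?R \<Longrightarrow> f' \<noteq> 0 \<or> g' \<noteq> 0 \<Longrightarrow> ?Q f' g'"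
      and fg: "f \<in> ?R" "g \<in> ?R" "f \<noteq> 0" "g \<noteq> 0" "deg_in v g \<le> deg_in v f" for f g
  proof -
    define cf where "cf = lead_coeff (separate v f)"
    define cg where "cg = lead_coeff (separate v g)"
    define k where "k = deg_in v f - deg_in v g"
    \<comment> \<open>Pseudo-remainder: cross-multiplied by the leading coefficients, so that the
      top coefficient in \<open>v\<close> cancels without division.\<close>
    define f' where "f' = cg * f - cf * mvar v ^ k * g"
    have cI: "cf \<in> mpols_in I" "cg \<in> mpols_in I"
      using coeff_separate_in[OF fg(1), of v] coeff_separate_in[OF fg(2), of v] I(2)
      by (simp_all add: cf_def cg_def)
    have cR: "cf \<in> ?R" "cg \<in> ?R" and cv: "cf \<in> mpols_in (- {v})" "cg \<in> mpols_in (- {v})"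
      using cI mpols_in_mono[of I "insert v I"] mpols_in_mono[of I "- {v}"] I(2) by blast+
    have cg0: "cg \<noteq> 0" using fg by (simp add: cg_def)
    have f'R: "f' \<in> ?R"
      unfolding f'_def by (intro mpols_in_intros cR fg mpols_in_mvar) auto
    have sep: "separate v f' = smult cg (separate v f) - smult cf (monom 1 k * separate v g)"
      unfolding f'_def
      by (simp add: comm_ring_hom.hom_simps[OF separate_hom] separate_mvar separate_const[OF cv(1)]
          separate_const[OF cv(2)] monom_altdef)
    have "degree (separate v f') \<le> deg_in v f"
      unfolding sep using fg(5) degree_mult_le[of "monom 1 k" "separate v g"]
      by (intro degree_diff_le)
         (auto simp: degree_separate k_def degree_monom_eq intro!: order_trans[OF degree_smult_le])
    moreover have "coeff (separate v f') (deg_in v f) = 0"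
      unfolding sep using fg(5)
      by (simp add: cf_def cg_def degree_separate coeff_monom_mult k_def)
    ultimately have "f' \<noteq> 0 \<Longrightarrow> deg_in v f' < deg_in v f"
      by (metis degree_separate eq_zero_or_degree_less separate_eq_0_iff)
    then have "sz f' < sz f" using fg by (auto simp: sz_def)
    then obtain e r a b where e: "e \<in> ?R" "e dvd f'" "e dvd g" "r \<in> mpols_in I" "r \<noteq> 0"
        "primitive_over I e" "r * e = a * f' + b * g"
      using IH[of f' g] f'R fg by auto
    have "e dvd cg * f"
      using e(2,3) unfolding f'_def by (metis dvd_add_right_iff dvd_mult diff_add_cancel)
    then obtain s where s: "cg * f = e * s" by (auto elim: dvdE)
    have "s \<in> ?R"
      using mpols_in_factor[of s e] s fg cg0 cR mpols_in_mult[of cg _ f]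
      by (metis mult.commute mult_eq_0_iff)
    then have "e dvd f"
      using primitive_dvd_cancel[OF I cI(2) cg0 e(1,6) _ s] by blast
    moreover have "r * e = (a * cg) * f + (b - a * cf * mvar v ^ k) * g"
      unfolding e(7) f'_def by (simp add: algebra_simps)
    ultimately show ?thesis using e by blast
  qed
  show ?thesis using assms(4-)
  proof (induction "sz f + sz g" arbitrary: f g rule: less_induct)
    case less
    consider "g = 0" | "f = 0" | "f \<noteq> 0" "g \<noteq> 0" "deg_in v g \<le> deg_in v f"
      | "f \<noteq> 0" "g \<noteq> 0" "deg_in v f \<le> deg_in v g" by linarith
    then show ?case
    proof cases
      case 1
      then show ?thesis using zero less.prems by simp
    next
      case 2
      then show ?thesis using sym[OF zero] less.prems by simp
    next
      case 3
      show ?thesis by (rule reduce[OF less.hyps less.prems(1,2) 3])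
    next
      case 4
      show ?thesis
        by (rule sym, rule reduce[OF less.hyps less.prems(2,1) 4(2,1,3)]) (simp_all add: add.commute)
    qed
  qed
qed

text \<open>If \<open>p\<close> is free of the new variable, Gauss's lemma applies. Otherwise
  \<open>p\<close> is primitive; unless it divides \<open>g\<close>, its gcd with \<open>g\<close>
  is a unit, and the Bezout relation with multiplier \<open>r\<close> free of \<open>v\<close> gives
  \<open>p dvd r * h\<close>, from which \<open>r\<close> can be cancelled.\<close>

lemma irreducibles_prime_in_finite:
  assumes "finite (I :: 'v::linorder set)"
  shows "irreducibles_prime_in I TYPE('k::field)"
  using assms
proof (induction I)
  case empty
  have False if "p \<in> mpols_in {}" "irreducible p" for p :: "('v, 'k) mpol"
    using that is_unit_mconst
    by (metis mpols_in_empty_iff comm_ring_hom.hom_zero[OF comm_ring_hom_mconst] irreducible_def)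
  then show ?case by (auto simp: irreducibles_prime_in_def)
next
  case (insert v I)
  note I = insert.hyps insert.IH
  show ?case unfolding irreducibles_prime_in_def
  proof (intro ballI impI)
    fix p g h :: "('v, 'k) mpol"
    assume p: "p \<in> mpols_in (insert v I)" "irreducible p"
      and g: "g \<in> mpols_in (insert v I)" and h: "h \<in> mpols_in (insert v I)" and dvd: "p dvd g * h"
    show "p dvd g \<or> p dvd h"
    proof (cases "p \<in> mpols_in I \<or> h = 0")
      case True
      then show ?thesis using prime_insert_variable[OF I(2,3) _ p(2) g h dvd] by auto
    next
      case False': False
      have p0: "p \<noteq> 0" using p(2) by (auto simp: irreducible_def)
      have unit_cases: "a dvd 1 \<or> p dvd a" if a: "a dvd p" for a
      proof -
        obtain b where b: "p = a * b" using a by (auto elim: dvdE)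
        then consider "a dvd 1" | "b dvd 1" using p(2) unfolding irreducible_def by blast
        then show ?thesis
        proof cases
          case 2
          then obtain w where "1 = b * w" by (auto elim: dvdE)
          then have "a = p * w" using b by (metis mult.assoc mult.right_neutral)
          then show ?thesis by simp
        qed simp
      qed
      obtain e r a b where e: "e dvd p" "e dvd g" "r \<in> mpols_in I" "r \<noteq> 0"
          "r * e = a * p + b * g"
        using primitive_gcd[OF I p(1) g] p0 by blast
      show ?thesis
      proof (cases "p dvd e")
        case True
        then show ?thesis using e(2) dvd_trans by blast
      next
        case False
        then obtain w where "1 = e * w" using unit_cases[OF e(1)] by (auto elim: dvdE)
        then have "r * h = (r * e) * h * w" by (simp add: ac_simps)
        also have "\<dots> = p * (a * h * w) + (g * h) * (b * w)"
          unfolding e(5) by (simp add: algebra_simps)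
        finally have "p dvd r * h" using dvd_add[OF dvd_triv_left dvd_mult2[OF dvd]] by simp
        then obtain s where s: "r * h = p * s" by (rule dvdE)
        have rR: "r \<in> mpols_in (insert v I)" by (rule mpols_in_mono[OF subset_insertI e(3)])
        have "s \<in> mpols_in (insert v I)"
          using mpols_in_factor[of s p] mpols_in_mult[OF rR h] e(4) False'
          unfolding s by (simp add: mult.commute s[symmetric])
        moreover have "primitive_over I p"
          unfolding primitive_over_def
        proof (intro ballI impI)
          fix c assume c: "c \<in> mpols_in I" "c dvd p"
          \<comment> \<open>Otherwise \<open>p\<close> would divide a nonzero polynomial free of
            \<open>v\<close> and so be free of \<open>v\<close> itself.\<close>
          have "\<not> p dvd c"
            using mpols_in_dvd[of p c I] c False' p0 by auto
          then show "c dvd 1" using unit_cases[OF c(2)] by blast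
        qed
        ultimately show ?thesis
          using primitive_dvd_cancel[OF I e(3,4) p(1) _ _ s] by blast
      qed
    qed
  qed
qed

lemma irreducible_imp_prime_elem_mpol:
  fixes p :: "('v::linorder, 'k::field) mpol"
  assumes "irreducible p"
  shows "prime_elem p"
  unfolding prime_elem_def
proof (intro conjI allI impI)
  fix g h assume dvd: "p dvd g * h"
  obtain I J L where fin: "finite I" "p \<in> mpols_in I" "finite J" "g \<in> mpols_in J"
    "finite L" "h \<in> mpols_in L"
    by (metis finite_vars)
  let ?U = "I \<union> J \<union> L"
  have "p \<in> mpols_in ?U" "g \<in> mpols_in ?U" "h \<in> mpols_in ?U"
    using fin mpols_in_mono[of I ?U p] mpols_in_mono[of J ?U g] mpols_in_mono[of L ?U h] by auto
  then show "p dvd g \<or> p dvd h"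
    using irreducibles_prime_in_finite[of ?U, where 'k = 'k] fin assms dvd
    unfolding irreducibles_prime_in_def by blast
qed (use assms in \<open>auto simp: irreducible_def\<close>)

text \<open>A substitute for the resultant: the gcd from \<open>primitive_gcd\<close> is a unit here
  and can be divided out of its Bezout relation.\<close>

lemma eliminate_variable:
  fixes f g :: "('v::linorder, 'k::field) mpol"
  assumes "f \<in> mpols_in I" "g \<in> mpols_in I" "f \<noteq> 0 \<or> g \<noteq> 0"
    and coprime: "\<And>c. c dvd f \<Longrightarrow> c dvd g \<Longrightarrow> c dvd 1"
    and "finite I"
  shows "\<exists>r a b. r \<in> mpols_in (I - {v}) \<and> r \<noteq> 0 \<and> r = a * f + b * g"
proof -
  have sub: "I \<subseteq> insert v (I - {v})" by auto
  have "finite (I - {v})" "v \<notin> I - {v}" using assms(5) by auto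
  from primitive_gcd[OF this irreducibles_prime_in_finite[OF this(1)]
      mpols_in_mono[OF sub assms(1)] mpols_in_mono[OF sub assms(2)] assms(3)]
  obtain e r a b where e: "e dvd f" "e dvd g" "r \<in> mpols_in (I - {v})" "r \<noteq> 0" "r * e = a * f + b * g"
    by blast
  then have "e dvd 1" using coprime by blast
  then obtain w where w: "1 = e * w" by (rule dvdE)
  then have "r = (r * e) * w" by (simp add: mult.assoc flip: w)
  also have "\<dots> = (a * w) * f + (b * w) * g" unfolding e(5) by (simp add: algebra_simps)
  finally show ?thesis using e by blast
qed

subsection \<open>Linear independence, power series branches and slices\<close>

text \<open>Gaussian elimination: the pivots multiply up to the polynomial \<open>P\<close>.\<close>

lemma linear_independence_open:
  fixes h0 :: "'r::comm_ring_1 \<Rightarrow> 'd::idom" and v :: "'j \<Rightarrow> 'l \<Rightarrow> 'r"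
  assumes h0: "comm_ring_hom h0" and S: "is_subring S" "\<And>r. h0 r \<in> S" and "finite J"
    and indep: "\<And>c. (\<And>j. j \<in> J \<Longrightarrow> c j \<in> S) \<Longrightarrow> (\<And>l. (\<Sum>j\<in>J. c j * h0 (v j l)) = 0) \<Longrightarrow>
                  \<forall>j\<in>J. c j = 0"
  shows "\<exists>P. h0 P \<noteq> 0 \<and> (\<forall>h :: 'r \<Rightarrow> 'e::idom. comm_ring_hom h \<longrightarrow> h P \<noteq> 0 \<longrightarrow>
           (\<forall>c. (\<forall>l. (\<Sum>j\<in>J. c j * h (v j l)) = 0) \<longrightarrow> (\<forall>j\<in>J. c j = 0)))"
  using \<open>finite J\<close> indep
proof (induction J arbitrary: v)
  case empty
  show ?case by (rule exI[of _ 1]) (simp add: comm_ring_hom.hom_one[OF h0])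
next
  case (insert i J)
  have "\<exists>l. h0 (v i l) \<noteq> 0"
  proof (rule ccontr)
    assume "\<nexists>l. h0 (v i l) \<noteq> 0"
    then have "(\<Sum>j\<in>insert i J. (if j = i then 1 else 0) * h0 (v j l)) = 0" for l
      by (intro sum.neutral) auto
    then have "\<forall>j\<in>insert i J. (if j = i then 1 else 0 :: 'd) = 0"
      by (intro insert.prems) (auto intro: is_subringD[OF S(1)])
    then show False by simp
  qed
  then obtain l0 where l0: "h0 (v i l0) \<noteq> 0" by blast
  \<comment> \<open>Fraction-free elimination: column \<open>l0\<close> is cleared with the pivot
    \<open>v i l0\<close>, without leaving the ring.\<close>
  define w where "w = (\<lambda>j l. v i l0 * v j l - v j l0 * v i l)"
  have key: "(\<Sum>j\<in>J. c j * h (w j l)) =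
      h (v i l0) * (\<Sum>j\<in>J. c j * h (v j l)) - h (v i l) * (\<Sum>j\<in>J. c j * h (v j l0))"
    if "comm_ring_hom h" for h :: "'r \<Rightarrow> 'x::idom" and c l
    unfolding w_def
    by (simp add: comm_ring_hom.hom_simps[OF that] sum_distrib_left algebra_simps sum_subtractf)
  have ex: "\<exists>P. h0 P \<noteq> 0 \<and> (\<forall>h :: 'r \<Rightarrow> 'e::idom. comm_ring_hom h \<longrightarrow> h P \<noteq> 0 \<longrightarrow>
           (\<forall>c. (\<forall>l. (\<Sum>j\<in>J. c j * h (w j l)) = 0) \<longrightarrow> (\<forall>j\<in>J. c j = 0)))"
  proof (rule insert.IH)
    fix c assume c: "\<And>j. j \<in> J \<Longrightarrow> c j \<in> S" "\<And>l. (\<Sum>j\<in>J. c j * h0 (w j l)) = 0"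
    \<comment> \<open>A relation among the \<open>w j\<close> lifts to one among the
      \<open>v j\<close>; scaling by the pivot instead of dividing keeps its coefficients in
      \<open>S\<close>.\<close>
    define c' where "c' = (\<lambda>j. if j = i then - (\<Sum>j\<in>J. c j * h0 (v j l0)) else h0 (v i l0) * c j)"
    have "(\<Sum>j\<in>insert i J. c' j * h0 (v j l)) = (\<Sum>j\<in>J. c j * h0 (w j l))" for l
    proof -
      have "(\<Sum>j\<in>J. c' j * h0 (v j l)) = (\<Sum>j\<in>J. h0 (v i l0) * (c j * h0 (v j l)))"
        using insert.hyps by (intro sum.cong) (auto simp: c'_def mult_ac)
      then show ?thesis
        using insert.hyps by (simp add: key[OF h0] c'_def sum_distrib_left mult_ac)
    qed
    moreover have "c' j \<in> S" if "j \<in> insert i J" for j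
      using that c(1) S(2) unfolding c'_def
      by (auto intro!: is_subringD[OF S(1)])
    ultimately have "\<forall>j\<in>insert i J. c' j = 0"
      using insert.prems[of c'] c(2) by simp
    then show "\<forall>j\<in>J. c j = 0"
      using l0 insert.hyps unfolding c'_def by (metis insertCI mult_eq_0_iff)
  qed
  then obtain P where P: "h0 P \<noteq> 0"
    "\<And>h c. comm_ring_hom (h :: 'r \<Rightarrow> 'e) \<Longrightarrow> h P \<noteq> 0 \<Longrightarrow> (\<And>l. (\<Sum>j\<in>J. c j * h (w j l)) = 0) \<Longrightarrow>
       \<forall>j\<in>J. c j = 0"
    by blast
  show ?case
  proof (intro exI[of _ "v i l0 * P"] conjI allI impI)
    show "h0 (v i l0 * P) \<noteq> 0" using l0 P(1) by (simp add: comm_ring_hom.hom_mult[OF h0])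
    fix h :: "'r \<Rightarrow> 'e" and c
    assume h: "comm_ring_hom h" "h (v i l0 * P) \<noteq> 0"
      and c: "\<forall>l. (\<Sum>j\<in>insert i J. c j * h (v j l)) = 0"
    have c': "(\<Sum>j\<in>J. c j * h (v j l)) = - (c i * h (v i l))" for l
      using c insert.hyps by (simp add: eq_neg_iff_add_eq_0 add.commute)
    have nz: "h (v i l0) \<noteq> 0" "h P \<noteq> 0"
      using h(2) by (auto simp: comm_ring_hom.hom_mult[OF h(1)])
    have "\<forall>j\<in>J. c j = 0"
      by (rule P(2)[OF h(1) nz(2)]) (simp add: key[OF h(1)] c')
    moreover from this have "c i = 0"
      using c'[of l0] nz(1) by simp
    ultimately show "\<forall>j\<in>insert i J. c j = 0" by simp
  qed
qed

section \<open>Power series branches and slices\<close>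

lemma fps_X_power_dvd_iff:
  fixes a :: "'a::comm_ring_1 fps"
  shows "fps_X ^ n dvd a \<longleftrightarrow> (\<forall>i<n. fps_nth a i = 0)"
proof
  assume "\<forall>i<n. fps_nth a i = 0"
  then have "a = fps_X ^ n * fps_shift n a"
    by (intro fps_ext) (auto simp: fps_X_power_mult_nth)
  then show "fps_X ^ n dvd a" by (rule dvdI)
qed (auto elim!: dvdE simp: fps_X_power_mult_nth)

text \<open>Banach's fixed point theorem for the \<open>X\<close>-adic metric: the coefficient of
  index \<open>i\<close> is stable after \<open>i + 1\<close> iterations, and the limit collects
  these stable values.\<close>

lemma fps_contraction_fixpoint:
  fixes \<Psi> :: "'a::comm_ring_1 fps \<Rightarrow> 'a fps"
  assumes contr: "\<And>a b n. fps_X dvd a \<Longrightarrow> fps_X dvd b \<Longrightarrow> fps_X ^ n dvd a - b \<Longrightarrow>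
      fps_X ^ Suc n dvd \<Psi> a - \<Psi> b"
    and zero: "\<And>a. fps_X dvd a \<Longrightarrow> fps_X dvd \<Psi> a"
  shows "\<exists>\<psi>. fps_X dvd \<psi> \<and> \<Psi> \<psi> = \<psi>"
proof -
  define it where "it = (\<lambda>k. (\<Psi> ^^ k) 0)"
  have X: "fps_X dvd it k" for k
    by (induction k) (auto simp: it_def zero)
  have "fps_X ^ k dvd it (Suc k) - it k" for k
  proof (induction k)
    case (Suc k)
    then show ?case using contr[OF X X Suc] by (simp add: it_def)
  qed simp
  then have step: "fps_nth (it (Suc k)) i = fps_nth (it k) i" if "i < k" for i k
    using that by (simp add: fps_X_power_dvd_iff)
  have stab: "fps_nth (it k) i = fps_nth (it (Suc i)) i" if "Suc i \<le> k" for i k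
    using that
  proof (induction rule: dec_induct)
    case (step n)
    then show ?case using \<open>\<And>k i. i < k \<Longrightarrow> fps_nth (it (Suc k)) i = fps_nth (it k) i\<close>[of i n] by simp
  qed simp
  define \<psi> where "\<psi> = Abs_fps (\<lambda>n. fps_nth (it (Suc n)) n)"
  have agree: "fps_X ^ k dvd \<psi> - it k" for k
    unfolding fps_X_power_dvd_iff using stab[of _ k] by (simp add: \<psi>_def)
  have X\<psi>: "fps_X dvd \<psi>"
    using agree[of 1] dvd_add[of fps_X "\<psi> - it 1" "it 1"] X[of 1] by simp
  have "\<Psi> \<psi> = \<psi>"
  proof (rule fps_ext)
    fix n
    have "fps_X ^ Suc (Suc n) dvd \<Psi> \<psi> - \<Psi> (it (Suc n))"
      by (rule contr[OF X\<psi> X agree])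
    then have "fps_nth (\<Psi> \<psi>) n = fps_nth (it (Suc (Suc n))) n"
      by (simp only: fps_X_power_dvd_iff) (simp add: it_def)
    then show "fps_nth (\<Psi> \<psi>) n = fps_nth \<psi> n"
      using stab[of n "Suc (Suc n)"] by (simp add: \<psi>_def)
  qed
  with X\<psi> show ?thesis by blast
qed

lemma poly_diff_dvd:
  fixes p :: "'a::comm_ring_1 poly"
  shows "a - b dvd poly p a - poly p b"
proof (induction p)
  case (pCons c p)
  have "poly (pCons c p) a - poly (pCons c p) b = a * (poly p a - poly p b) + (a - b) * poly p b"
    by (simp add: algebra_simps)
  then show ?case using pCons by simp
qed simp

text \<open>
  Newton's lemma without division: replacing \<open>x\<close> by \<open>\<alpha>\<^sup>2 X\<close> and \<open>y\<close> by \<open>\<alpha> \<psi>\<close>, where \<open>\<alpha>\<close> is the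
  derivative at the base point, makes all but the constant term divisible by \<open>\<alpha>\<^sup>2\<close>.
\<close>

lemma fps_newton:
  fixes f0 :: "'s::comm_ring_1 poly" and f1 :: "'s fps poly"
  defines "\<alpha> \<equiv> coeff f0 1"
  shows "\<exists>\<psi>. poly (map_poly fps_const f0 + smult (fps_const (\<alpha>\<^sup>2) * fps_X) f1) (fps_const \<alpha> * \<psi>) =
             fps_const (coeff f0 0)"
proof -
  define A where "A = fps_const \<alpha>"
  obtain c0 c1 q where pc: "map_poly fps_const f0 = pCons c0 (pCons c1 q)"
    by (metis pCons_cases)
  have c: "c0 = fps_const (coeff f0 0)" "c1 = A"
    using arg_cong[OF pc, of "\<lambda>p. coeff p 0"] arg_cong[OF pc, of "\<lambda>p. coeff p 1"]
    by (simp_all add: coeff_map_poly A_def \<alpha>_def)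
  \<comment> \<open>Fixed points solve \<open>z + z^2 q(A z) + X f1(A z) = 0\<close>, which is what
    remains after the constant term is removed and \<open>A^2\<close> is taken out; the factors
    \<open>z^2\<close> and \<open>X\<close> make the map contracting.\<close>
  define \<Psi> where "\<Psi> = (\<lambda>z. - (z\<^sup>2 * poly q (A * z) + fps_X * poly f1 (A * z)))"
  have "\<exists>\<psi>. fps_X dvd \<psi> \<and> \<Psi> \<psi> = \<psi>"
  proof (rule fps_contraction_fixpoint)
    fix a b :: "'s fps" and n
    assume ab: "fps_X dvd a" "fps_X dvd b" "fps_X ^ n dvd a - b"
    have p': "fps_X ^ n dvd poly p (A * a) - poly p (A * b)" for p
      using dvd_trans[OF dvd_mult[OF ab(3), of A]] poly_diff_dvd[of "A * a" "A * b" p]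
      by (simp add: right_diff_distrib)
    have "\<Psi> a - \<Psi> b = - (a * a * (poly q (A * a) - poly q (A * b)) + (a + b) * (a - b) * poly q (A * b)
        + fps_X * (poly f1 (A * a) - poly f1 (A * b)))"
      by (simp add: \<Psi>_def algebra_simps power2_eq_square)
    also have "fps_X * fps_X ^ n dvd \<dots>"
      using ab by (intro dvd_minus_iff[THEN iffD2] dvd_add mult_dvd_mono p' dvd_mult2) auto
    finally show "fps_X ^ Suc n dvd \<Psi> a - \<Psi> b" by simp
  next
    fix a :: "'s fps" assume "fps_X dvd a"
    then show "fps_X dvd \<Psi> a" by (simp add: \<Psi>_def power2_eq_square)
  qed
  then obtain \<psi> where \<psi>: "\<psi> = - (\<psi>\<^sup>2 * poly q (A * \<psi>) + fps_X * poly f1 (A * \<psi>))"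
    unfolding \<Psi>_def by metis
  have "poly (map_poly fps_const f0 + smult (fps_const (\<alpha>\<^sup>2) * fps_X) f1) (A * \<psi>) =
      c0 + A\<^sup>2 * (\<psi> + (\<psi>\<^sup>2 * poly q (A * \<psi>) + fps_X * poly f1 (A * \<psi>)))"
    unfolding pc c(2)
    by (simp add: A_def algebra_simps power2_eq_square flip: fps_const_mult)
  also have "\<psi> + (\<psi>\<^sup>2 * poly q (A * \<psi>) + fps_X * poly f1 (A * \<psi>)) = 0"
    using \<psi> by (metis add.left_inverse)
  finally show ?thesis unfolding A_def c(1) by auto
qed

lemma dvd_mult_diff:
  fixes a b :: "'a::comm_ring_1"
  assumes "D dvd a - a'" "D dvd b - b'"
  shows "D dvd a * b - a' * b'"
proof -
  have "a * b - a' * b' = a * (b - b') + (a - a') * b'" by (simp add: algebra_simps)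
  then show ?thesis using assms by simp
qed

lemma dvd_insertion_diff:
  fixes \<theta> \<theta>' :: "'v \<Rightarrow> 's::comm_ring_1"
  assumes "\<And>v. D dvd \<theta> v - \<theta>' v"
  shows "D dvd insertion \<iota> \<theta> f - insertion \<iota> \<theta>' f"
proof -
  have pow: "D dvd \<theta> v ^ n - \<theta>' v ^ n" for v n
    by (induction n) (simp_all add: dvd_mult_diff assms)
  have mon: "D dvd monom_val \<theta> m - monom_val \<theta>' m" for m
    by (induction m rule: poly_mapping_single_induct)
       (simp_all add: monom_val_add dvd_mult_diff pow)
  have "insertion \<iota> \<theta> f - insertion \<iota> \<theta>' f = (\<Sum>m\<in>Poly_Mapping.keys f.
      \<iota> (Poly_Mapping.lookup f m) * (monom_val \<theta> m - monom_val \<theta>' m))"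
    by (simp add: insertion_def sum_subtractf right_diff_distrib)
  then show ?thesis using mon by (auto intro!: dvd_sum)
qed

text \<open>The value on the branch is \<open>F\<close> at the base point and not 0: the
  construction takes place over a universal ring, where the point is not on the curve. A
  homomorphism that kills \<open>coeff f0 0\<close> turns it into an honest branch.\<close>

lemma smooth_branch:
  fixes F :: "('n, 'r::comm_ring_1) mpol" and q :: "'n \<Rightarrow> 'r" and y :: 'r
  assumes "i \<noteq> j"
  defines "f0 \<equiv> insertion (\<lambda>c. [:c:]) ((\<lambda>v. [:q v:])(j := [:y, 1:])) F"
  defines "\<alpha> \<equiv> coeff f0 1"
  shows "\<exists>\<psi>. insertion fps_const ((\<lambda>v. fps_const (q v))
            (i := fps_const (q i) + fps_const (\<alpha>\<^sup>2) * fps_X, j := fps_const y + fps_const \<alpha> * \<psi>)) F =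
          fps_const (coeff f0 0)"
proof -
  define c where "c = fps_const (\<alpha>\<^sup>2) * fps_X"
  define G where "G = insertion (\<lambda>c. [:fps_const c:])
      ((\<lambda>v. [:fps_const (q v):])(i := [:fps_const (q i) + c:], j := [:fps_const y, 1:])) F"
  define G0 where "G0 = insertion (\<lambda>c. [:fps_const c:])
      ((\<lambda>v. [:fps_const (q v):])(j := [:fps_const y, 1:])) F"
  \<comment> \<open>Only coordinate \<open>i\<close> differs between the two substitutions, and it
    differs by \<open>c\<close>.\<close>
  have "[:c:] dvd G - G0"
    unfolding G_def G0_def by (rule dvd_insertion_diff) (use assms(1) in auto)
  then obtain f1 where f1: "G - G0 = [:c:] * f1" by (rule dvdE)
  have "map_poly fps_const f0 = G0"
    unfolding f0_def G0_def
    by (subst comm_ring_hom.hom_insertion[OF comm_ring_hom.map_poly_hom[OF comm_ring_hom_fps_const]])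
       (auto simp: map_poly_pCons fun_upd_def if_distrib cong: if_cong)
  then have G: "G = map_poly fps_const f0 + smult c f1"
    using f1 by (simp add: algebra_simps)
  obtain \<psi> where \<psi>: "poly G (fps_const \<alpha> * \<psi>) = fps_const (coeff f0 0)"
    using fps_newton[of f0 f1] unfolding G c_def \<alpha>_def by (elim exE)
  let ?\<theta> = "(\<lambda>v. [:fps_const (q v):])(i := [:fps_const (q i) + c:], j := [:fps_const y, 1:])"
  have ev: "poly G z = insertion fps_const
      ((\<lambda>v. fps_const (q v))(i := fps_const (q i) + c, j := fps_const y + z)) F" for z
  proof -
    have "poly G z = insertion (\<lambda>c. poly [:fps_const c:] z) (\<lambda>v. poly (?\<theta> v) z) F"
      unfolding G_def by (rule comm_ring_hom.hom_insertion[OF comm_ring_hom_poly])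
    also have "(\<lambda>v. poly (?\<theta> v) z) =
        (\<lambda>v. fps_const (q v))(i := fps_const (q i) + c, j := fps_const y + z)"
      by (rule ext) simp
    finally show ?thesis by (simp only: poly_pCons poly_0 mult_zero_right add_0_right)
  qed
  show ?thesis
    by (rule exI[of _ \<psi>]) (use \<psi> ev in \<open>simp only: c_def\<close>)
qed

definition map_fps :: "('a \<Rightarrow> 'b) \<Rightarrow> 'a fps \<Rightarrow> 'b fps" where
  "map_fps h a = Abs_fps (\<lambda>n. h (fps_nth a n))"

lemma fps_nth_map_fps [simp]: "fps_nth (map_fps h a) n = h (fps_nth a n)"
  by (simp add: map_fps_def)

lemma (in comm_ring_hom) map_fps_hom: "comm_ring_hom (map_fps h)"
  by unfold_locales (auto intro!: fps_ext simp: hom_simps fps_mult_nth)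

lemma (in comm_ring_hom) map_fps_const: "map_fps h (fps_const c) = fps_const (h c)"
  by (rule fps_ext) (simp add: hom_simps)

lemma (in comm_ring_hom) map_fps_X: "map_fps h fps_X = fps_X"
  by (rule fps_ext) (simp add: hom_simps fps_X_def)

definition slice_coeff :: "('n \<Rightarrow> 'c) \<Rightarrow> 'n \<Rightarrow> 'n \<Rightarrow> ('n::finite, 'c::comm_ring_1) mpol \<Rightarrow> nat \<times> nat \<Rightarrow> 'c" where
  "slice_coeff q i j G = (\<lambda>ab. \<Sum>m\<in>{m\<in>Poly_Mapping.keys G. (Poly_Mapping.lookup m i, Poly_Mapping.lookup m j) = ab}.
     Poly_Mapping.lookup G m * (\<Prod>v\<in>UNIV - {i, j}. q v ^ Poly_Mapping.lookup m v))"

text \<open>The slice coefficients do not depend on the target ring, so the same numbers describe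
  \<open>G\<close> on a branch and on a line; if they all vanish, \<open>G\<close> vanishes on
  both.\<close>

lemma insertion_slice:
  fixes G :: "('n::finite, 'c::comm_ring_1) mpol"
  assumes "comm_ring_hom \<iota>" "i \<noteq> j" "\<And>v. v \<noteq> i \<Longrightarrow> v \<noteq> j \<Longrightarrow> \<theta> v = \<iota> (q v)"
    and "deg_in i G \<le> a" "deg_in j G \<le> b"
  shows "insertion \<iota> \<theta> G =
    (\<Sum>k\<in>{..a} \<times> {..b}. \<iota> (slice_coeff q i j G k) * (\<theta> i ^ fst k * \<theta> j ^ snd k))"
proof -
  interpret comm_ring_hom \<iota> by fact
  let ?l = "Poly_Mapping.lookup"
  have mon: "monom_val \<theta> m = \<theta> i ^ ?l m i * \<theta> j ^ ?l m j * \<iota> (\<Prod>v\<in>UNIV - {i, j}. q v ^ ?l m v)" for m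
  proof -
    have "monom_val \<theta> m = (\<Prod>v\<in>UNIV. \<theta> v ^ ?l m v)"
      by (rule monom_val_superset) auto
    also have "\<dots> = \<theta> i ^ ?l m i * (\<Prod>v\<in>UNIV - {i}. \<theta> v ^ ?l m v)"
      by (rule prod.remove) auto
    also have "(\<Prod>v\<in>UNIV - {i}. \<theta> v ^ ?l m v) = \<theta> j ^ ?l m j * (\<Prod>v\<in>UNIV - {i} - {j}. \<theta> v ^ ?l m v)"
      by (rule prod.remove) (use assms(2) in auto)
    also have "UNIV - {i} - {j} = UNIV - {i, j}" by auto
    also have "(\<Prod>v\<in>UNIV - {i, j}. \<theta> v ^ ?l m v) = \<iota> (\<Prod>v\<in>UNIV - {i, j}. q v ^ ?l m v)"
      unfolding hom_prod hom_power by (rule prod.cong) (use assms(3) in auto)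
    finally show ?thesis by (simp add: mult.assoc)
  qed
  have "insertion \<iota> \<theta> G = (\<Sum>k\<in>{..a} \<times> {..b}.
      \<Sum>m\<in>{m\<in>Poly_Mapping.keys G. (?l m i, ?l m j) = k}. \<iota> (?l G m) * monom_val \<theta> m)"
    unfolding insertion_def
    by (rule sum.group[symmetric])
       (use assms(4,5) in \<open>auto intro: order_trans[OF lookup_le_deg_in]\<close>)
  also have "\<dots> = (\<Sum>k\<in>{..a} \<times> {..b}. \<iota> (slice_coeff q i j G k) * (\<theta> i ^ fst k * \<theta> j ^ snd k))"
    unfolding slice_coeff_def hom_sum sum_distrib_right
    by (intro sum.cong refl) (auto simp: mon hom_mult mult_ac)
  finally show ?thesis .
qed

subsection \<open>An irreducible member over a purely transcendental extension\<close>

lemma separate_linear: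
  assumes "a \<in> mpols_in (- {t})" "b \<in> mpols_in (- {t})"
  shows "separate t (a + mvar t * b) = [:a, b:]"
  using assms
  by (simp add: comm_ring_hom.hom_simps[OF separate_hom] separate_mvar separate_const)

text \<open>The degree in \<open>t\<close> is 1, so one of two factors is free of \<open>t\<close>
  and divides both \<open>a\<close> and \<open>b\<close>.\<close>

lemma irreducible_linear:
  fixes a b :: "('v::linorder, 'k::field) mpol"
  assumes ab: "a \<in> mpols_in (- {t})" "b \<in> mpols_in (- {t})" and "b \<noteq> 0"
    and coprime: "\<And>c. c dvd a \<Longrightarrow> c dvd b \<Longrightarrow> c dvd 1"
  shows "irreducible (a + mvar t * b)"
proof -
  define f where "f = a + mvar t * b"
  have sep: "separate t f = [:a, b:]"
    unfolding f_def by (rule separate_linear[OF ab])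
  have deg: "deg_in t f = 1"
    using \<open>b \<noteq> 0\<close> sep degree_separate[of t f] by simp
  then have f0: "f \<noteq> 0" by auto
  have unit: "g dvd 1" if "g dvd f" "deg_in t g = 0" for g
  proof -
    have g: "g \<in> mpols_in (- {t})" using that(2) by (simp add: deg_in_eq_0_iff)
    have all: "\<forall>n. g dvd coeff [:a, b:] n"
      using that(1) dvd_iff_dvd_coeffs[OF g, of f] sep by simp
    show ?thesis using coprime[of g] all[rule_format, of 0] all[rule_format, of 1] by simp
  qed
  have "\<not> f dvd 1"
  proof
    assume "f dvd 1"
    then have "f \<in> mpols_in {}" by (rule mpols_in_dvd) (simp_all add: mpols_in_1)
    then show False using deg by (simp add: deg_in_eq_0_iff)
  qed
  moreover have "g dvd 1 \<or> h dvd 1" if gh: "f = g * h" for g h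
  proof -
    have "g \<noteq> 0" "h \<noteq> 0" using gh f0 by auto
    then have "deg_in t g + deg_in t h = 1" using deg_in_mult[of g h t] gh deg by simp
    then have "deg_in t g = 0 \<or> deg_in t h = 0" by linarith
    then show ?thesis using unit[of g] unit[of h] gh by auto
  qed
  ultimately show ?thesis using f0 unfolding f_def irreducible_def by blast
qed

text \<open>Setting \<open>t\<close> to 0 and to 1 cannot raise the degree in \<open>v\<close>; the
  resulting values are \<open>a\<close> and \<open>a + b\<close>.\<close>

lemma deg_in_linear:
  fixes a b :: "('v, 'k::comm_ring_1) mpol"
  assumes ab: "a \<in> mpols_in (- {t})" "b \<in> mpols_in (- {t})" and "v \<noteq> t"
  shows "deg_in v a \<le> deg_in v (a + mvar t * b)" "deg_in v b \<le> deg_in v (a + mvar t * b)"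
proof -
  have *: "deg_in v (a + mconst c * b) \<le> deg_in v (a + mvar t * b)" for c
  proof -
    let ?\<theta> = "mvar(t := mconst c)"
    interpret i: comm_ring_hom "insertion mconst ?\<theta>"
      by (rule insertion_hom[OF comm_ring_hom_mconst])
    have "insertion mconst ?\<theta> (a + mvar t * b) = a + mconst c * b"
      using insertion_eq_self[OF ab(1), of ?\<theta>] insertion_eq_self[OF ab(2), of ?\<theta>]
      by (simp add: i.hom_simps insertion_mvar[OF comm_ring_hom_mconst])
    moreover have "deg_in v (insertion mconst ?\<theta> (a + mvar t * b)) \<le> deg_in v (a + mvar t * b)"
      by (rule deg_in_insertion_le) (use \<open>v \<noteq> t\<close> in \<open>auto simp: deg_in_mvar\<close>)
    ultimately show ?thesis by simp
  qed
  show 1: "deg_in v a \<le> deg_in v (a + mvar t * b)"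
    using *[of 0] by (simp add: comm_ring_hom.hom_zero[OF comm_ring_hom_mconst])
  show "deg_in v b \<le> deg_in v (a + mvar t * b)"
    using *[of 1] 1 deg_in_diff_le[of v "a + mconst 1 * b" a]
    by (simp add: comm_ring_hom.hom_one[OF comm_ring_hom_mconst])
qed

lemma deg_in_power:
  fixes f :: "('v::linorder, 'c::idom) mpol"
  shows "f \<noteq> 0 \<Longrightarrow> deg_in v (f ^ n) = n * deg_in v f"
  by (induction n) (simp_all add: deg_in_mult)

lemma deg_in_mvar_minus_const:
  "deg_in v (mvar w - mconst c :: ('v, 'c::comm_ring_1) mpol) = (if v = w then 1 else 0)"
proof (rule antisym)
  show "deg_in v (mvar w - mconst c :: ('v, 'c) mpol) \<le> (if v = w then 1 else 0)"
    using deg_in_diff_le[of v "mvar w :: ('v, 'c) mpol" "mconst c"] by (simp add: deg_in_mvar)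
  show "(if v = w then 1 else 0) \<le> deg_in v (mvar w - mconst c :: ('v, 'c) mpol)"
    using deg_in_add_le[of v "mvar w - mconst c :: ('v, 'c) mpol" "mconst c"]
    by (simp add: deg_in_mvar split: if_splits)
qed

lemma mvar_minus_const_nonzero: "mvar w - mconst c \<noteq> (0 :: ('v, 'c::comm_ring_1) mpol)"
  using deg_in_mvar_minus_const[of w w c] by (metis deg_in_0 zero_neq_one)

text \<open>
  A generic member of the pencil spanned by \<open>x - p\<close> and \<open>m\<close>, with parameters the variables
  5 and 4; the coordinates \<open>x\<close>, \<open>y\<close> are the variables 2 and 3.
\<close>

locale special_member =
  fixes a b :: "(nat, 'k::field) mpol" and p1 p2 c0 :: 'k and dx dy :: nat
  assumes a: "a \<in> mpols_in {2, 3}" and b: "b \<in> mpols_in {2, 3}" and b_nz: "b \<noteq> 0"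
    and coprime: "c dvd a \<Longrightarrow> c dvd b \<Longrightarrow> c dvd 1"
    and dx: "dx > 0" and dy: "dy > 0"
begin

definition xx where "xx = (mvar 2 - mconst p1 :: (nat, 'k) mpol)"
definition yy where "yy = (mvar 3 - mconst p2 :: (nat, 'k) mpol)"
definition mm where "mm = yy * (1 + xx ^ dx * yy ^ (dy - 1))"
definition ff where
  "ff = (a + b * mconst c0 + mvar 5 * (b * xx)) + mvar 4 * (b * mm)"

lemma xx_yy_in: "xx \<in> mpols_in {2, 3}" "yy \<in> mpols_in {2, 3}"
  unfolding xx_def yy_def by (auto intro!: mpols_in_intros mpols_in_mvar)

lemma mm_in: "mm \<in> mpols_in {2, 3}"
  unfolding mm_def using xx_yy_in by (auto intro!: mpols_in_intros)

lemma ff_in: "ff \<in> mpols_in {2, 3, 4, 5}"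
proof -
  have "mpols_in {2, 3} \<subseteq> (mpols_in {2, 3, 4, 5} :: (nat, 'k) mpol set)"
    by (auto simp: mpols_in_def)
  then have "a \<in> mpols_in {2, 3, 4, 5}" "b \<in> mpols_in {2, 3, 4, 5}" "xx \<in> mpols_in {2, 3, 4, 5}"
    "mm \<in> mpols_in {2, 3, 4, 5}"
    using a b xx_yy_in mm_in by blast+
  then show ?thesis
    unfolding ff_def by (auto intro!: mpols_in_intros mpols_in_mvar)
qed

lemma deg_xx_yy: "deg_in v xx = (if v = 2 then 1 else 0)" "deg_in v yy = (if v = 3 then 1 else 0)"
  unfolding xx_def yy_def by (simp_all add: deg_in_mvar_minus_const)

lemma xx_yy_nz: "xx \<noteq> 0" "yy \<noteq> 0"
  unfolding xx_def yy_def by (rule mvar_minus_const_nonzero)+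

lemma deg_mm: "dx \<le> deg_in 2 mm" "dy \<le> deg_in 3 mm"
  and mm_nz: "mm \<noteq> 0"
proof -
  let ?P = "xx ^ dx * yy ^ (dy - 1)"
  have P: "deg_in 2 ?P = dx" "deg_in 3 ?P = dy - 1"
    using xx_yy_nz by (simp_all add: deg_in_mult deg_in_power deg_xx_yy)
  have le: "deg_in v ?P \<le> deg_in v (1 + ?P)" for v
    using deg_in_diff_le[of v "1 + ?P" 1] by simp
  have nz: "1 + ?P \<noteq> 0"
    using le[of 2] P(1) dx by (metis deg_in_0 not_gr_zero le_zero_eq)
  then show "mm \<noteq> 0" unfolding mm_def using xx_yy_nz by simp
  show "dx \<le> deg_in 2 mm" "dy \<le> deg_in 3 mm"
    unfolding mm_def deg_in_mult[OF xx_yy_nz(2) nz] deg_xx_yy using le[of 2] le[of 3] P dy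
    by auto
qed

lemma in_minus:
  "a + b * mconst c0 \<in> mpols_in (- {5})" "b * xx \<in> mpols_in (- {5})"
  "a + b * mconst c0 + mvar 5 * (b * xx) \<in> mpols_in (- {4})" "b * mm \<in> mpols_in (- {4})"
proof -
  have "mpols_in {2, 3} \<subseteq> (mpols_in (- {5}) :: (nat, 'k) mpol set)"
    "mpols_in {2, 3} \<subseteq> (mpols_in (- {4}) :: (nat, 'k) mpol set)"
    by (auto intro: mpols_in_mono[of "{2, 3}"])
  then have "a \<in> mpols_in (- {5})" "b \<in> mpols_in (- {5})" "xx \<in> mpols_in (- {5})"
    "a \<in> mpols_in (- {4})" "b \<in> mpols_in (- {4})" "xx \<in> mpols_in (- {4})" "mm \<in> mpols_in (- {4})"
    using a b xx_yy_in mm_in by blast+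
  then show "a + b * mconst c0 \<in> mpols_in (- {5})" "b * xx \<in> mpols_in (- {5})"
    "a + b * mconst c0 + mvar 5 * (b * xx) \<in> mpols_in (- {4})" "b * mm \<in> mpols_in (- {4})"
    by (auto intro!: mpols_in_intros mpols_in_mvar)
qed

text \<open>Neither parameter allows degrees to cancel, by \<open>deg_in_linear\<close>;
  \<open>a\<close> itself is reached as the difference of \<open>a + b * mconst c0\<close> and
  \<open>b * mconst c0\<close>.\<close>

lemma deg_ff:
  "deg_in 2 a \<le> deg_in 2 ff" "deg_in 2 b + dx \<le> deg_in 2 ff"
  "deg_in 3 a \<le> deg_in 3 ff" "deg_in 3 b + dy \<le> deg_in 3 ff"
proof -
  have 1: "deg_in v b + deg_in v mm \<le> deg_in v ff" if "v \<noteq> 4" for v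
    using deg_in_linear(2)[OF in_minus(3,4) that] deg_in_mult[OF b_nz mm_nz, of v]
    unfolding ff_def by simp
  have 2: "deg_in v a \<le> deg_in v ff" if "v \<noteq> 4" "v \<noteq> 5" for v
  proof -
    have "deg_in v (a + b * mconst c0) \<le> deg_in v ff"
      using deg_in_linear(1)[OF in_minus(1,2) that(2)] deg_in_linear(1)[OF in_minus(3,4) that(1)]
      unfolding ff_def by simp
    moreover have "deg_in v (b * mconst c0) \<le> deg_in v ff"
      using deg_in_mult_le[of v b "mconst c0"] 1[OF that(1)] by simp
    ultimately show ?thesis
      using deg_in_diff_le[of v "a + b * mconst c0" "b * mconst c0"] by simp
  qed
  show "deg_in 2 a \<le> deg_in 2 ff" "deg_in 3 a \<le> deg_in 3 ff"
    using 2 by simp_all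
  show "deg_in 2 b + dx \<le> deg_in 2 ff" "deg_in 3 b + dy \<le> deg_in 3 ff"
    using 1[of 2] 1[of 3] deg_mm by simp_all
qed

text \<open>On \<open>x = p1\<close> the polynomial \<open>xx\<close> vanishes, but
  \<open>mm\<close> restricts to \<open>yy\<close>, so \<open>r\<close> survives. The cofactor of
  \<open>r\<close> in \<open>xx\<close> must then vanish there and absorbs the whole degree of
  \<open>xx\<close>, which leaves \<open>r\<close> constant.\<close>

lemma irreducible_factor_not_both:
  assumes "irreducible r" "r dvd xx" "r dvd mm"
  shows False
proof -
  obtain s where s: "xx = r * s" using assms(2) by (rule dvdE)
  obtain t where t: "mm = r * t" using assms(3) by (rule dvdE)
  have nz: "r \<noteq> 0" "s \<noteq> 0" using s xx_yy_nz by auto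
  have deg: "deg_in v r + deg_in v s = (if v = 2 then 1 else 0)" for v
    using deg_in_mult[OF nz, of v] deg_xx_yy s by simp
  let ?\<theta> = "mvar(2 := mconst p1)"
  interpret i: comm_ring_hom "insertion mconst ?\<theta> :: (nat, 'k) mpol \<Rightarrow> (nat, 'k) mpol"
    by (rule insertion_hom[OF comm_ring_hom_mconst])
  have vals: "insertion mconst ?\<theta> (mvar w) = ?\<theta> w" "insertion mconst ?\<theta> (mconst c) = mconst c" for w c
    by (rule insertion_mvar[OF comm_ring_hom_mconst])
       (rule insertion_mconst, rule comm_ring_hom.hom_zero[OF comm_ring_hom_mconst])
  have "insertion mconst ?\<theta> xx = 0"
    unfolding xx_def by (simp add: i.hom_simps vals)
  moreover have "insertion mconst ?\<theta> mm = yy"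
    using dx unfolding mm_def xx_def yy_def by (simp add: i.hom_simps vals zero_power)
  ultimately have "insertion mconst ?\<theta> s = 0"
    using s t xx_yy_nz by (metis i.hom_mult mult_eq_0_iff)
  then have "s \<notin> mpols_in (- {2})"
    using nz insertion_eq_self[of s "- {2}" ?\<theta>] by auto
  then have "deg_in 2 s \<noteq> 0" by (auto simp: deg_in_eq_0_iff)
  then have "deg_in v r = 0" for v using deg[of v] deg[of 2] by (auto split: if_splits)
  then have "r \<in> mpols_in {}" by (simp add: deg_in_eq_0_iff)
  then obtain c where "r = mconst c" by (auto simp: mpols_in_empty_iff)
  then have "r dvd 1"
    using nz(1) is_unit_mconst[of c] comm_ring_hom.hom_zero[OF comm_ring_hom_mconst] by metis
  then show False using assms(1) by (simp add: irreducible_def)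
qed

text \<open>A common irreducible factor of the two coefficients with respect to variable 4 divides
  \<open>b * mm\<close>, so it is free of variable 5 and divides the coefficients with respect to
  that variable too. It then divides both \<open>a\<close> and \<open>b\<close>, or both
  \<open>xx\<close> and \<open>mm\<close>.\<close>

lemma irreducible_ff: "irreducible ff"
  unfolding ff_def
proof (rule irreducible_linear[OF in_minus(3,4)])
  show "b * mm \<noteq> 0" using b_nz mm_nz by simp
  fix c assume c: "c dvd a + b * mconst c0 + mvar 5 * (b * xx)" "c dvd b * mm"
  show "c dvd 1"
  proof (rule ccontr)
    assume nu: "\<not> c dvd 1"
    have bm: "b * mm \<in> mpols_in {2, 3}" using b mm_in by (rule mpols_in_mult)
    have c_in: "c \<in> mpols_in {2, 3}"
      by (rule mpols_in_dvd[OF c(2) bm]) (use b_nz mm_nz in simp)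
    have "c \<noteq> 0" using c(2) b_nz mm_nz by auto
    then obtain r where r: "r \<in> mpols_in {2, 3}" "irreducible r" "r dvd c"
      using exists_irreducible_factor[of "{2, 3}" c] c_in nu by auto
    have r3: "r \<in> mpols_in (- {5})" by (rule mpols_in_mono[OF _ r(1)]) auto
    have all: "\<forall>n. r dvd coeff [:a + b * mconst c0, b * xx:] n"
      using dvd_trans[OF r(3) c(1)] dvd_iff_dvd_coeffs[OF r3]
        separate_linear[OF in_minus(1,2)] by metis
    have r1: "r dvd a + b * mconst c0" and r2: "r dvd b * xx"
      using all[rule_format, of 0] all[rule_format, of 1] by simp_all
    have prime: "prime_elem r" by (rule irreducible_imp_prime_elem_mpol[OF r(2)])
    show False
    proof (cases "r dvd b")
      case True
      then have "r dvd a" using r1 by (simp add: dvd_add_left_iff)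
      then show False using coprime[OF _ True] r(2) by (simp add: irreducible_def)
    next
      case False
      then have "r dvd xx" "r dvd mm"
        using prime_elem_dvd_multD[OF prime r2] prime_elem_dvd_multD[OF prime dvd_trans[OF r(3) c(2)]]
        by blast+
      then show False by (rule irreducible_factor_not_both[OF r(2)])
    qed
  qed
qed

text \<open>A relation over \<open>k[s, t]\<close> is a polynomial \<open>g\<close> vanishing on the
  branch, of smaller degree than the irreducible \<open>ff\<close> in \<open>x\<close> or in
  \<open>y\<close>, hence coprime to it if nonzero. The eliminant without \<open>y\<close> would
  vanish at \<open>x0\<close>, which is transcendental over \<open>k[s, t]\<close> because
  \<open>\<beta>\<close> is nonzero.\<close>

lemma monomials_independent:
  fixes \<beta> :: "(nat, 'k) mpol" and y0 :: "(nat, 'k) mpol fps" and c :: "nat \<times> nat \<Rightarrow> (nat, 'k) mpol"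
  defines "x0 \<equiv> fps_const (mconst p1) + fps_const \<beta> * fps_X"
  assumes \<beta>: "\<beta> \<noteq> 0"
    and root: "insertion (\<lambda>c. fps_const (mconst c))
        (\<lambda>v. if v = 2 then x0 else if v = 3 then y0 else fps_const (mvar v)) ff = 0"
    and J: "finite J" "(\<forall>k\<in>J. fst k < deg_in 2 ff) \<or> (\<forall>k\<in>J. snd k < deg_in 3 ff)"
    and c: "\<And>k. k \<in> J \<Longrightarrow> c k \<in> mpols_in {4, 5}"
    and dep: "\<And>l. (\<Sum>k\<in>J. c k * fps_nth (x0 ^ fst k * y0 ^ snd k) l) = 0"
  shows "\<forall>k\<in>J. c k = 0"
proof -
  define \<theta> where "\<theta> = (\<lambda>v::nat. if v = 2 then x0 else if v = 3 then y0 else fps_const (mvar v))"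
  define \<iota> where "\<iota> = (\<lambda>c::'k. fps_const (mconst c :: (nat, 'k) mpol))"
  have \<iota>: "comm_ring_hom \<iota>"
    unfolding \<iota>_def by (rule comm_ring_hom.comp_hom[OF comm_ring_hom_mconst comm_ring_hom_fps_const])
  interpret e: comm_ring_hom "insertion \<iota> \<theta>" by (rule insertion_hom[OF \<iota>])
  have e_const: "insertion \<iota> \<theta> f = fps_const f" if "f \<in> mpols_in {4, 5}" for f
  proof -
    have "fps_const f = fps_const (insertion mconst mvar f)" by simp
    also have "\<dots> = insertion \<iota> (\<lambda>v. fps_const (mvar v)) f"
      unfolding \<iota>_def by (rule comm_ring_hom.hom_insertion[OF comm_ring_hom_fps_const])
    also have "\<dots> = insertion \<iota> \<theta> f"
      by (rule insertion_cong[OF that]) (auto simp: \<theta>_def)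
    finally show ?thesis ..
  qed
  have e_var: "insertion \<iota> \<theta> (mvar 2) = x0" "insertion \<iota> \<theta> (mvar 3) = y0"
    by (simp_all add: insertion_mvar[OF \<iota>] \<theta>_def)
  define g where "g = (\<Sum>k\<in>J. c k * mvar 2 ^ fst k * mvar 3 ^ snd k)"
  have c4: "c k \<in> mpols_in {2, 3, 4, 5}" if "k \<in> J" for k
    by (rule mpols_in_mono[OF _ c[OF that]]) auto
  have g_in: "g \<in> mpols_in {2, 3, 4, 5}"
    unfolding g_def by (auto intro!: mpols_in_intros mpols_in_mvar c4)
  have eg: "insertion \<iota> \<theta> g = 0"
  proof (rule fps_ext)
    fix l
    have "insertion \<iota> \<theta> g = (\<Sum>k\<in>J. fps_const (c k) * (x0 ^ fst k * y0 ^ snd k))"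
      unfolding g_def by (simp add: e.hom_simps e_var e_const[OF c] mult.assoc)
    then show "fps_nth (insertion \<iota> \<theta> g) l = fps_nth 0 l"
      using dep[of l] by (simp add: fps_sum_nth)
  qed
  have g_low: "deg_in 2 g < deg_in 2 ff \<or> deg_in 3 g < deg_in 3 ff" if "J \<noteq> {}"
  proof -
    have le: "deg_in v g \<le> n" if n: "\<And>k. k \<in> J \<Longrightarrow> deg_in v (c k * mvar 2 ^ fst k * mvar 3 ^ snd k) \<le> n" for v n
      using J(1) n unfolding g_def
    proof (induction J)
      case (insert k J)
      have "deg_in v (c k * mvar 2 ^ fst k * mvar 3 ^ snd k) \<le> n"
        "deg_in v (\<Sum>k\<in>J. c k * mvar 2 ^ fst k * mvar 3 ^ snd k) \<le> n"
        using insert by auto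
      then show ?case
        using deg_in_add_le[of v "c k * mvar 2 ^ fst k * mvar 3 ^ snd k"
            "\<Sum>k\<in>J. c k * mvar 2 ^ fst k * mvar 3 ^ snd k"] insert.hyps by simp
    qed simp
    have var_nz: "mvar v \<noteq> (0 :: (nat, 'k) mpol)" for v
      using mvar_minus_const_nonzero[of v 0] by (simp add: comm_ring_hom.hom_zero[OF comm_ring_hom_mconst])
    have c0: "deg_in 2 (c k) = 0" "deg_in 3 (c k) = 0" if "k \<in> J" for k
      using c[OF that] by (auto simp: deg_in_eq_0_iff)
    have t: "deg_in 2 (c k * mvar 2 ^ fst k * mvar 3 ^ snd k) \<le> fst k"
      "deg_in 3 (c k * mvar 2 ^ fst k * mvar 3 ^ snd k) \<le> snd k" if "k \<in> J" for k
      using that var_nz c0 by (cases "c k = 0"; simp add: deg_in_mult deg_in_power deg_in_mvar)+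
    from J(2) show ?thesis
    proof
      assume *: "\<forall>k\<in>J. fst k < deg_in 2 ff"
      then have "deg_in 2 ff > 0" using \<open>J \<noteq> {}\<close> by fastforce
      moreover have "deg_in 2 g \<le> deg_in 2 ff - 1"
        by (rule le) (use * t in fastforce)
      ultimately show ?thesis by linarith
    next
      assume *: "\<forall>k\<in>J. snd k < deg_in 3 ff"
      then have "deg_in 3 ff > 0" using \<open>J \<noteq> {}\<close> by fastforce
      moreover have "deg_in 3 g \<le> deg_in 3 ff - 1"
        by (rule le) (use * t in fastforce)
      ultimately show ?thesis by linarith
    qed
  qed
  have "g = 0"
  proof (rule ccontr)
    assume g0: "g \<noteq> 0"
    then have "J \<noteq> {}" by (auto simp: g_def)
    have ndvd: "\<not> ff dvd g"
    proof
      assume "ff dvd g"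
      then obtain h where h: "g = ff * h" by (rule dvdE)
      then have "ff \<noteq> 0" "h \<noteq> 0" using g0 by auto
      then have "deg_in v ff \<le> deg_in v g" for v unfolding h by (simp add: deg_in_mult)
      then show False using g_low[OF \<open>J \<noteq> {}\<close>] by (meson not_less)
    qed
    have cop: "d dvd 1" if d: "d dvd ff" "d dvd g" for d
    proof -
      obtain h where h: "ff = d * h" using d(1) by (rule dvdE)
      then consider "d dvd 1" | "h dvd 1" using irreducible_ff unfolding irreducible_def by blast
      then show ?thesis
      proof cases
        case 2
        then obtain w where w: "1 = h * w" by (rule dvdE)
        have "d = ff * w" unfolding h by (simp add: mult.assoc flip: w)
        then have "ff dvd d" by simp
        then show ?thesis using ndvd d(2) dvd_trans by blast
      qed
    qed
    have "\<exists>r s t. r \<in> mpols_in ({2, 3, 4, 5} - {3}) \<and> r \<noteq> 0 \<and> r = s * ff + t * g"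
      by (rule eliminate_variable[OF ff_in g_in disjI2[OF g0]]) (simp_all add: cop)
    then obtain r s t where r: "r \<in> mpols_in ({2, 3, 4, 5} - {3})" "r \<noteq> 0" "r = s * ff + t * g"
      by blast
    have er: "insertion \<iota> \<theta> r = 0"
      unfolding r(3) e.hom_add e.hom_mult eg root[folded \<iota>_def \<theta>_def] by simp
    define P where "P = separate 2 r"
    have "coeff P n \<in> mpols_in ({2, 3, 4, 5} - {3} - {2})" for n
      unfolding P_def by (rule coeff_separate_in[OF r(1)])
    then have "coeff P n \<in> mpols_in {4, 5}" for n
      by (rule mpols_in_mono[rotated]) auto
    then have map: "map_poly (insertion \<iota> \<theta>) P = map_poly fps_const P"
      by (intro poly_eqI) (simp add: coeff_map_poly e_const)
    interpret fp: comm_ring_hom "fps_of_poly :: (nat, 'k) mpol poly \<Rightarrow> _"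
      by unfold_locales (simp_all add: fps_of_poly_add fps_of_poly_mult)
    \<comment> \<open>The series \<open>x0\<close> is a polynomial of degree 1; composition with it
      is injective on polynomials, which is the transcendence of \<open>x0\<close>.\<close>
    have x0: "x0 = fps_of_poly [:mconst p1, \<beta>:]"
      unfolding x0_def by (simp add: fps_of_poly_pCons fps_of_poly_const)
    have "0 = poly (map_poly fps_const P) x0"
      using er e.hom_poly[of P "mvar 2"] by (simp add: P_def poly_separate map[unfolded P_def] e_var)
    also have "map_poly fps_const P = map_poly fps_of_poly (map_poly (\<lambda>c. [:c:]) P)"
      by (rule poly_eqI) (simp add: coeff_map_poly fps_of_poly_const)
    also have "poly \<dots> x0 = fps_of_poly (pcompose P [:mconst p1, \<beta>:])"
      unfolding x0 pcompose_altdef by (rule fp.hom_poly[symmetric])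
    finally have "pcompose P [:mconst p1, \<beta>:] = 0"
      by (metis fps_of_poly_0 fps_of_poly_eq_iff)
    then have "P = 0" by (rule pcompose_eq_0) (use \<beta> in simp)
    then show False using r(2) by (simp add: P_def)
  qed
  show "\<forall>k\<in>J. c k = 0"
  proof
    fix k assume k: "k \<in> J"
    interpret s1: comm_ring_hom "separate (2::nat) :: (nat, 'k) mpol \<Rightarrow> _" by (rule separate_hom)
    interpret s2: comm_ring_hom "separate (3::nat) :: (nat, 'k) mpol \<Rightarrow> _" by (rule separate_hom)
    have m1: "separate 2 (c k) = [:c k:]" if "k \<in> J" for k
      by (rule separate_const, rule mpols_in_mono[OF _ c[OF that]]) auto
    have m2: "separate 3 (c k * mvar 2 ^ n) = [:c k * mvar 2 ^ n:]" if "k \<in> J" for k n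
    proof (rule separate_const)
      have "c k \<in> mpols_in (- {3})" by (rule mpols_in_mono[OF _ c[OF that]]) auto
      then show "c k * mvar 2 ^ n \<in> mpols_in (- {3})"
        by (auto intro!: mpols_in_intros mpols_in_mvar)
    qed
    \<comment> \<open>The coefficients are read off from \<open>g = 0\<close>, first by the power of
      \<open>y\<close>, then by that of \<open>x\<close>.\<close>
    have "separate 3 g = (\<Sum>k\<in>J. monom (c k * mvar 2 ^ fst k) (snd k))"
      unfolding g_def s2.hom_sum
    proof (rule sum.cong)
      fix k assume "k \<in> J"
      then show "separate 3 (c k * mvar 2 ^ fst k * mvar 3 ^ snd k) = monom (c k * mvar 2 ^ fst k) (snd k)"
        using m2 by (simp add: s2.hom_mult[of "c k * mvar 2 ^ fst k"] s2.hom_power separate_mvar monom_altdef)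
    qed simp
    then have "0 = coeff (\<Sum>k\<in>J. monom (c k * mvar 2 ^ fst k) (snd k)) (snd k)"
      using \<open>g = 0\<close> s2.hom_zero by simp
    also have "\<dots> = (\<Sum>k'\<in>J. if snd k' = snd k then c k' * mvar 2 ^ fst k' else 0)"
      by (simp add: coeff_sum)
    finally have "0 = separate 2 (\<Sum>k'\<in>J. if snd k' = snd k then c k' * mvar 2 ^ fst k' else 0)"
      by (simp add: s1.hom_zero)
    also have "\<dots> = (\<Sum>k'\<in>J. if snd k' = snd k then monom (c k') (fst k') else 0)"
      unfolding s1.hom_sum
      by (rule sum.cong) (auto simp: s1.hom_simps m1 separate_mvar monom_altdef)
    finally have "0 = coeff (\<Sum>k'\<in>J. if snd k' = snd k then monom (c k') (fst k') else 0) (fst k)"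
      by simp
    also have "\<dots> = (\<Sum>k'\<in>J. if k' = k then c k else 0)"
      unfolding coeff_sum by (rule sum.cong) (auto simp: prod_eq_iff)
    also have "\<dots> = c k" using J(1) k by simp
    finally show "c k = 0" ..
  qed
qed

end

subsection \<open>Changing coefficients and variables\<close>

definition map_mpol :: "('c::comm_ring_1 \<Rightarrow> 's::comm_ring_1) \<Rightarrow> ('v, 'c) mpol \<Rightarrow> ('v, 's) mpol" where
  "map_mpol h = insertion (\<lambda>c. mconst (h c)) mvar"

lemma (in comm_ring_hom) map_mpol_hom: "comm_ring_hom (map_mpol h)"
  unfolding map_mpol_def
  by (rule insertion_hom, rule comm_ring_hom.comp_hom[OF _ comm_ring_hom_mconst], unfold_locales)

lemma insertion_map_mpol:
  assumes "comm_ring_hom \<iota>"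
  shows "insertion \<iota> \<theta> (map_mpol h f) = insertion (\<lambda>c. \<iota> (h c)) \<theta> f"
proof -
  have "insertion \<iota> \<theta> (map_mpol h f) =
      insertion (\<lambda>c. insertion \<iota> \<theta> (mconst (h c))) (\<lambda>v. insertion \<iota> \<theta> (mvar v)) f"
    unfolding map_mpol_def by (rule comm_ring_hom.hom_insertion[OF insertion_hom[OF assms]])
  then show ?thesis
    using assms by (simp add: insertion_mconst insertion_mvar comm_ring_hom.hom_zero)
qed

lemma map_mpol_single:
  assumes "comm_ring_hom h"
  shows "map_mpol h (Poly_Mapping.single m c) = Poly_Mapping.single m (h c)"
  using comm_ring_hom.hom_zero[OF assms] comm_ring_hom.hom_zero[OF comm_ring_hom_mconst]
  unfolding map_mpol_def
  by (subst insertion_single) (simp_all add: monom_val_mvar mconst_def mult_single)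

lemma deg_in_map_mpol_le: "deg_in v (map_mpol h f) \<le> deg_in v f"
  unfolding map_mpol_def by (rule deg_in_insertion_le) (auto simp: deg_in_mvar)

text \<open>Generic, special and actual members are this construction for different
  \<open>\<kappa>\<close> and \<open>U\<close>; \<open>map_mpol_pencil_member\<close> carries one
  into another.\<close>

definition pencil_member ::
    "('k::comm_ring_1 \<Rightarrow> 's::comm_ring_1) \<Rightarrow> ('v, 'k) mpol \<Rightarrow> ('v, 'k) mpol \<Rightarrow>
     ('v \<Rightarrow>\<^sub>0 nat) set \<Rightarrow> (('v \<Rightarrow>\<^sub>0 nat) \<Rightarrow> 's) \<Rightarrow> ('v, 's) mpol" where
  "pencil_member \<kappa> A B E U =
     map_mpol \<kappa> A + map_mpol \<kappa> B * (\<Sum>m\<in>E. Poly_Mapping.single m (U m))"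

lemma insertion_pencil_member:
  assumes "comm_ring_hom \<iota>"
  shows "insertion \<iota> \<theta> (pencil_member \<kappa> A B E U) = insertion (\<lambda>c. \<iota> (\<kappa> c)) \<theta> A +
     insertion (\<lambda>c. \<iota> (\<kappa> c)) \<theta> B * (\<Sum>m\<in>E. \<iota> (U m) * monom_val \<theta> m)"
proof -
  interpret comm_ring_hom "insertion \<iota> \<theta>" by (rule insertion_hom[OF assms])
  have "insertion \<iota> \<theta> (Poly_Mapping.single m c) = \<iota> c * monom_val \<theta> m" for m c
    by (rule insertion_single) (rule comm_ring_hom.hom_zero[OF assms])
  then show ?thesis
    by (simp add: pencil_member_def hom_simps insertion_map_mpol[OF assms])
qed

lemma (in comm_ring_hom) map_mpol_pencil_member:
  "map_mpol h (pencil_member \<kappa> A B E U) = pencil_member (\<lambda>c. h (\<kappa> c)) A B E (\<lambda>m. h (U m))"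
proof -
  have h: "comm_ring_hom h" by unfold_locales
  have *: "map_mpol h (map_mpol \<kappa> f) = map_mpol (\<lambda>c. h (\<kappa> c)) f" for f :: "('v, _) mpol"
    unfolding map_mpol_def[of h]
    by (subst insertion_map_mpol[OF comp_hom[OF comm_ring_hom_mconst]]) (simp add: map_mpol_def)
  interpret m: comm_ring_hom "map_mpol h" by (rule map_mpol_hom)
  show ?thesis
    by (simp add: pencil_member_def m.hom_simps * map_mpol_single[OF h])
qed

text \<open>The Nullstellensatz in one variable: the linear factors of \<open>p\<close>, with
  multiplicity, are matched one by one with copies of \<open>r\<close>.\<close>

lemma dvd_power_of_common_roots:
  fixes p r :: "'e::alg_closed_field poly"
  assumes "p \<noteq> 0" "degree p \<le> n" "\<And>x. poly p x = 0 \<Longrightarrow> poly r x = 0"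
  shows "p dvd r ^ n"
  using assms
proof (induction n arbitrary: p)
  case 0
  then show ?case by (simp add: is_unit_iff_degree)
next
  case (Suc n)
  show ?case
  proof (cases "degree p = 0")
    case True
    then show ?thesis using Suc.prems(1) by (meson dvd_trans is_unit_iff_degree one_dvd)
  next
    case False
    then obtain x where x: "poly p x = 0" using alg_closed_imp_poly_has_root[of p] by auto
    then obtain p' where p': "p = [:- x, 1:] * p'" by (metis poly_eq_0_iff_dvd dvdE)
    obtain r' where r': "r = [:- x, 1:] * r'"
      using Suc.prems(3)[OF x] by (metis poly_eq_0_iff_dvd dvdE)
    have nz: "p' \<noteq> 0" using Suc.prems(1) p' by auto
    have "degree p = Suc (degree p')"
      unfolding p' using nz by (subst degree_mult_eq) auto
    then have "p' dvd r ^ n"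
      using Suc.IH[OF nz] Suc.prems(2,3) p' by simp
    then have "[:- x, 1:] * p' dvd r * r ^ n"
      by (intro mult_dvd_mono) (simp only: r' dvd_triv_left)
    then show ?thesis unfolding p' power_Suc .
  qed
qed

lemma (in comm_ring_hom) hom_nonzero:
  assumes "x \<noteq> 0" "x * y = 1" "(1 :: 'b) \<noteq> 0"
  shows "h x \<noteq> 0"
  using assms by (metis hom_mult hom_one mult_zero_left)

section \<open>Renaming variables into the natural numbers\<close>

definition rename :: "('v \<Rightarrow> 'w) \<Rightarrow> ('v, 'c::comm_ring_1) mpol \<Rightarrow> ('w, 'c) mpol" where
  "rename \<nu> = insertion mconst (\<lambda>v. mvar (\<nu> v))"

definition unrename :: "('v \<Rightarrow> 'w) \<Rightarrow> ('w, 'c::comm_ring_1) mpol \<Rightarrow> ('v, 'c) mpol" where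
  "unrename \<nu> = insertion mconst (\<lambda>w. if w \<in> range \<nu> then mvar (inv_into UNIV \<nu> w) else 0)"

lemma rename_hom: "comm_ring_hom (rename \<nu>)"
  unfolding rename_def by (rule insertion_hom[OF comm_ring_hom_mconst])

lemma unrename_hom: "comm_ring_hom (unrename \<nu>)"
  unfolding unrename_def by (rule insertion_hom[OF comm_ring_hom_mconst])

lemma rename_in: "rename \<nu> f \<in> mpols_in (range \<nu>)"
  unfolding rename_def
  by (rule insertion_in_subring[OF is_subring_mpols_in, where I = UNIV]) (auto simp: mpols_in_mvar)

lemma unrename_rename:
  assumes "inj \<nu>"
  shows "unrename \<nu> (rename \<nu> f) = f"
proof -
  have "unrename \<nu> (rename \<nu> f) =
      insertion (\<lambda>c. unrename \<nu> (mconst c)) (\<lambda>v. unrename \<nu> (mvar (\<nu> v))) f"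
    unfolding rename_def[of \<nu>] by (rule comm_ring_hom.hom_insertion[OF unrename_hom])
  also have "(\<lambda>c. unrename \<nu> (mconst c)) = mconst"
    unfolding unrename_def
    by (auto simp: insertion_mconst comm_ring_hom.hom_zero[OF comm_ring_hom_mconst])
  also have "(\<lambda>v. unrename \<nu> (mvar (\<nu> v))) = mvar"
    unfolding unrename_def using assms by (auto simp: insertion_mvar[OF comm_ring_hom_mconst])
  finally show ?thesis by simp
qed

lemma rename_unrename:
  assumes "f \<in> mpols_in (range \<nu>)"
  shows "rename \<nu> (unrename \<nu> f) = f"
proof -
  have "rename \<nu> (unrename \<nu> f) = insertion (\<lambda>c. rename \<nu> (mconst c))
      (\<lambda>w. rename \<nu> (if w \<in> range \<nu> then mvar (inv_into UNIV \<nu> w) else 0)) f"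
    unfolding unrename_def by (rule comm_ring_hom.hom_insertion[OF rename_hom])
  also have "\<dots> = insertion mconst mvar f"
    by (rule insertion_cong[OF assms])
       (auto simp: rename_def insertion_mvar[OF comm_ring_hom_mconst] insertion_mconst f_inv_into_f
          comm_ring_hom.hom_zero[OF comm_ring_hom_mconst])
  finally show ?thesis by simp
qed

lemma rename_nonzero: "inj \<nu> \<Longrightarrow> f \<noteq> 0 \<Longrightarrow> rename \<nu> f \<noteq> 0"
  using unrename_rename comm_ring_hom.hom_zero[OF unrename_hom] by metis

lemma deg_in_rename:
  assumes "inj \<nu>"
  shows "deg_in (\<nu> v) (rename \<nu> f) = deg_in v f"
proof (rule antisym)
  show "deg_in (\<nu> v) (rename \<nu> f) \<le> deg_in v f"
    unfolding rename_def by (rule deg_in_insertion_le) (use assms in \<open>auto simp: deg_in_mvar inj_eq\<close>)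
  have "deg_in v (unrename \<nu> (rename \<nu> f)) \<le> deg_in (\<nu> v) (rename \<nu> f)"
    unfolding unrename_def
    by (rule deg_in_insertion_le) (use assms in \<open>auto simp: deg_in_mvar inj_eq\<close>)
  then show "deg_in v f \<le> deg_in (\<nu> v) (rename \<nu> f)" by (simp add: unrename_rename[OF assms])
qed

text \<open>An injection into \<open>nat\<close> supplies the order on the variables that
  \<open>deg_in_mult\<close> asks for.\<close>

lemma deg_in_mult_finite:
  fixes f g :: "('n::finite, 'c::idom) mpol"
  assumes "f \<noteq> 0" "g \<noteq> 0"
  shows "deg_in v (f * g) = deg_in v f + deg_in v g"
proof -
  obtain \<nu> :: "'n \<Rightarrow> nat" where \<nu>: "inj \<nu>"
    using finite_imp_inj_to_nat_seg[of "UNIV :: 'n set"] by auto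
  have "deg_in (\<nu> v) (rename \<nu> f * rename \<nu> g) = deg_in (\<nu> v) (rename \<nu> f) + deg_in (\<nu> v) (rename \<nu> g)"
    by (rule deg_in_mult[OF rename_nonzero[OF \<nu> assms(1)] rename_nonzero[OF \<nu> assms(2)]])
  then show ?thesis
    by (simp only: comm_ring_hom.hom_mult[OF rename_hom, symmetric] deg_in_rename[OF \<nu>])
qed

section \<open>The special and the generic member on a slice\<close>

locale pencil_slice =
  fixes A B :: "('n::finite, 'k::field) mpol" and d :: "'n \<Rightarrow> nat" and i j :: 'n and q :: "'n \<Rightarrow> 'k"
  assumes ij: "i \<noteq> j" and d: "d i > 0" "d j > 0" and Bq: "mpol_eval q B \<noteq> 0"
begin

definition slice :: "('n, 'k) mpol \<Rightarrow> (nat, 'k) mpol" where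
  "slice = insertion mconst (\<lambda>v. if v = i then mvar 2 else if v = j then mvar 3 else mconst (q v))"

text \<open>The degree bound of \<open>deg_in_pencil_member\<close>, which the slice
  \<open>sm.ff\<close> of the special member reaches in both of its coordinates.\<close>

definition bound :: "'n \<Rightarrow> nat" where
  "bound v = max (deg_in v A) (deg_in v B + d v)"

text \<open>Puts \<open>q\<close> on the special member: \<open>A + c0 B\<close> vanishes there, and
  so do the terms built from \<open>di\<close> and \<open>dj\<close>.\<close>

definition c0 :: 'k where "c0 = - mpol_eval q A / mpol_eval q B"

abbreviation "di \<equiv> mvar i - mconst (q i) :: ('n, 'k) mpol"
abbreviation "dj \<equiv> mvar j - mconst (q j) :: ('n, 'k) mpol"

text \<open>The point with coordinates in \<open>k[s, t]\<close> at which the generic conditions are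
  tested: the coefficient vector of the multiplier of \<open>B\<close> in the special
  member.\<close>

definition special :: "('n \<Rightarrow>\<^sub>0 nat) \<Rightarrow> (nat, 'k) mpol" where
  "special m = mconst (Poly_Mapping.lookup (mconst c0) m) +
     mvar 5 * mconst (Poly_Mapping.lookup di m) +
     mvar 4 * mconst (Poly_Mapping.lookup (dj * (1 + di ^ d i * dj ^ (d j - 1))) m)"

lemma insertion_Pol:
  assumes "comm_ring_hom \<iota>" "M \<in> Pol d"
  shows "insertion \<iota> \<theta> M = (\<Sum>m\<in>exponents d. \<iota> (Poly_Mapping.lookup M m) * monom_val \<theta> m)"
  by (rule insertion_superset)
     (use assms(2) in \<open>auto simp: Pol_iff finite_exponents comm_ring_hom.hom_zero[OF assms(1)]\<close>)

lemma special_in_Pol: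
  "mconst c0 \<in> Pol d" "di \<in> Pol d" "dj * (1 + di ^ d i * dj ^ (d j - 1)) \<in> Pol d"
proof -
  let ?P = "di ^ d i * dj ^ (d j - 1)"
  have pow: "deg_in v (f ^ n) \<le> n * deg_in v f" for v n and f :: "('n, 'k) mpol"
  proof (induction n)
    case (Suc n)
    then show ?case using deg_in_mult_le[of v f "f ^ n"] by simp
  qed simp
  have le: "deg_in v (dj * (1 + ?P)) \<le> deg_in v dj + (d i * deg_in v di + (d j - 1) * deg_in v dj)" for v
  proof -
    have "deg_in v ?P \<le> d i * deg_in v di + (d j - 1) * deg_in v dj"
      using deg_in_mult_le[of v "di ^ d i" "dj ^ (d j - 1)"] pow[of v di "d i"] pow[of v dj "d j - 1"]
      by linarith
    then have "deg_in v (1 + ?P) \<le> d i * deg_in v di + (d j - 1) * deg_in v dj"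
      using deg_in_add_le[of v 1 ?P] by simp
    then show ?thesis using deg_in_mult_le[of v dj "1 + ?P"] by linarith
  qed
  have "deg_in v (dj * (1 + ?P)) \<le> d v" for v
  proof (cases "v = j")
    case True
    then show ?thesis using le[of v] ij d by (simp add: deg_in_mvar_minus_const)
  next
    case False
    then show ?thesis
      using le[of v] by (cases "v = i") (simp_all add: deg_in_mvar_minus_const)
  qed
  then show "dj * (1 + di ^ d i * dj ^ (d j - 1)) \<in> Pol d" by (simp add: Pol_def)
  show "mconst c0 \<in> Pol d" "di \<in> Pol d"
    using d by (auto simp: Pol_def deg_in_mvar_minus_const)
qed

text \<open>The coefficient sum refolds into a closed form, because the three polynomials behind
  \<open>special\<close> lie in \<open>Pol d\<close>.\<close>

lemma insertion_special:
  fixes \<theta> :: "'n \<Rightarrow> 's::comm_ring_1"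
  assumes "comm_ring_hom \<iota>"
  defines "xx \<equiv> \<theta> i - \<iota> (mconst (q i))" and "yy \<equiv> \<theta> j - \<iota> (mconst (q j))"
  shows "insertion \<iota> \<theta> (pencil_member mconst A B (exponents d) special) =
     insertion (\<lambda>c. \<iota> (mconst c)) \<theta> A + insertion (\<lambda>c. \<iota> (mconst c)) \<theta> B *
       (\<iota> (mconst c0) + \<iota> (mvar 5) * xx + \<iota> (mvar 4) * (yy * (1 + xx ^ d i * yy ^ (d j - 1))))"
proof -
  interpret i: comm_ring_hom \<iota> by fact
  let ?i = "\<lambda>c. \<iota> (mconst c)"
  have hom: "comm_ring_hom ?i"
    by (rule comm_ring_hom.comp_hom[OF comm_ring_hom_mconst assms(1)])
  interpret e: comm_ring_hom "insertion ?i \<theta>" by (rule insertion_hom[OF hom])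
  let ?M = "dj * (1 + di ^ d i * dj ^ (d j - 1))"
  have "(\<Sum>m\<in>exponents d. \<iota> (special m) * monom_val \<theta> m) =
      insertion ?i \<theta> (mconst c0) + \<iota> (mvar 5) * insertion ?i \<theta> di + \<iota> (mvar 4) * insertion ?i \<theta> ?M"
    unfolding insertion_Pol[OF hom special_in_Pol(1)] insertion_Pol[OF hom special_in_Pol(2)]
      insertion_Pol[OF hom special_in_Pol(3)] special_def i.hom_simps
    by (simp only: sum_distrib_left distrib_right sum.distrib mult.assoc)
  also have "insertion ?i \<theta> di = xx"
    by (simp add: e.hom_simps insertion_mvar[OF hom] insertion_mconst comm_ring_hom.hom_zero[OF hom] xx_def)
  also have "insertion ?i \<theta> ?M = yy * (1 + xx ^ d i * yy ^ (d j - 1))"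
    by (simp add: e.hom_simps insertion_mvar[OF hom] insertion_mconst comm_ring_hom.hom_zero[OF hom]
        xx_def yy_def)
  also have "insertion ?i \<theta> (mconst c0) = \<iota> (mconst c0)"
    by (simp add: insertion_mconst comm_ring_hom.hom_zero[OF hom])
  finally show ?thesis
    by (simp only: insertion_pencil_member[OF assms(1)])
qed

end

lemma (in comm_ring_hom) poly_map_hom: "comm_ring_hom (\<lambda>p. poly (map_poly h p) y)"
  by (rule comm_ring_hom.comp_hom[OF map_poly_hom comm_ring_hom_poly])

lemma comm_ring_hom_pcompose: "comm_ring_hom (\<lambda>p. pcompose p (r :: 'a::comm_ring_1 poly))"
  by unfold_locales (simp_all add: pcompose_add pcompose_mult pcompose_1)

lemma mconst_eq_0_iff [simp]: "mconst c = 0 \<longleftrightarrow> c = 0"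
  by (metis mconst_def single_zero lookup_single_eq lookup_zero)

text \<open>The slice keeps coprimality, which makes the special member irreducible, and the
  degrees, so that a degree below \<open>bound\<close> is also below that of
  \<open>sm.ff\<close>.\<close>

locale good_slice = pencil_slice A B d i j q
  for A B :: "('n::finite, 'k::field) mpol" and d :: "'n \<Rightarrow> nat" and i j :: 'n and q :: "'n \<Rightarrow> 'k" +
  assumes slice_coprime: "c dvd slice A \<Longrightarrow> c dvd slice B \<Longrightarrow> c dvd 1"
    and slice_deg: "deg_in i A \<le> deg_in 2 (slice A)" "deg_in i B \<le> deg_in 2 (slice B)"
      "deg_in j A \<le> deg_in 3 (slice A)" "deg_in j B \<le> deg_in 3 (slice B)"
begin

lemma slice_in: "slice f \<in> mpols_in {2, 3}"
  unfolding slice_def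
  by (rule insertion_in_subring[OF is_subring_mpols_in, where I = UNIV]) (auto simp: mpols_in_mvar)

lemma slice_B_nonzero: "slice B \<noteq> 0"
proof
  assume *: "slice B = 0"
  let ?x = "\<lambda>v. if v = (2::nat) then q i else q j"
  have "mpol_eval ?x (slice B) = insertion (\<lambda>c. mpol_eval ?x (mconst c))
      (\<lambda>v. mpol_eval ?x (if v = i then mvar 2 else if v = j then mvar 3 else mconst (q v))) B"
    unfolding slice_def by (rule comm_ring_hom.hom_insertion[OF mpol_eval_hom])
  also have "\<dots> = mpol_eval q B"
    unfolding mpol_eval_eq_insertion[of q]
    by (rule insertion_cong[where I = UNIV]) (auto simp: mpol_eval_mconst mpol_eval_mvar)
  finally show False using * Bq by simp
qed

sublocale sm: special_member "slice A" "slice B" "q i" "q j" c0 "d i" "d j"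
  by unfold_locales (use slice_in slice_B_nonzero slice_coprime d in auto)

abbreviation "E \<equiv> exponents d"
abbreviation "Fspec \<equiv> pencil_member mconst A B E special"

lemma bound_le_deg: "bound i \<le> deg_in 2 sm.ff" "bound j \<le> deg_in 3 sm.ff"
  using sm.deg_ff slice_deg by (simp_all add: bound_def)

text \<open>Moves \<open>sm.monomials_independent\<close> to coordinates \<open>i\<close> and
  \<open>j\<close>: substituting the branch into the slice agrees with substituting it into the
  member in all variables, the remaining ones being held at \<open>q\<close>.\<close>

lemma special_independent:
  fixes \<beta> :: "(nat, 'k) mpol" and y0 :: "(nat, 'k) mpol fps" and c :: "nat \<times> nat \<Rightarrow> (nat, 'k) mpol"
  defines "x0 \<equiv> fps_const (mconst (q i)) + fps_const \<beta> * fps_X"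
  assumes \<beta>: "\<beta> \<noteq> 0"
    and root: "insertion fps_const ((\<lambda>v. fps_const (mconst (q v)))(i := x0, j := y0)) Fspec = 0"
    and J: "finite J" "(\<forall>k\<in>J. fst k < bound i) \<or> (\<forall>k\<in>J. snd k < bound j)"
    and c: "\<And>k. k \<in> J \<Longrightarrow> c k \<in> mpols_in {4, 5}"
    and dep: "\<And>l. (\<Sum>k\<in>J. c k * fps_nth (x0 ^ fst k * y0 ^ snd k) l) = 0"
  shows "\<forall>k\<in>J. c k = 0"
proof (rule sm.monomials_independent[OF \<beta> _ J(1) _ c])
  let ?\<iota> = "\<lambda>c. fps_const (mconst c :: (nat, 'k) mpol)"
  let ?t = "\<lambda>v. if v = 2 then x0 else if v = 3 then y0 else fps_const (mvar v)"
  let ?\<theta> = "(\<lambda>v. ?\<iota> (q v))(i := x0, j := y0)"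
  have \<iota>: "comm_ring_hom ?\<iota>"
    by (rule comm_ring_hom.comp_hom[OF comm_ring_hom_mconst comm_ring_hom_fps_const])
  interpret e: comm_ring_hom "insertion ?\<iota> ?t" by (rule insertion_hom[OF \<iota>])
  have vals: "insertion ?\<iota> ?t (mvar w) = ?t w" "insertion ?\<iota> ?t (mconst a) = ?\<iota> a" for w a
    by (rule insertion_mvar[OF \<iota>]) (rule insertion_mconst, rule comm_ring_hom.hom_zero[OF \<iota>])
  have sl: "insertion ?\<iota> ?t (slice f) = insertion ?\<iota> ?\<theta> f" for f
  proof -
    have "insertion ?\<iota> ?t (slice f) = insertion (\<lambda>c. insertion ?\<iota> ?t (mconst c)) (\<lambda>v. insertion ?\<iota> ?t
        (if v = i then mvar 2 else if v = j then mvar 3 else mconst (q v))) f"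
      unfolding slice_def by (rule e.hom_insertion)
    also have "\<dots> = insertion ?\<iota> ?\<theta> f"
      by (rule insertion_cong[where I = UNIV]) (use ij in \<open>auto simp: vals\<close>)
    finally show ?thesis .
  qed
  have eq: "insertion ?\<iota> ?t sm.ff = insertion fps_const ?\<theta> Fspec"
    unfolding sm.ff_def sm.mm_def sm.xx_def sm.yy_def e.hom_simps sl vals
      insertion_special[OF comm_ring_hom_fps_const]
    using ij by (simp add: algebra_simps del: fps_const_mult)
  show "insertion ?\<iota> (\<lambda>v. if v = 2 then fps_const (mconst (q i)) + fps_const \<beta> * fps_X
      else if v = 3 then y0 else fps_const (mvar v)) sm.ff = 0"
    unfolding eq[unfolded x0_def] by (rule root[unfolded x0_def])
  show "(\<forall>k\<in>J. fst k < deg_in 2 sm.ff) \<or> (\<forall>k\<in>J. snd k < deg_in 3 sm.ff)"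
    using J(2) bound_le_deg by (meson order_less_le_trans)
qed (use dep in \<open>simp_all add: x0_def\<close>)

text \<open>
  The generic member, with the coefficients of \<open>M\<close> as indeterminates; the second coordinate
  \<open>y\<close> of the base point is the variable of the outer polynomial ring.
\<close>

definition \<kappa> :: "'k \<Rightarrow> ('n \<Rightarrow>\<^sub>0 nat, 'k) mpol poly" where "\<kappa> c = [:mconst c:]"
definition F :: "('n, ('n \<Rightarrow>\<^sub>0 nat, 'k) mpol poly) mpol" where
  "F = pencil_member \<kappa> A B E (\<lambda>m. [:mvar m:])"
text \<open>\<open>F\<close> on the line through the base point in direction \<open>j\<close>,
  expanded at that point: the constant coefficient \<open>\<phi>\<close> is the value and the linear
  one \<open>\<alpha>\<close> the derivative.\<close>

definition f0 :: "('n \<Rightarrow>\<^sub>0 nat, 'k) mpol poly poly" where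
  "f0 = insertion (\<lambda>c. [:c:]) ((\<lambda>v. [:\<kappa> (q v):])(j := [:[:0, 1:], 1:])) F"
definition \<alpha> where "\<alpha> = coeff f0 1"
definition \<phi> where "\<phi> = coeff f0 0"

lemma \<phi>_eq: "\<phi> = insertion (\<lambda>c. c) ((\<lambda>v. \<kappa> (q v))(j := [:0, 1:])) F"
proof -
  have "\<phi> = poly f0 0" by (simp add: \<phi>_def poly_0_coeff_0)
  also have "\<dots> = insertion (\<lambda>c. poly [:c:] 0)
      (\<lambda>v. poly (((\<lambda>v. [:\<kappa> (q v):])(j := [:[:0, 1:], 1:])) v) 0) F"
    unfolding f0_def by (rule comm_ring_hom.hom_insertion[OF comm_ring_hom_poly])
  also have "\<dots> = insertion (\<lambda>c. c) ((\<lambda>v. \<kappa> (q v))(j := [:0, 1:])) F"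
    by (rule insertion_cong[where I = UNIV]) auto
  finally show ?thesis .
qed

lemma map_mpol_F:
  assumes "comm_ring_hom h"
  shows "map_mpol h F = pencil_member (\<lambda>c. h (\<kappa> c)) A B E (\<lambda>m. h [:mvar m:])"
  unfolding F_def by (rule comm_ring_hom.map_mpol_pencil_member[OF assms])

lemma hom_\<phi>:
  assumes "comm_ring_hom h"
  shows "h \<phi> = insertion (\<lambda>c. c) ((\<lambda>v. h (\<kappa> (q v)))(j := h [:0, 1:]))
     (pencil_member (\<lambda>c. h (\<kappa> c)) A B E (\<lambda>m. h [:mvar m:]))"
proof -
  have "h \<phi> = insertion (\<lambda>c. h c) (\<lambda>v. h (((\<lambda>v. \<kappa> (q v))(j := [:0, 1:])) v)) F"
    unfolding \<phi>_eq by (rule comm_ring_hom.hom_insertion[OF assms])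
  also have "(\<lambda>v. h (((\<lambda>v. \<kappa> (q v))(j := [:0, 1:])) v)) = (\<lambda>v. h (\<kappa> (q v)))(j := h [:0, 1:])"
    by (rule ext) simp
  also have "insertion (\<lambda>c. h c) \<dots> F = insertion (\<lambda>c. c) \<dots> (map_mpol h F)"
    using insertion_map_mpol[OF comm_ring_hom_id, of _ h F] by simp
  finally show ?thesis unfolding map_mpol_F[OF assms] .
qed

abbreviation "spec0 \<equiv> insertion mconst special"

text \<open>Sends the generic parameters and base point to the special ones. An element with nonzero
  image is a condition that holds at the special member.\<close>

definition spec :: "('n \<Rightarrow>\<^sub>0 nat, 'k) mpol poly \<Rightarrow> (nat, 'k) mpol" where
  "spec p = poly (map_poly spec0 p) (mconst (q j))"

lemma spec0_hom: "comm_ring_hom spec0"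
  by (rule insertion_hom[OF comm_ring_hom_mconst])

lemma spec_hom: "comm_ring_hom spec"
  unfolding spec_def by (rule comm_ring_hom.poly_map_hom[OF spec0_hom])

lemma spec0_values: "spec0 (mconst c) = mconst c" "spec0 (mvar m) = special m" "spec0 0 = 0" "spec0 1 = 1"
  by (simp_all add: insertion_mconst insertion_mvar[OF comm_ring_hom_mconst]
      comm_ring_hom.hom_zero[OF comm_ring_hom_mconst] comm_ring_hom.hom_one[OF spec0_hom])

lemma spec_values: "spec (\<kappa> c) = mconst c" "spec [:mvar m:] = special m" "spec [:0, 1:] = mconst (q j)"
  by (simp_all add: spec_def \<kappa>_def map_poly_pCons spec0_values)

lemma spec_\<phi>: "spec \<phi> = 0"
proof -
  have eval: "insertion mconst (\<lambda>v. mconst (q v)) f = (mconst (mpol_eval q f) :: (nat, 'k) mpol)" for f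
    unfolding mpol_eval_eq_insertion
    by (rule comm_ring_hom.hom_insertion[OF comm_ring_hom_mconst, symmetric])
  have "(\<lambda>v. mconst (q v))(j := mconst (q j)) = (\<lambda>v. mconst (q v) :: (nat, 'k) mpol)" by auto
  then have "spec \<phi> = insertion (\<lambda>c. c) (\<lambda>v. mconst (q v)) Fspec"
    unfolding hom_\<phi>[OF spec_hom] spec_values by simp
  also have "\<dots> = mconst (mpol_eval q A) + mconst (mpol_eval q B) * mconst c0"
    unfolding insertion_special[OF comm_ring_hom_id] by (simp add: eval)
  also have "\<dots> = mconst (mpol_eval q A + mpol_eval q B * c0)"
    by (simp only: comm_ring_hom.hom_simps[OF comm_ring_hom_mconst])
  also have "mpol_eval q A + mpol_eval q B * c0 = 0" using Bq by (simp add: c0_def)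
  finally show ?thesis by (simp add: comm_ring_hom.hom_zero[OF comm_ring_hom_mconst])
qed

definition fspec :: "(nat, 'k) mpol poly" where
  "fspec = insertion (\<lambda>c. [:c:]) ((\<lambda>v. [:mconst (q v):])(j := [:mconst (q j), 1:])) Fspec"

lemma map_poly_spec_f0: "map_poly spec f0 = fspec"
proof -
  interpret s: comm_ring_hom spec by (rule spec_hom)
  interpret m: comm_ring_hom "map_poly spec" by (rule s.map_poly_hom)
  have "map_poly spec f0 = insertion (\<lambda>c. map_poly spec [:c:])
      (\<lambda>v. map_poly spec (((\<lambda>v. [:\<kappa> (q v):])(j := [:[:0, 1:], 1:])) v)) F"
    unfolding f0_def by (rule m.hom_insertion)
  also have "\<dots> = insertion (\<lambda>c. [:spec c:]) ((\<lambda>v. [:mconst (q v):])(j := [:mconst (q j), 1:])) F"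
    by (rule insertion_cong[where I = UNIV])
       (auto simp: map_poly_pCons s.hom_zero s.hom_one spec_values)
  also have "\<dots> = insertion (\<lambda>c. [:c:]) ((\<lambda>v. [:mconst (q v):])(j := [:mconst (q j), 1:])) (map_mpol spec F)"
    by (rule insertion_map_mpol[OF comm_ring_hom_poly_const, symmetric])
  also have "map_mpol spec F = Fspec"
    unfolding map_mpol_F[OF spec_hom] spec_values ..
  finally show ?thesis unfolding fspec_def .
qed

text \<open>On the line through \<open>q\<close> in direction \<open>j\<close> the multiplier of
  \<open>B\<close> restricts to \<open>c0 + t z\<close>, since \<open>di\<close> vanishes there and
  \<open>d i\<close> is positive. The coefficient of \<open>z\<close> in the member is therefore
  linear in \<open>t\<close> with slope \<open>B(q)\<close>, which is nonzero.\<close>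

lemma coeff_fspec_1: "coeff fspec 1 \<noteq> 0"
proof -
  let ?\<iota> = "\<lambda>c. [:mconst c:] :: (nat, 'k) mpol poly"
  let ?\<theta> = "(\<lambda>v. [:mconst (q v):])(j := [:mconst (q j), 1:]) :: _ \<Rightarrow> (nat, 'k) mpol poly"
  let ?A = "insertion ?\<iota> ?\<theta> A" and ?B = "insertion ?\<iota> ?\<theta> B"
  have const: "coeff (insertion ?\<iota> ?\<theta> f) n \<in> mpols_in {}" for f n
  proof -
    have "insertion ?\<iota> ?\<theta> f \<in> {p. \<forall>n. coeff p n \<in> mpols_in {}}"
      by (rule insertion_in_subring[OF is_subring_coeffs[OF is_subring_mpols_in], where I = UNIV])
         (auto simp: coeff_pCons mpols_in_intros split: nat.splits)
    then show ?thesis by simp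
  qed
  obtain a1 where a1: "coeff ?A 1 = mconst a1"
    using const[of A 1] unfolding mpols_in_empty_iff by (elim exE)
  obtain b1 where b1: "coeff ?B 1 = mconst b1"
    using const[of B 1] unfolding mpols_in_empty_iff by (elim exE)
  have "coeff ?B 0 = poly ?B 0" by (simp add: poly_0_coeff_0)
  also have "\<dots> = insertion (\<lambda>c. poly (?\<iota> c) 0) (\<lambda>v. poly (?\<theta> v) 0) B"
    by (rule comm_ring_hom.hom_insertion[OF comm_ring_hom_poly])
  also have "\<dots> = insertion mconst (\<lambda>v. mconst (q v)) B"
    by (rule insertion_cong[where I = UNIV]) auto
  also have "\<dots> = mconst (mpol_eval q B)"
    unfolding mpol_eval_eq_insertion
    by (rule comm_ring_hom.hom_insertion[OF comm_ring_hom_mconst, symmetric])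
  finally have b0: "coeff ?B 0 = mconst (mpol_eval q B)" .
  have "fspec = ?A + ?B * [:mconst c0, mvar 4:]"
    unfolding fspec_def insertion_special[OF comm_ring_hom_poly_const] using ij d
    by (simp add: zero_power)
  also have "coeff \<dots> 1 = mconst (a1 + b1 * c0) + mvar 4 * mconst (mpol_eval q B)"
    by (simp add: a1[simplified] b1[simplified] b0 coeff_mult comm_ring_hom.hom_simps[OF comm_ring_hom_mconst])
  finally have eq: "coeff fspec 1 = \<dots>" .
  have "separate 4 (coeff fspec 1) = [:mconst (a1 + b1 * c0), mconst (mpol_eval q B):]"
    unfolding eq by (rule separate_linear) auto
  then have "separate 4 (coeff fspec 1) \<noteq> 0" using Bq by simp
  then show ?thesis unfolding separate_eq_0_iff .
qed

lemma spec_\<alpha>: "spec \<alpha> \<noteq> 0"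
proof -
  have "spec \<alpha> = coeff (map_poly spec f0) 1"
    by (simp add: \<alpha>_def coeff_map_poly comm_ring_hom.hom_zero[OF spec_hom])
  then show ?thesis using coeff_fspec_1 by (simp only: map_poly_spec_f0 not_False_eq_True)
qed

text \<open>Translating \<open>y\<close> by \<open>q j\<close> turns this polynomial into
  \<open>fspec\<close>, whose linear coefficient is nonzero.\<close>

lemma map_poly_spec0_\<phi>_nonzero: "map_poly spec0 \<phi> \<noteq> 0"
proof
  assume 0: "map_poly spec0 \<phi> = 0"
  let ?\<theta> = "(\<lambda>v. [:mconst (q v):])(j := [:0, 1:]) :: _ \<Rightarrow> (nat, 'k) mpol poly"
  let ?r = "[:mconst (q j), 1:] :: (nat, 'k) mpol poly"
  interpret m: comm_ring_hom "map_poly spec0" by (rule comm_ring_hom.map_poly_hom[OF spec0_hom])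
  have vals: "map_poly spec0 (\<kappa> c) = [:mconst c:]" "map_poly spec0 [:mvar m:] = [:special m:]"
    "map_poly spec0 [:0, 1:] = [:0, 1:]" for c m
    by (simp_all add: \<kappa>_def map_poly_pCons spec0_values)
  have "map_poly spec0 \<phi> = insertion (\<lambda>c. c) ?\<theta> (map_mpol (\<lambda>c. [:c:]) Fspec)"
    unfolding hom_\<phi>[OF m.comm_ring_hom_axioms] vals
      comm_ring_hom.map_mpol_pencil_member[OF comm_ring_hom_poly_const] ..
  also have "\<dots> = insertion (\<lambda>c. [:c:]) ?\<theta> Fspec"
    by (rule insertion_map_mpol[OF comm_ring_hom_id])
  finally have "pcompose (map_poly spec0 \<phi>) ?r =
      insertion (\<lambda>c. pcompose [:c:] ?r) (\<lambda>v. pcompose (?\<theta> v) ?r) Fspec"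
    using comm_ring_hom.hom_insertion[OF comm_ring_hom_pcompose] by metis
  also have "\<dots> = fspec"
    unfolding fspec_def by (rule insertion_cong[where I = UNIV]) (auto simp: pcompose_pCons)
  finally show False using 0 coeff_fspec_1 by simp
qed

end

subsection \<open>Elimination of the base point\<close>

context good_slice
begin

lemma spec_in: "spec p \<in> mpols_in {4, 5}"
proof -
  have sp: "special m \<in> mpols_in {4, 5}" for m
    unfolding special_def by (auto intro!: mpols_in_intros mpols_in_mvar)
  have "spec0 c \<in> mpols_in {4, 5}" for c
    by (rule insertion_in_subring[OF is_subring_mpols_in, where I = UNIV]) (auto simp: sp)
  then show ?thesis
    unfolding spec_def poly_altdef
    by (auto simp: coeff_map_poly spec0_values intro!: mpols_in_intros)
qed

text \<open>A factor short of full degree in one of the two variables has its exponents in one of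
  these boxes.\<close>

definition low_degrees :: "nat \<Rightarrow> nat \<Rightarrow> (nat \<times> nat) set \<Rightarrow> bool" where
  "low_degrees D D' J \<longleftrightarrow> J = {..<D} \<times> {..D'} \<or> J = {..D} \<times> {..<D'}"

text \<open>The branch is constructed once over \<open>k[u][y]\<close> and carried along every
  homomorphism. Its expanded monomials are independent at the special point, so
  \<open>linear_independence_open\<close> yields one polynomial for each box; \<open>P\<close> is
  their product.\<close>

lemma branch_polynomial:
  "\<exists>P. spec P \<noteq> 0 \<and> (\<forall>h :: ('n \<Rightarrow>\<^sub>0 nat, 'k) mpol poly \<Rightarrow> 'e::idom. comm_ring_hom h \<longrightarrow> h P \<noteq> 0 \<longrightarrow> h \<phi> = 0 \<longrightarrow>
     (\<exists>\<xi> \<eta>. insertion fps_const ((\<lambda>v. fps_const (h (\<kappa> (q v))))(i := \<xi>, j := \<eta>)) (map_mpol h F) = 0 \<and>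
        (\<forall>J c. low_degrees (bound i) (bound j) J \<longrightarrow>
           (\<Sum>k\<in>J. fps_const (c k) * (\<xi> ^ fst k * \<eta> ^ snd k)) = 0 \<longrightarrow> (\<forall>k\<in>J. c k = 0))))"
proof -
  obtain \<psi> where \<psi>: "insertion fps_const ((\<lambda>v. fps_const (\<kappa> (q v)))
      (i := fps_const (\<kappa> (q i)) + fps_const (\<alpha>\<^sup>2) * fps_X, j := fps_const [:0, 1:] + fps_const \<alpha> * \<psi>)) F =
      fps_const \<phi>"
    using smooth_branch[OF ij, of "\<lambda>v. \<kappa> (q v)" "[:0, 1:]" F] unfolding \<alpha>_def \<phi>_def f0_def by (elim exE)
  define \<xi> where "\<xi> = fps_const (\<kappa> (q i)) + fps_const (\<alpha>\<^sup>2) * fps_X"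
  define \<eta> where "\<eta> = fps_const [:0, 1:] + fps_const \<alpha> * \<psi>"
  define vec where "vec = (\<lambda>k l. fps_nth (\<xi> ^ fst k * \<eta> ^ snd k) l)"
  have mapped: "insertion fps_const ((\<lambda>v. fps_const (h (\<kappa> (q v))))(i := map_fps h \<xi>, j := map_fps h \<eta>))
      (map_mpol h F) = fps_const (h \<phi>)"
    and vec: "h (vec k l) = fps_nth (map_fps h \<xi> ^ fst k * map_fps h \<eta> ^ snd k) l"
    if h: "comm_ring_hom h" for h :: "('n \<Rightarrow>\<^sub>0 nat, 'k) mpol poly \<Rightarrow> 'z::comm_ring_1" and k l
  proof -
    interpret h: comm_ring_hom h by (rule h)
    interpret m: comm_ring_hom "map_fps h" by (rule h.map_fps_hom)
    have "fps_const (h \<phi>) = map_fps h (insertion fps_const ((\<lambda>v. fps_const (\<kappa> (q v)))(i := \<xi>, j := \<eta>)) F)"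
      using \<psi> by (simp only: \<xi>_def \<eta>_def h.map_fps_const)
    also have "\<dots> = insertion (\<lambda>c. map_fps h (fps_const c))
        (\<lambda>v. map_fps h (((\<lambda>v. fps_const (\<kappa> (q v)))(i := \<xi>, j := \<eta>)) v)) F"
      by (rule m.hom_insertion)
    also have "\<dots> = insertion (\<lambda>c. fps_const (h c))
        ((\<lambda>v. fps_const (h (\<kappa> (q v))))(i := map_fps h \<xi>, j := map_fps h \<eta>)) F"
      by (rule insertion_cong[where I = UNIV]) (simp_all add: h.map_fps_const)
    also have "\<dots> = insertion fps_const
        ((\<lambda>v. fps_const (h (\<kappa> (q v))))(i := map_fps h \<xi>, j := map_fps h \<eta>)) (map_mpol h F)"
      by (rule insertion_map_mpol[OF comm_ring_hom_fps_const, symmetric])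
    finally show "insertion fps_const ((\<lambda>v. fps_const (h (\<kappa> (q v))))(i := map_fps h \<xi>, j := map_fps h \<eta>))
      (map_mpol h F) = fps_const (h \<phi>)" by simp
    show "h (vec k l) = fps_nth (map_fps h \<xi> ^ fst k * map_fps h \<eta> ^ snd k) l"
      unfolding vec_def by (simp only: m.hom_mult[symmetric] m.hom_power[symmetric] fps_nth_map_fps)
  qed
  have spec_xi: "map_fps spec \<xi> = fps_const (mconst (q i)) + fps_const ((spec \<alpha>)\<^sup>2) * fps_X"
  proof -
    interpret h: comm_ring_hom spec by (rule spec_hom)
    interpret m: comm_ring_hom "map_fps spec" by (rule h.map_fps_hom)
    show ?thesis
      unfolding \<xi>_def by (simp only: m.hom_simps h.map_fps_const h.map_fps_X h.hom_simps spec_values)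
  qed
  have root: "insertion fps_const ((\<lambda>v. fps_const (mconst (q v)))
      (i := fps_const (mconst (q i)) + fps_const ((spec \<alpha>)\<^sup>2) * fps_X, j := map_fps spec \<eta>)) Fspec = 0"
    using mapped[OF spec_hom] unfolding map_mpol_F[OF spec_hom] spec_xi spec_values spec_\<phi> by simp
  have "\<exists>P. spec P \<noteq> 0 \<and> (\<forall>h :: _ \<Rightarrow> 'e. comm_ring_hom h \<longrightarrow> h P \<noteq> 0 \<longrightarrow>
      (\<forall>c. (\<forall>l. (\<Sum>k\<in>J. c k * h (vec k l)) = 0) \<longrightarrow> (\<forall>k\<in>J. c k = 0)))"
    if J: "finite J" "(\<forall>k\<in>J. fst k < bound i) \<or> (\<forall>k\<in>J. snd k < bound j)" for J
  \<comment> \<open>The coefficients are confined to \<open>k[s, t]\<close>, as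
    \<open>special_independent\<close> demands; the surrounding ring also contains the variables 2
    and 3.\<close>
  proof (rule linear_independence_open[OF spec_hom is_subring_mpols_in spec_in J(1)])
    fix c :: "nat \<times> nat \<Rightarrow> (nat, 'k) mpol"
    assume "\<And>k. k \<in> J \<Longrightarrow> c k \<in> mpols_in {4, 5}" "\<And>l. (\<Sum>k\<in>J. c k * spec (vec k l)) = 0"
    then show "\<forall>k\<in>J. c k = 0"
      unfolding vec[OF spec_hom] spec_xi
      by (intro special_independent[OF _ root J]) (use spec_\<alpha> in auto)
  qed
  note ex = this
  have "\<exists>P. spec P \<noteq> 0 \<and> (\<forall>h :: _ \<Rightarrow> 'e. comm_ring_hom h \<longrightarrow> h P \<noteq> 0 \<longrightarrow>
      (\<forall>c. (\<forall>l. (\<Sum>k\<in>{..<bound i} \<times> {..bound j}. c k * h (vec k l)) = 0) \<longrightarrow> (\<forall>k\<in>{..<bound i} \<times> {..bound j}. c k = 0)))"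
    by (rule ex) auto
  then obtain P1 where P1: "spec P1 \<noteq> 0" "\<And>(h :: _ \<Rightarrow> 'e) c. comm_ring_hom h \<Longrightarrow> h P1 \<noteq> 0 \<Longrightarrow>
      (\<And>l. (\<Sum>k\<in>{..<bound i} \<times> {..bound j}. c k * h (vec k l)) = 0) \<Longrightarrow> \<forall>k\<in>{..<bound i} \<times> {..bound j}. c k = 0"
    by blast
  have "\<exists>P. spec P \<noteq> 0 \<and> (\<forall>h :: _ \<Rightarrow> 'e. comm_ring_hom h \<longrightarrow> h P \<noteq> 0 \<longrightarrow>
      (\<forall>c. (\<forall>l. (\<Sum>k\<in>{..bound i} \<times> {..<bound j}. c k * h (vec k l)) = 0) \<longrightarrow> (\<forall>k\<in>{..bound i} \<times> {..<bound j}. c k = 0)))"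
    by (rule ex) auto
  then obtain P2 where P2: "spec P2 \<noteq> 0" "\<And>(h :: _ \<Rightarrow> 'e) c. comm_ring_hom h \<Longrightarrow> h P2 \<noteq> 0 \<Longrightarrow>
      (\<And>l. (\<Sum>k\<in>{..bound i} \<times> {..<bound j}. c k * h (vec k l)) = 0) \<Longrightarrow> \<forall>k\<in>{..bound i} \<times> {..<bound j}. c k = 0"
    by blast
  show ?thesis
  proof (intro exI[of _ "P1 * P2"] conjI allI impI)
    show "spec (P1 * P2) \<noteq> 0"
      using P1(1) P2(1) by (simp add: comm_ring_hom.hom_mult[OF spec_hom])
    fix h :: "('n \<Rightarrow>\<^sub>0 nat, 'k) mpol poly \<Rightarrow> 'e"
    assume h: "comm_ring_hom h" "h (P1 * P2) \<noteq> 0" "h \<phi> = 0"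
    have hP: "h P1 \<noteq> 0" "h P2 \<noteq> 0" using h(2) by (auto simp: comm_ring_hom.hom_mult[OF h(1)])
    show "\<exists>\<xi> \<eta>. insertion fps_const ((\<lambda>v. fps_const (h (\<kappa> (q v))))(i := \<xi>, j := \<eta>)) (map_mpol h F) = 0 \<and>
        (\<forall>J c. low_degrees (bound i) (bound j) J \<longrightarrow>
           (\<Sum>k\<in>J. fps_const (c k) * (\<xi> ^ fst k * \<eta> ^ snd k)) = 0 \<longrightarrow> (\<forall>k\<in>J. c k = 0))"
    proof (rule exI[of _ "map_fps h \<xi>"], rule exI[of _ "map_fps h \<eta>"], intro conjI allI impI)
      show "insertion fps_const ((\<lambda>v. fps_const (h (\<kappa> (q v))))(i := map_fps h \<xi>, j := map_fps h \<eta>))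
          (map_mpol h F) = 0"
        unfolding mapped[OF h(1)] h(3) by simp
      fix J and c :: "nat \<times> nat \<Rightarrow> 'e"
      assume J: "low_degrees (bound i) (bound j) J"
        and 0: "(\<Sum>k\<in>J. fps_const (c k) * (map_fps h \<xi> ^ fst k * map_fps h \<eta> ^ snd k)) = 0"
      have "(\<Sum>k\<in>J. c k * h (vec k l)) = 0" for l
        using arg_cong[OF 0, of "\<lambda>f. fps_nth f l"] unfolding vec[OF h(1)] by (simp add: fps_sum_nth)
      then show "\<forall>k\<in>J. c k = 0"
        using J P1(2)[OF h(1) hP(1), of c] P2(2)[OF h(1) hP(2), of c] unfolding low_degrees_def by blast
    qed
  qed
qed

text \<open>
  Eliminates the base point: the powers of \<open>P\<close> that the generic fibre \<open>\<phi>\<close> fails to divide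
  detect a root of \<open>\<phi>\<close> that is not a root of \<open>P\<close>.
\<close>

lemma exists_root_polynomial:
  assumes P: "spec P \<noteq> 0"
  shows "\<exists>Q. spec0 Q \<noteq> 0 \<and> (\<forall>h :: ('n \<Rightarrow>\<^sub>0 nat, 'k) mpol \<Rightarrow> 'e::alg_closed_field. comm_ring_hom h \<longrightarrow> h Q \<noteq> 0 \<longrightarrow>
     map_poly h \<phi> \<noteq> 0 \<and> (\<exists>y. poly (map_poly h \<phi>) y = 0 \<and> poly (map_poly h P) y \<noteq> 0))"
proof -
  \<comment> \<open>By \<open>dvd_power_of_common_roots\<close>, divisibility of this power is what
    has to be excluded. The exponent suits every \<open>h\<close>, since the degree of
    \<open>\<phi>\<close> can only drop.\<close>
  define w where "w = P ^ degree \<phi>"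
  define n where "n = degree w"
  \<comment> \<open>The multiples \<open>\<phi> * y^l\<close> with \<open>l \<le> n\<close>,
    together with \<open>w\<close>: their images are dependent as soon as the image of
    \<open>\<phi>\<close> is nonzero and divides that of \<open>w\<close>, the quotient having
    degree at most \<open>n\<close>.\<close>
  define vec where "vec = (\<lambda>l. coeff (if l \<le> n then \<phi> * monom 1 l else w))"
  let ?J = "{..Suc n}"
  have split: "(\<Sum>l\<in>?J. c l * h (vec l m)) =
      coeff (map_poly h \<phi> * (\<Sum>l\<le>n. monom (c l) l) + smult (c (Suc n)) (map_poly h w)) m"
    if h: "comm_ring_hom h" for h :: "('n \<Rightarrow>\<^sub>0 nat, 'k) mpol \<Rightarrow> 'z::comm_ring_1" and c m
  proof -
    interpret h: comm_ring_hom h by (rule h)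
    interpret m: comm_ring_hom "map_poly h" by (rule h.map_poly_hom)
    have "c l * h (vec l m) = coeff (map_poly h \<phi> * monom (c l) l) m" if "l \<le> n" for l
    proof -
      have "c l * h (vec l m) = coeff (smult (c l) (map_poly h (\<phi> * monom 1 l))) m"
        using that by (simp add: vec_def coeff_map_poly h.hom_zero)
      also have "smult (c l) (map_poly h (\<phi> * monom 1 l)) = map_poly h \<phi> * monom (c l) l"
        by (simp add: m.hom_mult map_poly_monom h.hom_zero h.hom_one smult_monom mult_smult_right[symmetric])
      finally show ?thesis .
    qed
    then have "(\<Sum>l\<le>n. c l * h (vec l m)) = coeff (map_poly h \<phi> * (\<Sum>l\<le>n. monom (c l) l)) m"
      by (simp add: sum_distrib_left coeff_sum)
    then show ?thesis
      by (simp add: vec_def coeff_map_poly h.hom_zero)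
  qed
  have "\<exists>Q. spec0 Q \<noteq> 0 \<and> (\<forall>h :: _ \<Rightarrow> 'e. comm_ring_hom h \<longrightarrow> h Q \<noteq> 0 \<longrightarrow>
      (\<forall>c. (\<forall>m. (\<Sum>l\<in>?J. c l * h (vec l m)) = 0) \<longrightarrow> (\<forall>l\<in>?J. c l = 0)))"
  proof (rule linear_independence_open[OF spec0_hom, where S = UNIV])
    show "is_subring UNIV" by (simp add: is_subring_def)
    fix c :: "nat \<Rightarrow> (nat, 'k) mpol" assume "\<And>m. (\<Sum>l\<in>?J. c l * spec0 (vec l m)) = 0"
    then have 0: "map_poly spec0 \<phi> * (\<Sum>l\<le>n. monom (c l) l) + smult (c (Suc n)) (map_poly spec0 w) = 0"
      unfolding split[OF spec0_hom] by (intro poly_eqI) simp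
    \<comment> \<open>At the special base point \<open>\<phi>\<close> vanishes and \<open>w\<close>
      does not, so \<open>w\<close> cannot occur in the relation.\<close>
    have "c (Suc n) * spec w = 0"
      using arg_cong[OF 0, of "\<lambda>p. poly p (mconst (q j))"] spec_\<phi> unfolding spec_def by simp
    moreover have "spec w \<noteq> 0"
      unfolding w_def comm_ring_hom.hom_power[OF spec_hom] using P by simp
    ultimately have last: "c (Suc n) = 0" by simp
    then have sum0: "(\<Sum>l\<le>n. monom (c l) l) = 0" using 0 map_poly_spec0_\<phi>_nonzero by simp
    have "c l = 0" if "l \<le> n" for l
    proof -
      have "c l = coeff (\<Sum>l\<le>n. monom (c l) l) l"
        using that by (simp add: coeff_sum)
      then show ?thesis using sum0 by simp
    qed
    then show "\<forall>l\<in>?J. c l = 0" using last by (auto simp: le_Suc_eq)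
  qed auto
  then obtain Q where Q: "spec0 Q \<noteq> 0" "\<And>(h :: _ \<Rightarrow> 'e) c. comm_ring_hom h \<Longrightarrow> h Q \<noteq> 0 \<Longrightarrow>
      (\<And>m. (\<Sum>l\<in>?J. c l * h (vec l m)) = 0) \<Longrightarrow> \<forall>l\<in>?J. c l = 0"
    by blast
  show ?thesis
  proof (intro exI[of _ Q] conjI allI impI)
    fix h :: "('n \<Rightarrow>\<^sub>0 nat, 'k) mpol \<Rightarrow> 'e" assume h: "comm_ring_hom h" "h Q \<noteq> 0"
    interpret h: comm_ring_hom h by (rule h(1))
    interpret m: comm_ring_hom "map_poly h" by (rule h.map_poly_hom)
    have indep: "\<forall>l\<in>?J. c l = 0"
      if "map_poly h \<phi> * (\<Sum>l\<le>n. monom (c l) l) + smult (c (Suc n)) (map_poly h w) = 0" for c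
      by (rule Q(2)[OF h]) (simp only: split[OF h(1)] that coeff_0)
    show nz: "map_poly h \<phi> \<noteq> 0"
    proof
      assume "map_poly h \<phi> = 0"
      then have "\<forall>l\<in>?J. (if l = 0 then 1 else 0 :: 'e) = 0"
        by (intro indep) simp
      from this[THEN bspec, of 0] show False by simp
    qed
    show "\<exists>y. poly (map_poly h \<phi>) y = 0 \<and> poly (map_poly h P) y \<noteq> 0"
    proof (rule ccontr)
      assume "\<not> ?thesis"
      then have "map_poly h \<phi> dvd map_poly h P ^ degree \<phi>"
        by (intro dvd_power_of_common_roots nz map_poly_degree_leq) auto
      then have "map_poly h \<phi> dvd map_poly h w" by (simp add: w_def m.hom_power)
      then obtain s where s: "map_poly h w = map_poly h \<phi> * s" by (rule dvdE)
      define s' where "s' = (if map_poly h w = 0 then 0 else s)"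
      have s': "map_poly h w = map_poly h \<phi> * s'" using s by (simp add: s'_def)
      have "degree s' \<le> n"
      proof (cases "map_poly h w = 0")
        case False
        then have "s \<noteq> 0" using s by auto
        then have "degree s \<le> degree (map_poly h w)" using nz by (simp add: s degree_mult_eq)
        also have "\<dots> \<le> n" unfolding n_def by (rule map_poly_degree_leq)
        finally show ?thesis using False by (simp add: s'_def)
      qed (simp add: s'_def)
      then have sum: "(\<Sum>l\<le>n. monom (coeff s' l) l) = s'"
        by (rule poly_as_sum_of_monoms')
      \<comment> \<open>The entry \<open>-1\<close> at \<open>Suc n\<close> is the coefficient of
        \<open>w\<close> in the relation that expresses \<open>w\<close> as \<open>s'\<close> times
        \<open>\<phi>\<close>.\<close>
      have "(\<Sum>l\<le>n. monom (if l = Suc n then - 1 else coeff s' l) l) = (\<Sum>l\<le>n. monom (coeff s' l) l)"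
        by (rule sum.cong) auto
      then have "\<forall>l\<in>?J. (if l = Suc n then - 1 else coeff s' l) = 0"
        by (intro indep) (simp add: sum s')
      from this[THEN bspec, of "Suc n"] show False by simp
    qed
  qed (rule Q(1))
qed

end

section \<open>Generic conditions over the base field and factors of a generic member\<close>

lemma deg_in_pencil_member:
  assumes "\<And>m. m \<in> E \<Longrightarrow> Poly_Mapping.lookup m v \<le> n" "finite E"
  shows "deg_in v (pencil_member \<kappa> A B E U) \<le> max (deg_in v A) (deg_in v B + n)"
proof -
  have "deg_in v (\<Sum>m\<in>E. Poly_Mapping.single m (U m)) \<le> n"
    unfolding deg_in_le_iff
    using assms by (auto simp: in_keys_iff lookup_sum lookup_single when_def split: if_splits)
  then have "deg_in v (map_mpol \<kappa> B * (\<Sum>m\<in>E. Poly_Mapping.single m (U m))) \<le> deg_in v B + n"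
    using deg_in_mult_le[of v "map_mpol \<kappa> B"] deg_in_map_mpol_le[of v \<kappa> B]
    by (meson add_mono order_trans)
  then show ?thesis
    using deg_in_add_le[of v "map_mpol \<kappa> A"] deg_in_map_mpol_le[of v \<kappa> A]
    unfolding pencil_member_def by (meson max.mono order_trans)
qed

lemma infinite_poly_nonroot:
  fixes p :: "'a::idom poly"
  assumes "infinite (UNIV :: 'a set)" "p \<noteq> 0"
  shows "\<exists>s. poly p s \<noteq> 0"
proof (rule ccontr)
  assume "\<nexists>s. poly p s \<noteq> 0"
  then have "{s. poly p s = 0} = UNIV" by auto
  then show False using poly_roots_finite[OF assms(2)] assms(1) by simp
qed

text \<open>Restrict to the line through the two points.\<close>

lemma mpol_eval_common_nonzero:
  fixes f g :: "('v, 'k::field) mpol"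
  assumes "infinite (UNIV :: 'k set)" "mpol_eval x f \<noteq> 0" "mpol_eval y g \<noteq> 0"
  shows "\<exists>z. mpol_eval z f \<noteq> 0 \<and> mpol_eval z g \<noteq> 0"
proof -
  define L where "L = insertion (\<lambda>c::'k. [:c:]) (\<lambda>v. [:x v, y v - x v:])"
  have L: "poly (L h) s = mpol_eval (\<lambda>v. x v + s * (y v - x v)) h" for h s
    unfolding L_def mpol_eval_eq_insertion
    by (subst comm_ring_hom.hom_insertion[OF comm_ring_hom_poly]) simp
  have "poly (L f) 0 \<noteq> 0" "poly (L g) 1 \<noteq> 0"
    using assms(2,3) by (simp_all add: L)
  then have "L f * L g \<noteq> 0" by auto
  then obtain s where "poly (L f * L g) s \<noteq> 0"
    using infinite_poly_nonroot[OF assms(1)] by blast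
  then show ?thesis by (auto simp: L)
qed

text \<open>Nonempty open subsets of affine space over an infinite field meet; here for principal
  open sets, with equations confined to the indeterminates \<open>E\<close>.\<close>

lemma mpol_generic_finite_conj:
  fixes \<Phi> :: "'j \<Rightarrow> ('v \<Rightarrow> 'k::field) \<Rightarrow> bool"
  assumes "infinite (UNIV :: 'k set)" "finite J"
    and "\<And>j. j \<in> J \<Longrightarrow> \<exists>Q\<in>mpols_in E. (\<exists>u. mpol_eval u Q \<noteq> 0) \<and> (\<forall>u. mpol_eval u Q \<noteq> 0 \<longrightarrow> \<Phi> j u)"
  shows "\<exists>Q\<in>mpols_in E. (\<exists>u. mpol_eval u Q \<noteq> 0) \<and> (\<forall>u. mpol_eval u Q \<noteq> 0 \<longrightarrow> (\<forall>j\<in>J. \<Phi> j u))"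
  using assms(2,3)
proof (induction J)
  case empty
  show ?case by (rule bexI[of _ 1]) (simp_all add: mpols_in_1)
next
  case (insert j J)
  obtain Q x where Q: "Q \<in> mpols_in E" "mpol_eval x Q \<noteq> 0" "\<And>u. mpol_eval u Q \<noteq> 0 \<Longrightarrow> \<forall>j\<in>J. \<Phi> j u"
    using insert by blast
  obtain R y where R: "R \<in> mpols_in E" "mpol_eval y R \<noteq> 0" "\<And>u. mpol_eval u R \<noteq> 0 \<Longrightarrow> \<Phi> j u"
    using insert.prems[of j] by blast
  obtain z where "mpol_eval z Q \<noteq> 0" "mpol_eval z R \<noteq> 0"
    using mpol_eval_common_nonzero[OF assms(1) Q(2) R(2)] by blast
  then show ?case
    using Q R by (intro bexI[of _ "Q * R"]) (auto simp: mpol_eval_mult mpols_in_mult)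
qed

context good_slice
begin

lemma bound_pos: "bound i > 0" "bound j > 0"
  using d by (simp_all add: bound_def less_max_iff_disj)

definition full_degree :: "('n, 'e::zero) mpol \<Rightarrow> bool" where
  "full_degree G \<longleftrightarrow> bound i \<le> deg_in i G \<and> bound j \<le> deg_in j G"

text \<open>The root from \<open>exists_root_polynomial\<close> is a base point at which
  \<open>branch_polynomial\<close> supplies a branch. One of two factors vanishes on it, which
  forces full degree in \<open>i\<close> and \<open>j\<close>.\<close>

lemma generic_parameters:
  fixes emb :: "'k \<Rightarrow> 'e::alg_closed_field"
  assumes emb: "comm_ring_hom emb" and inf: "infinite (UNIV :: 'k set)"
  shows "\<exists>Q\<in>mpols_in E. (\<exists>u. mpol_eval u Q \<noteq> 0) \<and> (\<forall>u. mpol_eval u Q \<noteq> 0 \<longrightarrow>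
     (\<forall>G H. pencil_member emb A B E (\<lambda>m. emb (u m)) = G * H \<longrightarrow>
        G * H \<noteq> 0 \<and> (full_degree G \<or> full_degree H)))"
proof -
  obtain P where P: "spec P \<noteq> 0" "\<And>h :: ('n \<Rightarrow>\<^sub>0 nat, 'k) mpol poly \<Rightarrow> 'e. comm_ring_hom h \<Longrightarrow> h P \<noteq> 0 \<Longrightarrow> h \<phi> = 0 \<Longrightarrow>
     (\<exists>x y. insertion fps_const ((\<lambda>v. fps_const (h (\<kappa> (q v))))(i := x, j := y)) (map_mpol h F) = 0 \<and>
        (\<forall>J c. low_degrees (bound i) (bound j) J \<longrightarrow>
           (\<Sum>k\<in>J. fps_const (c k) * (x ^ fst k * y ^ snd k)) = 0 \<longrightarrow> (\<forall>k\<in>J. c k = 0)))"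
    using branch_polynomial[where 'e = 'e] by blast
  obtain Q where Q: "spec0 Q \<noteq> 0" "\<And>h :: ('n \<Rightarrow>\<^sub>0 nat, 'k) mpol \<Rightarrow> 'e. comm_ring_hom h \<Longrightarrow> h Q \<noteq> 0 \<Longrightarrow>
     map_poly h \<phi> \<noteq> 0 \<and> (\<exists>y. poly (map_poly h \<phi>) y = 0 \<and> poly (map_poly h P) y \<noteq> 0)"
    using exists_root_polynomial[OF P(1), where 'e = 'e] by blast
  \<comment> \<open>\<open>Q\<close> may contain indeterminates for exponents outside
    \<open>exponents d\<close>. Setting them to 0 keeps the value at the special point, where they
    are 0 already.\<close>
  define Z where "Z = insertion mconst (\<lambda>m. if m \<in> E then mvar m else 0) Q"
  have Z_in: "Z \<in> mpols_in E"
    unfolding Z_def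
    by (rule insertion_in_subring[OF is_subring_mpols_in, where I = UNIV])
       (auto simp: mpols_in_mvar mpols_in_intros)
  have Z_eval: "mpol_eval u Z = mpol_eval (\<lambda>m. if m \<in> E then u m else 0) Q" for u
  proof -
    have "mpol_eval u Z = insertion (\<lambda>c. mpol_eval u (mconst c))
        (\<lambda>m. mpol_eval u (if m \<in> E then mvar m else 0)) Q"
      unfolding Z_def by (rule comm_ring_hom.hom_insertion[OF mpol_eval_hom])
    also have "\<dots> = mpol_eval (\<lambda>m. if m \<in> E then u m else 0) Q"
      unfolding mpol_eval_eq_insertion[of "\<lambda>m. if m \<in> E then u m else 0"]
      by (rule insertion_cong[where I = UNIV]) auto
    finally show ?thesis .
  qed
  have "\<exists>u. mpol_eval u Z \<noteq> 0"
  proof -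
    obtain x where x: "mpol_eval x (spec0 Q) \<noteq> 0" using mpol_eval_nonzero[OF inf Q(1)] by blast
    have outside: "special m = 0" if "m \<notin> E" for m
    proof -
      have "Poly_Mapping.lookup M m = 0" if "M \<in> Pol d" for M :: "('n, 'k) mpol"
        using that \<open>m \<notin> E\<close> by (auto simp: Pol_iff in_keys_iff)
      from this[OF special_in_Pol(1)] this[OF special_in_Pol(2)] this[OF special_in_Pol(3)]
      show ?thesis
        unfolding special_def by (simp add: comm_ring_hom.hom_zero[OF comm_ring_hom_mconst])
    qed
    have "mpol_eval x (spec0 Q) = insertion (\<lambda>c. mpol_eval x (mconst c)) (\<lambda>m. mpol_eval x (special m)) Q"
      by (rule comm_ring_hom.hom_insertion[OF mpol_eval_hom])
    also have "\<dots> = mpol_eval (\<lambda>m. if m \<in> E then mpol_eval x (special m) else 0) Q"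
      unfolding mpol_eval_eq_insertion[of "\<lambda>m. if m \<in> E then mpol_eval x (special m) else 0"]
      by (rule insertion_cong[where I = UNIV]) (auto simp: outside)
    also have "\<dots> = mpol_eval (\<lambda>m. mpol_eval x (special m)) Z" by (rule Z_eval[symmetric])
    finally have "mpol_eval (\<lambda>m. mpol_eval x (special m)) Z \<noteq> 0" using x by metis
    then show ?thesis by (rule exI[where x = "\<lambda>m. mpol_eval x (special m)"])
  qed
  moreover have "G * H \<noteq> 0 \<and> (full_degree G \<or> full_degree H)"
    if u: "mpol_eval u Z \<noteq> 0" and GH: "pencil_member emb A B E (\<lambda>m. emb (u m)) = G * H" for u G H
  proof -
    interpret emb: comm_ring_hom emb by (rule emb)
    have emb_nz: "emb c \<noteq> 0" if "c \<noteq> 0" for c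
      using emb.hom_nonzero[of c "inverse c"] that by simp
    define u' where "u' = (\<lambda>m. if m \<in> E then u m else 0)"
    define h0 where "h0 = (\<lambda>f. emb (mpol_eval u' f))"
    interpret h0: comm_ring_hom h0
      unfolding h0_def by (rule comm_ring_hom.comp_hom[OF mpol_eval_hom emb])
    have "h0 Q \<noteq> 0" using u emb_nz by (simp add: h0_def Z_eval u'_def)
    then obtain y where y: "map_poly h0 \<phi> \<noteq> 0" "poly (map_poly h0 \<phi>) y = 0" "poly (map_poly h0 P) y \<noteq> 0"
      using Q(2)[OF h0.comm_ring_hom_axioms] by blast
    define h where "h = (\<lambda>p. poly (map_poly h0 p) y)"
    have h: "comm_ring_hom h" unfolding h_def by (rule h0.poly_map_hom)
    have h0_values: "h0 (mconst c) = emb c" "h0 (mvar m) = emb (u' m)" for c m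
      by (simp_all add: h0_def)
    have h_values: "h (\<kappa> c) = emb c" "h [:mvar m:] = emb (u' m)" for c m
      by (simp_all add: h_def \<kappa>_def map_poly_pCons h0.hom_zero h0_values)
    define Fu where "Fu = pencil_member emb A B E (\<lambda>m. emb (u m))"
    have Fu: "pencil_member emb A B E (\<lambda>m. emb (u' m)) = Fu"
      unfolding Fu_def pencil_member_def u'_def by simp
    obtain x1 x2 where root: "insertion fps_const ((\<lambda>v. fps_const (emb (q v)))(i := x1, j := x2)) Fu = 0"
      and indep: "\<And>J c. low_degrees (bound i) (bound j) J \<Longrightarrow>
           (\<Sum>k\<in>J. fps_const (c k) * (x1 ^ fst k * x2 ^ snd k)) = 0 \<Longrightarrow> \<forall>k\<in>J. c k = 0"
      using P(2)[OF h] y(2,3) unfolding map_mpol_F[OF h] h_values Fu by (auto simp: h_def)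
    let ?t = "(\<lambda>v. [:emb (q v):])(j := [:0, 1:])"
    let ?s = "(\<lambda>v. fps_const (emb (q v)))(i := x1, j := x2)"
    interpret t: comm_ring_hom "insertion (\<lambda>c::'e. [:c:]) ?t"
      by (rule insertion_hom[OF comm_ring_hom_poly_const])
    interpret s: comm_ring_hom "insertion (fps_const :: 'e \<Rightarrow> _) ?s"
      by (rule insertion_hom[OF comm_ring_hom_fps_const])
    \<comment> \<open>The fibre polynomial is \<open>Fu\<close> on the line through \<open>q\<close>
      in direction \<open>j\<close>; it is nonzero, so no factor of \<open>Fu\<close> vanishes on
      that line.\<close>
    have "map_poly h0 \<phi> = insertion (\<lambda>c. [:c:]) ?t Fu"
    proof -
      interpret m: comm_ring_hom "map_poly h0" by (rule h0.map_poly_hom)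
      have vals: "map_poly h0 (\<kappa> c) = [:emb c:]" "map_poly h0 [:mvar m:] = [:emb (u' m):]"
        "map_poly h0 [:0, 1:] = [:0, 1:]" for c m
        by (simp_all add: \<kappa>_def map_poly_pCons h0_values h0.hom_zero h0.hom_one)
      have "map_poly h0 \<phi> = insertion (\<lambda>c. c) ?t (map_mpol (\<lambda>c. [:c:]) Fu)"
        unfolding hom_\<phi>[OF m.comm_ring_hom_axioms] vals Fu[symmetric]
          comm_ring_hom.map_mpol_pencil_member[OF comm_ring_hom_poly_const] ..
      then show ?thesis using insertion_map_mpol[OF comm_ring_hom_id] by metis
    qed
    then have t_nz: "insertion (\<lambda>c. [:c:]) ?t Fu \<noteq> 0" using y(1) by simp
    then have Fu_nz: "Fu \<noteq> 0" by auto
    have full: "full_degree G" if Fu_eq: "Fu = G * H" and G0: "insertion fps_const ?s G = 0" for G H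
    proof -
      have nz: "G \<noteq> 0" "H \<noteq> 0" using Fu_nz Fu_eq by auto
      have tG: "insertion (\<lambda>c. [:c:]) ?t G \<noteq> 0" using t_nz unfolding Fu_eq t.hom_mult by auto
      have deg: "deg_in v G \<le> bound v" for v
      proof -
        have "deg_in v G \<le> deg_in v Fu" unfolding Fu_eq deg_in_mult_finite[OF nz] by simp
        also have "\<dots> \<le> bound v"
          unfolding Fu_def bound_def
          by (rule deg_in_pencil_member) (simp_all add: exponents_def finite_exponents[unfolded exponents_def])
        finally show ?thesis .
      qed
      \<comment> \<open>Low degree makes all slice coefficients vanish, by independence on the
        branch; then \<open>G\<close> would vanish on the line as well.\<close>
      have False if ab: "low_degrees (bound i) (bound j) ({..a} \<times> {..b})" "deg_in i G \<le> a" "deg_in j G \<le> b" for a b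
      proof -
        let ?c = "slice_coeff (\<lambda>v. emb (q v)) i j G"
        have "insertion fps_const ?s G =
            (\<Sum>k\<in>{..a} \<times> {..b}. fps_const (?c k) * (?s i ^ fst k * ?s j ^ snd k))"
          by (rule insertion_slice[OF comm_ring_hom_fps_const ij _ ab(2,3)]) simp
        then have "(\<Sum>k\<in>{..a} \<times> {..b}. fps_const (?c k) * (x1 ^ fst k * x2 ^ snd k)) = 0"
          using G0 ij by simp
        then have c0: "\<forall>k\<in>{..a} \<times> {..b}. ?c k = 0" by (rule indep[OF ab(1)])
        have "insertion (\<lambda>c. [:c:]) ?t G =
            (\<Sum>k\<in>{..a} \<times> {..b}. [:?c k:] * (?t i ^ fst k * ?t j ^ snd k))"
          by (rule insertion_slice[OF comm_ring_hom_poly_const ij _ ab(2,3)]) simp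
        also have "\<dots> = 0" by (rule sum.neutral) (use c0 in simp)
        finally show False using tG by simp
      qed
      note no = this
      show ?thesis
        unfolding full_degree_def
      proof (intro conjI leI notI)
        have lt: "{..<n} = {..n - 1}" if "n > 0" for n :: nat using that by auto
        assume "deg_in i G < bound i"
        then have "deg_in i G \<le> bound i - 1" by linarith
        moreover have "low_degrees (bound i) (bound j) ({..bound i - 1} \<times> {..bound j})"
          unfolding low_degrees_def lt[OF bound_pos(1)] by simp
        ultimately show False using no deg[of j] by blast
      next
        have lt: "{..<n} = {..n - 1}" if "n > 0" for n :: nat using that by auto
        assume "deg_in j G < bound j"
        then have "deg_in j G \<le> bound j - 1" by linarith
        moreover have "low_degrees (bound i) (bound j) ({..bound i} \<times> {..bound j - 1})"
          unfolding low_degrees_def lt[OF bound_pos(2)] by simp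
        ultimately show False using no deg[of i] by blast
      qed
    qed
    have Fu_GH: "Fu = G * H" using GH by (simp add: Fu_def)
    have "insertion fps_const ?s G * insertion fps_const ?s H = 0"
      using root unfolding Fu_GH s.hom_mult .
    then have "insertion fps_const ?s G = 0 \<or> insertion fps_const ?s H = 0" by simp
    then show ?thesis
      using full[OF Fu_GH] full[of H G] Fu_GH Fu_nz by (auto simp: mult.commute)
  qed
  ultimately show ?thesis using Z_in by blast
qed

end

subsection \<open>The main theorem\<close>

text \<open>The leading coefficient in \<open>w\<close> survives the specialisation of the other
  variables.\<close>

lemma deg_in_le_degree_specialized:
  fixes f :: "('v, 'k::field) mpol"
  assumes "mpol_eval x (lead_coeff (separate w f)) \<noteq> 0"
  shows "deg_in w f \<le> degree (insertion (\<lambda>c. [:c:]) (\<lambda>v. if v = w then [:0, 1:] else [:x v:]) f)"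
proof -
  interpret e: comm_ring_hom "mpol_eval x" by (rule mpol_eval_hom)
  interpret m: comm_ring_hom "map_poly (mpol_eval x)" by (rule e.map_poly_hom)
  have "map_poly (mpol_eval x) (separate w f) = insertion (\<lambda>c. map_poly (mpol_eval x) [:mconst c:])
      (\<lambda>v. map_poly (mpol_eval x) (if v = w then [:0, 1:] else [:mvar v:])) f"
    unfolding separate_def by (rule m.hom_insertion)
  also have "\<dots> = insertion (\<lambda>c. [:c:]) (\<lambda>v. if v = w then [:0, 1:] else [:x v:]) f"
    by (rule insertion_cong[where I = UNIV]) (auto simp: map_poly_pCons)
  finally have eq: "map_poly (mpol_eval x) (separate w f) =
      insertion (\<lambda>c. [:c:]) (\<lambda>v. if v = w then [:0, 1:] else [:x v:]) f" .
  have "coeff (map_poly (mpol_eval x) (separate w f)) (degree (separate w f)) \<noteq> 0"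
    using assms by (simp add: coeff_map_poly)
  then have "degree (separate w f) \<le> degree (map_poly (mpol_eval x) (separate w f))"
    by (rule le_degree)
  then show ?thesis unfolding eq degree_separate .
qed

text \<open>
  Each of the two eliminants is free of one of the variables, so a common divisor of the slices
  involves neither of them.
\<close>

lemma exists_good_slice:
  fixes A B :: "('n::finite, 'k::field) mpol"
  assumes inf: "infinite (UNIV :: 'k set)" and A: "A \<noteq> 0" and B: "B \<noteq> 0"
    and coprime: "relatively_prime A B" and "i \<noteq> j" and d: "d i > 0" "d j > 0"
  shows "\<exists>q. good_slice A B d i j q"
proof -
  obtain \<nu> :: "'n \<Rightarrow> nat" where \<nu>: "inj \<nu>"
    using finite_imp_inj_to_nat_seg[of "UNIV :: 'n set"] by auto
  interpret r: comm_ring_hom "rename \<nu> :: ('n, 'k) mpol \<Rightarrow> _" by (rule rename_hom)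
  interpret ur: comm_ring_hom "unrename \<nu> :: (nat, 'k) mpol \<Rightarrow> _" by (rule unrename_hom)
  define A' where "A' = rename \<nu> A"
  define B' where "B' = rename \<nu> B"
  have nz: "A' \<noteq> 0" "B' \<noteq> 0" using rename_nonzero[OF \<nu>] A B by (auto simp: A'_def B'_def)
  have ins: "A' \<in> mpols_in (range \<nu>)" "B' \<in> mpols_in (range \<nu>)"
    by (simp_all add: A'_def B'_def rename_in)
  have cop: "c dvd 1" if c: "c dvd A'" "c dvd B'" for c
  proof -
    have "c \<in> mpols_in (range \<nu>)" by (rule mpols_in_dvd[OF c(1) ins(1) nz(1)])
    moreover have "unrename \<nu> c dvd A" "unrename \<nu> c dvd B"
      using ur.hom_dvd[OF c(1)] ur.hom_dvd[OF c(2)] by (simp_all add: A'_def B'_def unrename_rename[OF \<nu>])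
    then have "unrename \<nu> c dvd 1" using coprime by (simp add: relatively_prime_def)
    then have "rename \<nu> (unrename \<nu> c) dvd rename \<nu> 1" by (rule r.hom_dvd)
    ultimately show ?thesis by (simp add: rename_unrename r.hom_one)
  qed
  have ex: "\<exists>r a b. r \<in> mpols_in (range \<nu> - {v}) \<and> r \<noteq> 0 \<and> r = a * A' + b * B'" for v
    by (rule eliminate_variable[OF ins disjI1[OF nz(1)]]) (simp_all add: cop)
  obtain r1 a1 b1 where r1: "r1 \<in> mpols_in (range \<nu> - {\<nu> j})" "r1 \<noteq> 0" "r1 = a1 * A' + b1 * B'"
    using ex[of "\<nu> j"] by (elim exE conjE)
  obtain r2 a2 b2 where r2: "r2 \<in> mpols_in (range \<nu> - {\<nu> i})" "r2 \<noteq> 0" "r2 = a2 * A' + b2 * B'"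
    using ex[of "\<nu> i"] by (elim exE conjE)
  let ?lc = "\<lambda>v f. lead_coeff (separate (\<nu> v) f)"
  have lc: "?lc v A' \<noteq> 0" "?lc v B' \<noteq> 0" for v using nz by simp_all
  \<comment> \<open>Each factor has its purpose: \<open>B'\<close> allows the division in
    \<open>c0\<close>, \<open>r1\<close> and \<open>r2\<close> keep the eliminants nonzero on the
    slice, and the leading coefficients preserve the degrees in \<open>i\<close> and
    \<open>j\<close>.\<close>
  have W: "B' * r1 * r2 * ?lc i A' * ?lc i B' * ?lc j A' * ?lc j B' \<noteq> 0"
    using nz r1(2) r2(2) lc by (simp only: mult_eq_0_iff de_Morgan_disj simp_thms)
  obtain x where "mpol_eval x (B' * r1 * r2 * ?lc i A' * ?lc i B' * ?lc j A' * ?lc j B') \<noteq> 0"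
    using mpol_eval_nonzero[OF inf W] by (elim exE)
  then have x: "mpol_eval x B' \<noteq> 0" "mpol_eval x r1 \<noteq> 0" "mpol_eval x r2 \<noteq> 0"
    "mpol_eval x (?lc i A') \<noteq> 0" "mpol_eval x (?lc i B') \<noteq> 0"
    "mpol_eval x (?lc j A') \<noteq> 0" "mpol_eval x (?lc j B') \<noteq> 0"
    by (simp_all only: mpol_eval_mult mult_eq_0_iff de_Morgan_disj simp_thms)
  define q where "q = (\<lambda>v. x (\<nu> v))"
  have ins_rename: "insertion \<iota> \<theta> (rename \<nu> f) = insertion \<iota> (\<lambda>v. \<theta> (\<nu> v)) f"
    if "comm_ring_hom \<iota>" for \<iota> :: "'k \<Rightarrow> 's::comm_ring_1" and \<theta> f
  proof -
    have "insertion \<iota> \<theta> (rename \<nu> f) =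
        insertion (\<lambda>c. insertion \<iota> \<theta> (mconst c)) (\<lambda>v. insertion \<iota> \<theta> (mvar (\<nu> v))) f"
      unfolding rename_def by (rule comm_ring_hom.hom_insertion[OF insertion_hom[OF that]])
    also have "(\<lambda>c. insertion \<iota> \<theta> (mconst c)) = \<iota>"
      by (rule ext, rule insertion_mconst, rule comm_ring_hom.hom_zero[OF that])
    also have "(\<lambda>v. insertion \<iota> \<theta> (mvar (\<nu> v))) = (\<lambda>v. \<theta> (\<nu> v))"
      by (rule ext, rule insertion_mvar[OF that])
    finally show ?thesis .
  qed
  have evq: "mpol_eval q f = mpol_eval x (rename \<nu> f)" for f
    unfolding mpol_eval_eq_insertion ins_rename[OF comm_ring_hom_id] q_def ..
  interpret ps: pencil_slice A B d i j q
    by unfold_locales (use \<open>i \<noteq> j\<close> d x(1) in \<open>simp_all add: evq B'_def\<close>)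
  define sl :: "(nat, 'k) mpol \<Rightarrow> (nat, 'k) mpol" where
    "sl = insertion mconst (\<lambda>w. if w = \<nu> i then mvar 2 else if w = \<nu> j then mvar 3 else mconst (x w))"
  interpret sl: comm_ring_hom sl
    unfolding sl_def by (rule insertion_hom[OF comm_ring_hom_mconst])
  have slice: "ps.slice f = sl (rename \<nu> f)" for f
    unfolding sl_def ps.slice_def ins_rename[OF comm_ring_hom_mconst] inj_eq[OF \<nu>]
    by (simp only: q_def)
  have sl_nz: "sl f \<noteq> 0" if "mpol_eval x f \<noteq> 0" for f
  proof
    let ?y = "\<lambda>v::nat. if v = 2 then x (\<nu> i) else x (\<nu> j)"
    assume 0: "sl f = 0"
    have "mpol_eval ?y (sl f) = insertion (\<lambda>c. mpol_eval ?y (mconst c)) (\<lambda>w. mpol_eval ?y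
        (if w = \<nu> i then mvar 2 else if w = \<nu> j then mvar 3 else mconst (x w))) f"
      unfolding sl_def by (rule comm_ring_hom.hom_insertion[OF mpol_eval_hom])
    also have "\<dots> = mpol_eval x f"
      unfolding mpol_eval_eq_insertion[of x] by (rule insertion_cong[where I = UNIV]) auto
    finally show False using 0 that by simp
  qed
  have "\<nu> i \<noteq> \<nu> j" using \<nu> \<open>i \<noteq> j\<close> by (simp add: inj_eq)
  have sl_r1: "sl r1 \<in> mpols_in {2}"
    unfolding sl_def
    by (rule insertion_in_subring[OF is_subring_mpols_in _ _ r1(1)]) (auto simp: mpols_in_mvar)
  have sl_r2: "sl r2 \<in> mpols_in {3}"
    unfolding sl_def
    by (rule insertion_in_subring[OF is_subring_mpols_in _ _ r2(1)]) (auto simp: mpols_in_mvar)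
  have slice_cop: "c dvd 1" if c: "c dvd ps.slice A" "c dvd ps.slice B" for c
  proof -
    have c': "c dvd sl A'" "c dvd sl B'" using c by (simp_all add: slice A'_def B'_def)
    have "c dvd sl r1" unfolding r1(3) sl.hom_add sl.hom_mult
      by (intro dvd_add dvd_mult c')
    then have 1: "c \<in> mpols_in {2}" by (rule mpols_in_dvd[OF _ sl_r1 sl_nz[OF x(2)]])
    have "c dvd sl r2" unfolding r2(3) sl.hom_add sl.hom_mult
      by (intro dvd_add dvd_mult c')
    then have 2: "c \<in> mpols_in {3}" by (rule mpols_in_dvd[OF _ sl_r2 sl_nz[OF x(3)]])
    have "deg_in v c = 0" for v
      using 1 2 unfolding deg_in_eq_0_iff by (cases "v = 2") auto
    then have "c \<in> mpols_in {}" by (simp add: deg_in_eq_0_iff)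
    then obtain e where e: "c = mconst e" by (auto simp: mpols_in_empty_iff)
    have "c \<noteq> 0" using c'(2) sl_nz[OF x(1)] by auto
    then show ?thesis unfolding e by (intro is_unit_mconst) auto
  qed
  have deg2: "deg_in i f \<le> deg_in 2 (ps.slice f)" if "mpol_eval x (?lc i (rename \<nu> f)) \<noteq> 0" for f
  proof -
    let ?\<theta> = "\<lambda>v::nat. if v = 2 then [:0, 1:] else [:x (\<nu> j):]"
    have "deg_in i f = deg_in (\<nu> i) (rename \<nu> f)" by (rule deg_in_rename[OF \<nu>, symmetric])
    also have "\<dots> \<le> degree (insertion (\<lambda>c. [:c:]) (\<lambda>v. if v = \<nu> i then [:0, 1:] else [:x v:]) (rename \<nu> f))"
      by (rule deg_in_le_degree_specialized[OF that])
    also have "insertion (\<lambda>c. [:c:]) (\<lambda>v. if v = \<nu> i then [:0, 1:] else [:x v:]) (rename \<nu> f) =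
        insertion (\<lambda>c. insertion (\<lambda>c. [:c:]) ?\<theta> (mconst c)) (\<lambda>w. insertion (\<lambda>c. [:c:]) ?\<theta>
        (if w = \<nu> i then mvar 2 else if w = \<nu> j then mvar 3 else mconst (x w))) (rename \<nu> f)"
      using \<open>\<nu> i \<noteq> \<nu> j\<close>
      by (intro insertion_cong[where I = UNIV])
         (auto simp: insertion_mconst insertion_mvar[OF comm_ring_hom_poly_const])
    also have "\<dots> = insertion (\<lambda>c. [:c:]) ?\<theta> (sl (rename \<nu> f))"
      unfolding sl_def
      by (rule comm_ring_hom.hom_insertion[OF insertion_hom[OF comm_ring_hom_poly_const], symmetric])
    also have "degree \<dots> \<le> deg_in 2 (sl (rename \<nu> f))"
      by (rule degree_insertion_le) auto
    finally show ?thesis by (simp add: slice)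
  qed
  have deg3: "deg_in j f \<le> deg_in 3 (ps.slice f)" if "mpol_eval x (?lc j (rename \<nu> f)) \<noteq> 0" for f
  proof -
    let ?\<theta> = "\<lambda>v::nat. if v = 3 then [:0, 1:] else [:x (\<nu> i):]"
    have "deg_in j f = deg_in (\<nu> j) (rename \<nu> f)" by (rule deg_in_rename[OF \<nu>, symmetric])
    also have "\<dots> \<le> degree (insertion (\<lambda>c. [:c:]) (\<lambda>v. if v = \<nu> j then [:0, 1:] else [:x v:]) (rename \<nu> f))"
      by (rule deg_in_le_degree_specialized[OF that])
    also have "insertion (\<lambda>c. [:c:]) (\<lambda>v. if v = \<nu> j then [:0, 1:] else [:x v:]) (rename \<nu> f) =
        insertion (\<lambda>c. insertion (\<lambda>c. [:c:]) ?\<theta> (mconst c)) (\<lambda>w. insertion (\<lambda>c. [:c:]) ?\<theta>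
        (if w = \<nu> i then mvar 2 else if w = \<nu> j then mvar 3 else mconst (x w))) (rename \<nu> f)"
      using \<open>\<nu> i \<noteq> \<nu> j\<close>
      by (intro insertion_cong[where I = UNIV])
         (auto simp: insertion_mconst insertion_mvar[OF comm_ring_hom_poly_const])
    also have "\<dots> = insertion (\<lambda>c. [:c:]) ?\<theta> (sl (rename \<nu> f))"
      unfolding sl_def
      by (rule comm_ring_hom.hom_insertion[OF insertion_hom[OF comm_ring_hom_poly_const], symmetric])
    also have "degree \<dots> \<le> deg_in 3 (sl (rename \<nu> f))"
      by (rule degree_insertion_le) auto
    finally show ?thesis by (simp add: slice)
  qed
  have "good_slice A B d i j q"
    by unfold_locales
       (use slice_cop deg2[OF x(4)[unfolded A'_def]] deg2[OF x(5)[unfolded B'_def]]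
          deg3[OF x(6)[unfolded A'_def]] deg3[OF x(7)[unfolded B'_def]] in auto)
  then show ?thesis by (rule exI[where x = q])
qed

lemma comm_ring_hom_to_ac: "comm_ring_hom (to_ac :: 'k::field \<Rightarrow> 'k alg_closure)"
  by unfold_locales simp_all

lemma map_mpol_to_ac: "map_mpol to_ac f = to_ac_mpol f"
proof (induction f rule: poly_mapping_single_induct)
  case zero
  then show ?case
    by (intro poly_mapping_eqI)
       (simp add: comm_ring_hom.hom_zero[OF comm_ring_hom.map_mpol_hom[OF comm_ring_hom_to_ac]])
next
  case (add m c f)
  have "to_ac_mpol (Poly_Mapping.single m c + f) = Poly_Mapping.single m (to_ac c) + to_ac_mpol f"
    by (rule poly_mapping_eqI) (auto simp: lookup_add lookup_single when_def)
  then show ?case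
    using add by (simp add: comm_ring_hom.hom_add[OF comm_ring_hom.map_mpol_hom[OF comm_ring_hom_to_ac]]
        map_mpol_single[OF comm_ring_hom_to_ac])
qed

lemma pencil_member_to_ac:
  fixes A B M :: "('n::finite, 'k::field) mpol"
  assumes "M \<in> Pol d"
  shows "pencil_member to_ac A B (exponents d) (\<lambda>m. to_ac (coeffs_of d M m)) =
     to_ac_mpol A + to_ac_mpol B * to_ac_mpol M"
proof -
  have "(\<Sum>m\<in>exponents d. Poly_Mapping.single m (to_ac (coeffs_of d M m))) = to_ac_mpol M"
  proof (rule poly_mapping_eqI)
    fix m
    have "Poly_Mapping.lookup (\<Sum>m\<in>exponents d. Poly_Mapping.single m (to_ac (coeffs_of d M m))) m =
        (if m \<in> exponents d then to_ac (Poly_Mapping.lookup M m) else 0)"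
      using finite_exponents[of d]
      by (simp add: lookup_sum lookup_single when_def coeffs_of_def)
    then show "Poly_Mapping.lookup (\<Sum>m\<in>exponents d. Poly_Mapping.single m (to_ac (coeffs_of d M m))) m =
        Poly_Mapping.lookup (to_ac_mpol M) m"
      using assms by (auto simp: Pol_iff in_keys_iff)
  qed
  then show ?thesis by (simp add: pencil_member_def map_mpol_to_ac)
qed

lemma openin_nonvanishing:
  fixes Q :: "('n::finite \<Rightarrow>\<^sub>0 nat, 'k::field) mpol"
  assumes "Q \<in> mpols_in (exponents d)"
  shows "openin (Pol_topology d) {M \<in> Pol d. mpol_eval (coeffs_of d M) Q \<noteq> 0}"
proof -
  let ?V = "(exponents d \<rightarrow>\<^sub>E UNIV) - zero_locus (exponents d) {Q}"
  have "openin (zariski_topology (exponents d)) ?V"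
    unfolding openin_zariski_topology using assms by blast
  moreover have "{M \<in> Pol d. mpol_eval (coeffs_of d M) Q \<noteq> 0} = coeffs_of d -` ?V \<inter> Pol d"
    by (auto simp: zero_locus_def coeffs_of_def)
  ultimately show ?thesis
    unfolding Pol_topology_def openin_pullback_topology by blast
qed

text \<open>Only one of two factors can have degree \<open>D i0\<close> in \<open>i0\<close>, as the
  degrees add up to at most \<open>D i0\<close>. It is therefore the full factor for every
  \<open>j\<close>, and its cofactor has degree 0 in every variable.\<close>

lemma irreducible_if_full_degrees:
  fixes f :: "('n::finite, 'e::field) mpol"
  assumes "i0 \<noteq> j0" and bound: "\<And>v. deg_in v f \<le> D v" "\<And>v. D v > 0"
    and full: "\<And>j G H. j \<noteq> i0 \<Longrightarrow> f = G * H \<Longrightarrow> G * H \<noteq> 0 \<and>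
      (D i0 \<le> deg_in i0 G \<and> D j \<le> deg_in j G \<or> D i0 \<le> deg_in i0 H \<and> D j \<le> deg_in j H)"
  shows "irreducible f"
proof -
  \<comment> \<open>The factorisation \<open>f = f * 1\<close> is used here and again below: the
    constant 1 has degree 0, less than \<open>D i0\<close>, so \<open>f\<close> itself is the full
    factor.\<close>
  have f0: "f \<noteq> 0" using full[of j0 f 1] assms(1) by auto
  have "D i0 \<le> deg_in i0 f"
    using full[of j0 f 1] assms(1) bound(2)[of i0] by auto
  then have pos: "deg_in i0 f > 0" using bound(2)[of i0] by linarith
  have "\<not> f dvd 1"
  proof
    assume "f dvd 1"
    then obtain w where w: "1 = f * w" by (rule dvdE)
    then have "w \<noteq> 0" by auto
    then have "deg_in i0 (1 :: ('n, 'e) mpol) = deg_in i0 f + deg_in i0 w"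
      unfolding w by (rule deg_in_mult_finite[OF f0])
    then show False using pos by simp
  qed
  moreover have unit: "H dvd 1" if GH: "f = G * H" and G: "D i0 \<le> deg_in i0 G" for G H
  proof -
    have nz: "G \<noteq> 0" "H \<noteq> 0" using f0 GH by auto
    have deg: "deg_in v G + deg_in v H \<le> D v" for v
      using bound(1)[of v] unfolding GH deg_in_mult_finite[OF nz] .
    have H0: "deg_in i0 H = 0" using deg[of i0] G by linarith
    have "deg_in v H = 0" for v
    proof (cases "v = i0")
      case False
      then have "D v \<le> deg_in v G"
        using full[OF False GH] H0 bound(2)[of i0] by auto
      then show ?thesis using deg[of v] by linarith
    qed (use H0 in simp)
    then have "H \<in> mpols_in {}" by (simp add: deg_in_eq_0_iff)
    then obtain e where "H = mconst e" by (auto simp: mpols_in_empty_iff)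
    then show ?thesis using nz(2) is_unit_mconst[of e] by (metis mconst_eq_0_iff)
  qed
  moreover have "G dvd 1 \<or> H dvd 1" if GH: "f = G * H" for G H
    using full[of j0 G H] assms(1) GH unit[OF GH] unit[of H G] by (auto simp: mult.commute)
  ultimately show ?thesis using f0 unfolding irreducible_def by blast
qed

theorem theorem1p4:
  fixes A B :: "('n::finite, 'k::field) mpol"
    and d :: "'n \<Rightarrow> nat"
  assumes "CARD('n) \<ge> 2"
    and "infinite (UNIV :: 'k set)"
    and "A \<noteq> 0" and "B \<noteq> 0"
    and "relatively_prime A B"
    and "\<And>i. d i > 0"
  shows "\<exists>U. openin (Pol_topology d) U \<and> U \<noteq> {} \<and> to_ac_mpol ` U \<subseteq> Irr A B"
proof -
  obtain i0 j0 :: 'n where ij: "i0 \<noteq> j0"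
    using assms(1) by (metis card_2_iff' ex_card iso_tuple_UNIV_I subsetI)
  let ?E = "exponents d"
  define D where "D = (\<lambda>v. max (deg_in v A) (deg_in v B + d v))"
  define member where "member = (\<lambda>u :: ('n \<Rightarrow>\<^sub>0 nat) \<Rightarrow> 'k. pencil_member to_ac A B ?E (\<lambda>m. to_ac (u m)))"
  define \<Phi> where "\<Phi> = (\<lambda>j u. \<forall>G H. member u = G * H \<longrightarrow> G * H \<noteq> 0 \<and>
      (D i0 \<le> deg_in i0 G \<and> D j \<le> deg_in j G \<or> D i0 \<le> deg_in i0 H \<and> D j \<le> deg_in j H))"
  \<comment> \<open>One slice for each pair \<open>i0\<close>, \<open>j\<close>; the conditions for
    the finitely many \<open>j\<close> are intersected afterwards.\<close>
  have each: "\<exists>Q\<in>mpols_in ?E. (\<exists>u. mpol_eval u Q \<noteq> 0) \<and> (\<forall>u. mpol_eval u Q \<noteq> 0 \<longrightarrow> \<Phi> j u)"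
    if "j \<in> UNIV - {i0}" for j
  proof -
    have "i0 \<noteq> j" using that by auto
    have "\<exists>q. good_slice A B d i0 j q"
      by (rule exists_good_slice[OF assms(2-5) \<open>i0 \<noteq> j\<close>]) (rule assms(6))+
    then obtain q where "good_slice A B d i0 j q" by (elim exE)
    then interpret good_slice A B d i0 j q .
    show ?thesis
      using generic_parameters[OF comm_ring_hom_to_ac assms(2)]
      unfolding \<Phi>_def member_def D_def full_degree_def bound_def .
  qed
  have "\<exists>Q\<in>mpols_in ?E. (\<exists>u. mpol_eval u Q \<noteq> 0) \<and>
      (\<forall>u. mpol_eval u Q \<noteq> 0 \<longrightarrow> (\<forall>j\<in>UNIV - {i0}. \<Phi> j u))"
    by (rule mpol_generic_finite_conj[OF assms(2) finite each])
  then obtain Q where Q: "Q \<in> mpols_in ?E" "\<exists>u. mpol_eval u Q \<noteq> 0"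
      "\<forall>u. mpol_eval u Q \<noteq> 0 \<longrightarrow> (\<forall>j\<in>UNIV - {i0}. \<Phi> j u)"
    by (elim bexE conjE)
  let ?U = "{M \<in> Pol d. mpol_eval (coeffs_of d M) Q \<noteq> 0}"
  have "openin (Pol_topology d) ?U" by (rule openin_nonvanishing[OF Q(1)])
  moreover have "?U \<noteq> {}"
  proof -
    obtain u where u: "mpol_eval u Q \<noteq> 0" using Q(2) by blast
    have "restrict u ?E \<in> coeffs_of d ` (Pol d :: ('n, 'k) mpol set)"
      using bij_betw_imp_surj_on[OF bij_betw_coeffs_of[of d, where 'k = 'k]] by simp
    then obtain M :: "('n, 'k) mpol" where M: "M \<in> Pol d" "coeffs_of d M = restrict u ?E" by auto
    \<comment> \<open>\<open>Q\<close> contains only indeterminates from \<open>exponents d\<close>,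
      so the values of \<open>u\<close> elsewhere do not matter.\<close>
    have "mpol_eval (restrict u ?E) Q = mpol_eval u Q"
      unfolding mpol_eval_eq_insertion by (rule insertion_cong[OF Q(1)]) auto
    then show ?thesis using M u by auto
  qed
  moreover have "to_ac_mpol M \<in> Irr A B" if M: "M \<in> ?U" for M
  proof -
    have eq: "member (coeffs_of d M) = to_ac_mpol A + to_ac_mpol B * to_ac_mpol M"
      unfolding member_def using M pencil_member_to_ac by blast
    have "irreducible (member (coeffs_of d M))"
    proof (rule irreducible_if_full_degrees[OF ij, of _ D])
      show "deg_in v (member (coeffs_of d M)) \<le> D v" for v
        unfolding member_def D_def
        by (rule deg_in_pencil_member) (auto simp: exponents_def finite_exponents[unfolded exponents_def])
      show "D v > 0" for v using assms(6)[of v] by (simp add: D_def less_max_iff_disj)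
      fix j G H assume "j \<noteq> i0" "member (coeffs_of d M) = G * H"
      then show "G * H \<noteq> 0 \<and> (D i0 \<le> deg_in i0 G \<and> D j \<le> deg_in j G \<or>
          D i0 \<le> deg_in i0 H \<and> D j \<le> deg_in j H)"
        using Q(3)[rule_format, of "coeffs_of d M" j] M unfolding \<Phi>_def by blast
    qed
    then show ?thesis unfolding Irr_def eq by simp
  qed
  ultimately show ?thesis by blast
qed

end
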